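(* Let $(\Omega,\mathcal{F},(\mathcal{F}_t)_{t\in[0,T]},\mathbb{P})$ be a filtered probability space satisfying the usual conditions, and let $Y$ be a real-valued pure-jump Lévy process with drift on it, with Lévy measure $\nu$, such that $\mathcal{F}$ is the completion of $\sigma(Y)$. Let $f\colon[0,T]\times\mathbb{D}_1\times\mathbb{D}_1\to\mathbb{R}$ satisfy conditions (i)–(iv) of the context, let $g$ be the associated function and let $\Psi_g$ be the universal representation function, both as defined in the context. Let $H,G$ be real-valued càdlàg adapted processes such that $H_t,G_t\in\mathcal{D}_{1,2}$ for all $t\in[0,T]$, let $X$ be the solution of $$X_t=H_t+\int_{(0,t]}g(s,G,X)\,\mathrm{d}Y_s,\qquad t\in[0,T],$$ and assume $X_t\in L^2(\Omega,\mathcal{F},\mathbb{P})$ for all $t\in[0,T]$. Then for all $t\in[0,T]$, $$D_{u,v}X_t=\Psi_g\big(H+D_{u,v}H,\;G+D_{u,v}G,\;Y+v\mathbf{1}_{[u,T]}\big)_t-\Psi_g(H,G,Y)_t$$ (as equivalence classes with respect to $\mathbb{P}\otimes\lambda\otimes\nu$, where $(u,v)\in[0,T]\times\mathbb{R}$), whenever the right-hand side is square integrable with respect to $\mathbb{P}\otimes\lambda\otimes\nu$.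
   Context: $T\in(0,\infty)$; $\mathbb{D}_1$ is the space of càdlàg functions $[0,T]\to\mathbb{R}$, equipped with the Borel $\sigma$-field $\mathcal{B}(\mathbb{D}_1)$ of the Skorohod topology (which coincides with the $\sigma$-field generated by the evaluations $x\mapsto x(t)$); $x^t(s)=x(s\wedge t)$; $\lambda$ is Lebesgue measure on $[0,T]$. Lévy process: with $N$ the Poisson random measure of $Y$ and $\tilde N$ its compensated version, for some $\gamma\in\mathbb{R}$, almost surely $Y_t=\gamma t+\int_{(0,t]\times\{|x|>1\}}x\,N(ds,dx)+\int_{(0,t]\times\{|x|\le1\}}x\,\tilde N(ds,dx)$, $t\in[0,T]$. Conditions on $f$: (i) $t\mapsto f(t,\zeta,\gamma)$ is càdlàg for all $\zeta,\gamma\in\mathbb{D}_1$; (ii) $f$ is $\mathcal{B}([0,T])\otimes\mathcal{B}(\mathbb{D}_1)\otimes\mathcal{B}(\mathbb{D}_1)$-measurable; (iii) $f(t,\zeta,\gamma)=f(t,\zeta^t,\gamma^t)$ for all $t,\zeta,\gamma$; (iv) there is a $\mathcal{B}([0,T])\otimes\mathcal{B}(\mathbb{D}_1)$-measurable $C\colon[0,T]\times\mathbb{D}_1\to(0,\infty)$, with $t\mapsto C(t,\zeta)$ càdlàg, such that $|f(t,\zeta,\gamma)|\le C(t,\zeta)(1+\sup_{0\le s\le t}|\gamma(s)|)$ and $|f(t,\zeta,\gamma_1)-f(t,\zeta,\gamma_2)|\le C(t,\zeta)\sup_{0\le s\le t}|\gamma_1(s)-\gamma_2(s)|$ for all arguments.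 Function $g$: $g(t,\zeta,\gamma)=f(t-,\zeta,\gamma)$ (left limit in $t$) for $t\in(0,T]$ and $g(0,\zeta,\gamma)=f(0,\zeta,\gamma)$. Function $\Psi_g$: a measurable function $\Psi_g\colon\mathbb{D}_1\times\mathbb{D}_1\times\mathbb{D}_1\to\mathbb{D}_1$ (product of the Borel $\sigma$-fields $\mathcal{B}(\mathbb{D}_1)$ on the domain, $\mathcal{B}(\mathbb{D}_1)$ on the target) depending only on $g$, such that for all real-valued càdlàg adapted processes $H',G'$ and all real-valued càdlàg semimartingales $Y'$ the process $\Psi_g(H',G',Y')$ (applied pathwise) is, up to indistinguishability, the unique solution $X'$ of $X'_t=H'_t+\int_{(0,t]} g(s,G',X')\,\mathrm{d}Y'_s$, $t\in[0,T]$. Such a function exists under (i)–(iv). Malliavin derivative: let $Z\in L^2(\Omega,\mathcal{F},\mathbb{P})$ and let $\psi_Z\colon\mathbb{D}_1\to\mathbb{R}$ be measurable with $Z=\psi_Z(Y)$ $\mathbb{P}$-a.s. For $u\in[0,T]$, $v\in\mathbb{R}$, define $D_{u,v}Z:=\psi_Z(Y+v\mathbf{1}_{[u,T]})-\psi_Z(Y)$, as an equivalence class in $L^2(\Omega\times[0,T]\times\mathbb{R},\mathcal{F}\otimes\mathcal{B}([0,T]\times\mathbb{R}),\mathbb{P}\otimes\lambda\otimes\nu)$, whenever $\mathbb{E}\int_0^T\int_{\mathbb{R}}|D_{u,v}Z|^2\,\nu(dv)\,du<\infty$. $\mathcal{D}_{1,2}$ is the set of all $Z$ satisfying this condition. For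 the processes $H$ and $G$: there are measurable $\phi_H,\phi_G\colon\mathbb{D}_1\to\mathbb{D}_1$ with $H=\phi_H(Y)$, $G=\phi_G(Y)$ $\mathbb{P}$-a.s., such that $\phi_H(\cdot)(t)$ and $\phi_G(\cdot)(t)$ represent $H_t$ and $G_t$ for all $t\in[0,T]$. If $H_t,G_t\in\mathcal{D}_{1,2}$ for all $t$, define the $\mathbb{D}_1$-valued objects $D_{u,v}H=\phi_H(Y+v\mathbf{1}_{[u,T]})-\phi_H(Y)$ and $D_{u,v}G=\phi_G(Y+v\mathbf{1}_{[u,T]})-\phi_G(Y)$. *)

theory Defs
  imports "HOL-Probability.Probability"
begin

section \<open>Path space\<close>

definition cadlag_on :: "real \<Rightarrow> (real \<Rightarrow> real) \<Rightarrow> bool" where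
  "cadlag_on T x \<longleftrightarrow>
     (\<forall>t\<in>{0..<T}. (x \<longlongrightarrow> x t) (at_right t)) \<and>
     (\<forall>t\<in>{0<..T}. \<exists>l. (x \<longlongrightarrow> l) (at_left t))"

definition caglad_on :: "real \<Rightarrow> (real \<Rightarrow> real) \<Rightarrow> bool" where
  "caglad_on T x \<longleftrightarrow>
     (\<forall>t\<in>{0<..T}. (x \<longlongrightarrow> x t) (at_left t)) \<and>
     (\<forall>t\<in>{0..<T}. \<exists>l. (x \<longlongrightarrow> l) (at_right t))"

text \<open>A path on \<open>[0,T]\<close> is an extensional function, i.e. \<open>undefined\<close> off \<open>[0,T]\<close>. The
  \<open>\<sigma>\<close>-algebra is the one generated by the evaluations, which is the Borel \<open>\<sigma>\<close>-algebra of the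
  Skorohod topology.\<close>

definition DD :: "real \<Rightarrow> (real \<Rightarrow> real) measure" where
  "DD T = restrict_space (Pi\<^sub>M {0..T} (\<lambda>_. borel)) {x. cadlag_on T x}"

definition path_add :: "real \<Rightarrow> (real \<Rightarrow> real) \<Rightarrow> (real \<Rightarrow> real) \<Rightarrow> real \<Rightarrow> real" where
  "path_add T x y = (\<lambda>s\<in>{0..T}. x s + y s)"

definition path_diff :: "real \<Rightarrow> (real \<Rightarrow> real) \<Rightarrow> (real \<Rightarrow> real) \<Rightarrow> real \<Rightarrow> real" where
  "path_diff T x y = (\<lambda>s\<in>{0..T}. x s - y s)"

definition stop_path :: "real \<Rightarrow> (real \<Rightarrow> real) \<Rightarrow> real \<Rightarrow> real \<Rightarrow> real" where
  "stop_path T x t = (\<lambda>s\<in>{0..T}. x (min s t))"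

text \<open>The path \<open>y + v 1\<^bsub>[u,T]\<^esub>\<close>.\<close>

definition shift_path :: "real \<Rightarrow> (real \<Rightarrow> real) \<Rightarrow> real \<Rightarrow> real \<Rightarrow> real \<Rightarrow> real" where
  "shift_path T y u v = path_add T y (\<lambda>s. v * indicator {u..T} s)"

definition jump :: "(real \<Rightarrow> real) \<Rightarrow> real \<Rightarrow> real" where
  "jump y s = y s - Lim (at_left s) y"

abbreviation leb :: "real \<Rightarrow> real measure" where
  "leb T \<equiv> restrict_space lborel {0..T}"

definition square_integrable :: "'b measure \<Rightarrow> ('b \<Rightarrow> real) \<Rightarrow> bool" where
  "square_integrable N h \<longleftrightarrow> h \<in> borel_measurable N \<and> integrable N (\<lambda>x. (h x)\<^sup>2)"


section \<open>Filtered probability spaces and processes\<close>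

text \<open>A filtration indexed by \<open>[0,T]\<close> is given by a function on the reals of which only the values
  at points of \<open>[0,T]\<close> are used. A process is a function of the sample point and the time.\<close>

definition usual_filtered_space :: "real \<Rightarrow> 'a measure \<Rightarrow> (real \<Rightarrow> 'a measure) \<Rightarrow> bool" where
  "usual_filtered_space T M F \<longleftrightarrow>
     prob_space M \<and> complete_measure M \<and>
     (\<forall>t\<in>{0..T}. subalgebra M (F t)) \<and>
     (\<forall>s\<in>{0..T}. \<forall>t\<in>{s..T}. sets (F s) \<subseteq> sets (F t)) \<and>
     null_sets M \<subseteq> sets (F 0) \<and>
     (\<forall>t\<in>{0..<T}. sets (F t) = (\<Inter>s\<in>{t<..T}. sets (F s)))"

definition adapted :: "real \<Rightarrow> (real \<Rightarrow> 'a measure) \<Rightarrow> ('a \<Rightarrow> real \<Rightarrow> real) \<Rightarrow> bool" where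
  "adapted T F X \<longleftrightarrow> (\<forall>t\<in>{0..T}. (\<lambda>\<omega>. X \<omega> t) \<in> borel_measurable (F t))"

definition cadlag_adapted ::
  "real \<Rightarrow> 'a measure \<Rightarrow> (real \<Rightarrow> 'a measure) \<Rightarrow> ('a \<Rightarrow> real \<Rightarrow> real) \<Rightarrow> bool" where
  "cadlag_adapted T M F X \<longleftrightarrow> (\<forall>\<omega>\<in>space M. X \<omega> \<in> space (DD T)) \<and> adapted T F X"

definition stop_time ::
  "real \<Rightarrow> 'a measure \<Rightarrow> (real \<Rightarrow> 'a measure) \<Rightarrow> ('a \<Rightarrow> real) \<Rightarrow> bool" where
  "stop_time T M F \<tau> \<longleftrightarrow>
     (\<forall>\<omega>\<in>space M. \<tau> \<omega> \<in> {0..T}) \<and> (\<forall>t\<in>{0..T}. {\<omega>\<in>space M. \<tau> \<omega> \<le> t} \<in> sets (F t))"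

text \<open>The \<open>\<sigma>\<close>-algebra of events prior to \<open>\<tau>\<close>.\<close>

definition stop_sigma ::
  "real \<Rightarrow> 'a measure \<Rightarrow> (real \<Rightarrow> 'a measure) \<Rightarrow> ('a \<Rightarrow> real) \<Rightarrow> 'a measure" where
  "stop_sigma T M F \<tau> =
     sigma (space M) {A \<in> sets M. \<forall>t\<in>{0..T}. {\<omega>\<in>A. \<tau> \<omega> \<le> t} \<in> sets (F t)}"

definition martingale ::
  "real \<Rightarrow> 'a measure \<Rightarrow> (real \<Rightarrow> 'a measure) \<Rightarrow> ('a \<Rightarrow> real \<Rightarrow> real) \<Rightarrow> bool" where
  "martingale T M F X \<longleftrightarrow>
     adapted T F X \<and>
     (\<forall>t\<in>{0..T}. integrable M (\<lambda>\<omega>. X \<omega> t)) \<and>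
     (\<forall>s\<in>{0..T}. \<forall>t\<in>{s..T}. AE \<omega> in M. real_cond_exp M (F s) (\<lambda>\<omega>. X \<omega> t) \<omega> = X \<omega> s)"

definition local_martingale ::
  "real \<Rightarrow> 'a measure \<Rightarrow> (real \<Rightarrow> 'a measure) \<Rightarrow> ('a \<Rightarrow> real \<Rightarrow> real) \<Rightarrow> bool" where
  "local_martingale T M F X \<longleftrightarrow>
     cadlag_adapted T M F X \<and>
     (\<exists>\<tau> :: nat \<Rightarrow> 'a \<Rightarrow> real.
        (\<forall>n. stop_time T M F (\<tau> n)) \<and>
        (\<forall>\<omega>\<in>space M. mono (\<lambda>n. \<tau> n \<omega>)) \<and>
        (AE \<omega> in M. \<exists>n. \<tau> n \<omega> = T) \<and>
        (\<forall>n. martingale T M F (\<lambda>\<omega>. stop_path T (X \<omega>) (\<tau> n \<omega>))))"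

definition finite_variation_on :: "real \<Rightarrow> (real \<Rightarrow> real) \<Rightarrow> bool" where
  "finite_variation_on T a \<longleftrightarrow>
     (\<exists>K. \<forall>(n::nat) (p :: nat \<Rightarrow> real).
        mono_on {..n} p \<and> p ` {..n} \<subseteq> {0..T} \<longrightarrow> (\<Sum>i<n. \<bar>a (p (Suc i)) - a (p i)\<bar>) \<le> K)"

definition semimartingale ::
  "real \<Rightarrow> 'a measure \<Rightarrow> (real \<Rightarrow> 'a measure) \<Rightarrow> ('a \<Rightarrow> real \<Rightarrow> real) \<Rightarrow> bool" where
  "semimartingale T M F Y \<longleftrightarrow>
     cadlag_adapted T M F Y \<and>
     (\<exists>N A. local_martingale T M F N \<and> cadlag_adapted T M F A \<and>
        (\<forall>\<omega>\<in>space M. finite_variation_on T (A \<omega>) \<and> N \<omega> 0 = 0 \<and> A \<omega> 0 = 0 \<and>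
           (\<forall>t\<in>{0..T}. Y \<omega> t = Y \<omega> 0 + N \<omega> t + A \<omega> t)))"


section \<open>Stochastic integration\<close>

text \<open>The tuple \<open>(n, K\<^sub>0, \<tau>, K)\<close> stands for the simple predictable process
  \<open>K\<^sub>0 1\<^bsub>{0}\<^esub> + \<Sum>i<n. K i 1\<^bsub>(\<tau> i, \<tau> (i+1)]\<^esub>\<close>.\<close>

type_synonym 'a simple_data = "nat \<times> ('a \<Rightarrow> real) \<times> (nat \<Rightarrow> 'a \<Rightarrow> real) \<times> (nat \<Rightarrow> 'a \<Rightarrow> real)"

definition simple_predictable ::
  "real \<Rightarrow> 'a measure \<Rightarrow> (real \<Rightarrow> 'a measure) \<Rightarrow> 'a simple_data \<Rightarrow> bool" where
  "simple_predictable T M F = (\<lambda>(n, K0, \<tau>, K).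
     K0 \<in> borel_measurable (F 0) \<and>
     (\<forall>i\<le>n. stop_time T M F (\<tau> i)) \<and>
     (\<forall>\<omega>\<in>space M. \<tau> 0 \<omega> = 0 \<and> mono_on {..n} (\<lambda>i. \<tau> i \<omega>)) \<and>
     (\<forall>i<n. K i \<in> borel_measurable (stop_sigma T M F (\<tau> i))))"

definition simple_process :: "'a simple_data \<Rightarrow> 'a \<Rightarrow> real \<Rightarrow> real" where
  "simple_process = (\<lambda>(n, K0, \<tau>, K) \<omega> s.
     K0 \<omega> * indicator {0} s + (\<Sum>i<n. K i \<omega> * indicator {\<tau> i \<omega><..\<tau> (Suc i) \<omega>} s))"

text \<open>The integral is taken over \<open>(0,t]\<close>, so \<open>K\<^sub>0\<close> does not contribute.\<close>

definition simple_integral ::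
  "'a simple_data \<Rightarrow> ('a \<Rightarrow> real \<Rightarrow> real) \<Rightarrow> 'a \<Rightarrow> real \<Rightarrow> real" where
  "simple_integral = (\<lambda>(n, K0, \<tau>, K) Y \<omega> t.
     (\<Sum>i<n. K i \<omega> * (Y \<omega> (min (\<tau> (Suc i) \<omega>) t) - Y \<omega> (min (\<tau> i \<omega>) t))))"

text \<open>Convergence in probability, uniformly on \<open>[0,T]\<close>.\<close>

definition ucp_tendsto ::
  "real \<Rightarrow> 'a measure \<Rightarrow> (nat \<Rightarrow> 'a \<Rightarrow> real \<Rightarrow> real) \<Rightarrow> ('a \<Rightarrow> real \<Rightarrow> real) \<Rightarrow> bool" where
  "ucp_tendsto T M Xs X \<longleftrightarrow>
     (\<forall>\<epsilon>>0. (\<lambda>n. measure M {\<omega>\<in>space M. \<exists>s\<in>{0..T}. \<bar>Xs n \<omega> s - X \<omega> s\<bar> > \<epsilon>}) \<longlonglongrightarrow> 0)"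

text \<open>\<open>I\<close> is the process \<open>t \<mapsto> \<integral>\<^bsub>(0,t]\<^esub> V dY\<close> for a left-continuous adapted integrand \<open>V\<close> with right
  limits: the continuous extension, with respect to ucp convergence, of the elementary integral
  from simple predictable processes.\<close>

definition is_stoch_integral ::
  "real \<Rightarrow> 'a measure \<Rightarrow> (real \<Rightarrow> 'a measure) \<Rightarrow> ('a \<Rightarrow> real \<Rightarrow> real) \<Rightarrow> ('a \<Rightarrow> real \<Rightarrow> real)
     \<Rightarrow> ('a \<Rightarrow> real \<Rightarrow> real) \<Rightarrow> bool" where
  "is_stoch_integral T M F V Y I \<longleftrightarrow>
     (\<forall>\<omega>\<in>space M. caglad_on T (V \<omega>)) \<and> adapted T F V \<and> cadlag_adapted T M F I \<and>
     (\<exists>S. (\<forall>n. simple_predictable T M F (S n)) \<and> ucp_tendsto T M (\<lambda>n. simple_process (S n)) V) \<and>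
     (\<forall>S. (\<forall>n. simple_predictable T M F (S n)) \<and> ucp_tendsto T M (\<lambda>n. simple_process (S n)) V
        \<longrightarrow> ucp_tendsto T M (\<lambda>n. simple_integral (S n) Y) I)"

text \<open>\<open>X\<close> solves \<open>X\<^sub>t = H\<^sub>t + \<integral>\<^bsub>(0,t]\<^esub> g(s,G,X) dY\<^sub>s\<close>, \<open>t \<in> [0,T]\<close>.\<close>

definition sde_solution ::
  "real \<Rightarrow> 'a measure \<Rightarrow> (real \<Rightarrow> 'a measure) \<Rightarrow> (real \<Rightarrow> (real \<Rightarrow> real) \<Rightarrow> (real \<Rightarrow> real) \<Rightarrow> real)
     \<Rightarrow> ('a \<Rightarrow> real \<Rightarrow> real) \<Rightarrow> ('a \<Rightarrow> real \<Rightarrow> real) \<Rightarrow> ('a \<Rightarrow> real \<Rightarrow> real)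
     \<Rightarrow> ('a \<Rightarrow> real \<Rightarrow> real) \<Rightarrow> bool" where
  "sde_solution T M F g H G Y X \<longleftrightarrow>
     cadlag_adapted T M F X \<and>
     (\<exists>I. is_stoch_integral T M F (\<lambda>\<omega> s. g s (G \<omega>) (X \<omega>)) Y I \<and>
        (AE \<omega> in M. \<forall>t\<in>{0..T}. X \<omega> t = H \<omega> t + I \<omega> t))"


section \<open>Coefficients and the universal representation of solutions\<close>

definition coefficient_conditions ::
  "real \<Rightarrow> (real \<Rightarrow> (real \<Rightarrow> real) \<Rightarrow> (real \<Rightarrow> real) \<Rightarrow> real) \<Rightarrow> bool" where
  "coefficient_conditions T f \<longleftrightarrow>
     (\<forall>\<zeta>\<in>space (DD T). \<forall>\<gamma>\<in>space (DD T). cadlag_on T (\<lambda>t. f t \<zeta> \<gamma>)) \<and>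
     (\<lambda>(t, \<zeta>, \<gamma>). f t \<zeta> \<gamma>)
        \<in> borel_measurable (restrict_space borel {0..T} \<Otimes>\<^sub>M (DD T \<Otimes>\<^sub>M DD T)) \<and>
     (\<forall>t\<in>{0..T}. \<forall>\<zeta>\<in>space (DD T). \<forall>\<gamma>\<in>space (DD T).
        f t \<zeta> \<gamma> = f t (stop_path T \<zeta> t) (stop_path T \<gamma> t)) \<and>
     (\<exists>C :: real \<Rightarrow> (real \<Rightarrow> real) \<Rightarrow> real.
        (\<lambda>(t, \<zeta>). C t \<zeta>) \<in> borel_measurable (restrict_space borel {0..T} \<Otimes>\<^sub>M DD T) \<and>
        (\<forall>\<zeta>\<in>space (DD T). cadlag_on T (\<lambda>t. C t \<zeta>)) \<and>
        (\<forall>t\<in>{0..T}. \<forall>\<zeta>\<in>space (DD T). 0 < C t \<zeta>) \<and>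
        (\<forall>t\<in>{0..T}. \<forall>\<zeta>\<in>space (DD T). \<forall>\<gamma>\<in>space (DD T).
           \<bar>f t \<zeta> \<gamma>\<bar> \<le> C t \<zeta> * (1 + (SUP s\<in>{0..t}. \<bar>\<gamma> s\<bar>))) \<and>
        (\<forall>t\<in>{0..T}. \<forall>\<zeta>\<in>space (DD T). \<forall>\<gamma>1\<in>space (DD T). \<forall>\<gamma>2\<in>space (DD T).
           \<bar>f t \<zeta> \<gamma>1 - f t \<zeta> \<gamma>2\<bar> \<le> C t \<zeta> * (SUP s\<in>{0..t}. \<bar>\<gamma>1 s - \<gamma>2 s\<bar>)))"

definition left_lim_coeff ::
  "(real \<Rightarrow> (real \<Rightarrow> real) \<Rightarrow> (real \<Rightarrow> real) \<Rightarrow> real)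
     \<Rightarrow> real \<Rightarrow> (real \<Rightarrow> real) \<Rightarrow> (real \<Rightarrow> real) \<Rightarrow> real" where
  "left_lim_coeff f t \<zeta> \<gamma> = (if t = 0 then f 0 \<zeta> \<gamma> else Lim (at_left t) (\<lambda>s. f s \<zeta> \<gamma>))"

text \<open>One map \<open>\<Psi>\<close> serves all filtered probability spaces (whose sample points have type \<open>'a\<close>).\<close>

definition universal_representation ::
  "'a itself \<Rightarrow> real \<Rightarrow> (real \<Rightarrow> (real \<Rightarrow> real) \<Rightarrow> (real \<Rightarrow> real) \<Rightarrow> real)
     \<Rightarrow> ((real \<Rightarrow> real) \<Rightarrow> (real \<Rightarrow> real) \<Rightarrow> (real \<Rightarrow> real) \<Rightarrow> real \<Rightarrow> real) \<Rightarrow> bool" where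
  "universal_representation (_ :: 'a itself) T g \<Psi> \<longleftrightarrow>
     (\<lambda>(h, \<zeta>, y). \<Psi> h \<zeta> y) \<in> measurable (DD T \<Otimes>\<^sub>M (DD T \<Otimes>\<^sub>M DD T)) (DD T) \<and>
     (\<forall>(M :: 'a measure) F H G Y.
        usual_filtered_space T M F \<and> cadlag_adapted T M F H \<and> cadlag_adapted T M F G \<and>
        semimartingale T M F Y \<longrightarrow>
          sde_solution T M F g H G Y (\<lambda>\<omega>. \<Psi> (H \<omega>) (G \<omega>) (Y \<omega>)) \<and>
          (\<forall>X. sde_solution T M F g H G Y X \<longrightarrow>
             (AE \<omega> in M. \<forall>t\<in>{0..T}. X \<omega> t = \<Psi> (H \<omega>) (G \<omega>) (Y \<omega>) t)))"


section \<open>Levy processes\<close>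

definition levy_process ::
  "real \<Rightarrow> 'a measure \<Rightarrow> (real \<Rightarrow> 'a measure) \<Rightarrow> ('a \<Rightarrow> real \<Rightarrow> real) \<Rightarrow> bool" where
  "levy_process T M F Y \<longleftrightarrow>
     cadlag_adapted T M F Y \<and>
     (AE \<omega> in M. Y \<omega> 0 = 0) \<and>
     (\<forall>s\<in>{0..T}. \<forall>t\<in>{s..T}.
        prob_space.indep_set M (sets (F s))
          (sets (vimage_algebra (space M) (\<lambda>\<omega>. Y \<omega> t - Y \<omega> s) borel))) \<and>
     (\<forall>s\<in>{0..T}. \<forall>t\<in>{s..T}.
        distr M borel (\<lambda>\<omega>. Y \<omega> t - Y \<omega> s) = distr M borel (\<lambda>\<omega>. Y \<omega> (t - s)))"

definition levy_measure :: "real measure \<Rightarrow> bool" where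
  "levy_measure \<nu> \<longleftrightarrow>
     sets \<nu> = sets borel \<and> emeasure \<nu> {0} = 0 \<and> (\<integral>\<^sup>+x. ennreal (min 1 (x\<^sup>2)) \<partial>\<nu>) < \<infinity>"

definition poisson_random_measure ::
  "'a measure \<Rightarrow> ('a \<Rightarrow> 'b measure) \<Rightarrow> 'b measure \<Rightarrow> bool" where
  "poisson_random_measure M N \<mu> \<longleftrightarrow>
     (\<forall>\<omega>\<in>space M. sets (N \<omega>) = sets \<mu>) \<and>
     (\<forall>B\<in>sets \<mu>. (\<lambda>\<omega>. emeasure (N \<omega>) B) \<in> borel_measurable M) \<and>
     (\<forall>B\<in>sets \<mu>. emeasure \<mu> B < \<infinity> \<longrightarrow>
        (\<forall>k::nat. measure M {\<omega>\<in>space M. emeasure (N \<omega>) B = of_nat k} =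
           measure \<mu> B ^ k / fact k * exp (- measure \<mu> B))) \<and>
     (\<forall>B\<in>sets \<mu>. emeasure \<mu> B = \<infinity> \<longrightarrow> (AE \<omega> in M. emeasure (N \<omega>) B = \<infinity>)) \<and>
     (\<forall>(n::nat) B. (\<forall>i<n. B i \<in> sets \<mu>) \<and> disjoint_family_on B {..<n} \<longrightarrow>
        prob_space.indep_vars M (\<lambda>_. borel) (\<lambda>i \<omega>. emeasure (N \<omega>) (B i)) {..<n})"

text \<open>The counting measure of the jumps of the path \<open>y\<close>: it gives mass one to each point
  \<open>(s, \<Delta>y(s))\<close> with \<open>\<Delta>y(s) \<noteq> 0\<close>.\<close>

definition jump_measure :: "real \<Rightarrow> (real \<Rightarrow> real) \<Rightarrow> (real \<times> real) measure" where
  "jump_measure T y =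
     distr (count_space {s\<in>{0<..T}. jump y s \<noteq> 0}) (leb T \<Otimes>\<^sub>M borel) (\<lambda>s. (s, jump y s))"

text \<open>\<open>J\<close> is a version of \<open>\<integral>\<^bsub>(0,t] \<times> {|x| \<le> 1}\<^esub> x (N - \<lambda>\<otimes>\<nu>)(ds,dx)\<close>, the \<open>L\<^sup>2\<close> limit of the integrals over
  \<open>(0,t] \<times> {\<epsilon> < |x| \<le> 1}\<close> as \<open>\<epsilon>\<close> tends to \<open>0\<close>.\<close>

definition is_compensated_integral ::
  "real \<Rightarrow> 'a measure \<Rightarrow> ('a \<Rightarrow> real \<Rightarrow> real) \<Rightarrow> real measure \<Rightarrow> real \<Rightarrow> ('a \<Rightarrow> real) \<Rightarrow> bool" where
  "is_compensated_integral T M Y \<nu> t J \<longleftrightarrow>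
     J \<in> borel_measurable M \<and>
     ((\<lambda>\<epsilon>. \<integral>\<^sup>+\<omega>. ennreal ((J \<omega> -
          ((LINT z:({0<..t} \<times> {x. \<epsilon> < \<bar>x\<bar> \<and> \<bar>x\<bar> \<le> 1})|jump_measure T (Y \<omega>). snd z) -
           (LINT z:({0<..t} \<times> {x. \<epsilon> < \<bar>x\<bar> \<and> \<bar>x\<bar> \<le> 1})|(leb T \<Otimes>\<^sub>M \<nu>). snd z)))\<^sup>2) \<partial>M)
        \<longlongrightarrow> 0) (at_right 0)"

text \<open>A Levy process with Levy measure \<open>\<nu>\<close> and without Gaussian part, in terms of its
  Levy--Ito representation.\<close>

definition pure_jump_levy_process ::
  "real \<Rightarrow> 'a measure \<Rightarrow> (real \<Rightarrow> 'a measure) \<Rightarrow> real measure \<Rightarrow> ('a \<Rightarrow> real \<Rightarrow> real) \<Rightarrow> bool" where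
  "pure_jump_levy_process T M F \<nu> Y \<longleftrightarrow>
     levy_process T M F Y \<and> levy_measure \<nu> \<and>
     poisson_random_measure M (\<lambda>\<omega>. jump_measure T (Y \<omega>)) (leb T \<Otimes>\<^sub>M \<nu>) \<and>
     (\<exists>(\<gamma>::real) J.
        (\<forall>t\<in>{0..T}. is_compensated_integral T M Y \<nu> t (\<lambda>\<omega>. J \<omega> t)) \<and>
        (AE \<omega> in M. \<forall>t\<in>{0..T}.
           Y \<omega> t = \<gamma> * t + (LINT z:({0<..t} \<times> {x. \<bar>x\<bar> > 1})|jump_measure T (Y \<omega>). snd z) + J \<omega> t))"

text \<open>The underlying \<open>\<sigma>\<close>-algebra is the completion of the one generated by \<open>Y\<close>.\<close>

definition generated_by :: "real \<Rightarrow> 'a measure \<Rightarrow> ('a \<Rightarrow> real \<Rightarrow> real) \<Rightarrow> bool" where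
  "generated_by T M Y \<longleftrightarrow>
     sets M = sets (completion (restr_to_subalg M (vimage_algebra (space M) Y (DD T))))"


section \<open>Malliavin derivative\<close>

definition represents ::
  "real \<Rightarrow> 'a measure \<Rightarrow> ('a \<Rightarrow> real \<Rightarrow> real) \<Rightarrow> ((real \<Rightarrow> real) \<Rightarrow> real) \<Rightarrow> ('a \<Rightarrow> real) \<Rightarrow> bool" where
  "represents T M Y \<psi> Z \<longleftrightarrow> \<psi> \<in> borel_measurable (DD T) \<and> (AE \<omega> in M. Z \<omega> = \<psi> (Y \<omega>))"

definition path_represents ::
  "real \<Rightarrow> 'a measure \<Rightarrow> ('a \<Rightarrow> real \<Rightarrow> real) \<Rightarrow> ((real \<Rightarrow> real) \<Rightarrow> real \<Rightarrow> real)
     \<Rightarrow> ('a \<Rightarrow> real \<Rightarrow> real) \<Rightarrow> bool" where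
  "path_represents T M Y \<phi> H \<longleftrightarrow> \<phi> \<in> measurable (DD T) (DD T) \<and> (AE \<omega> in M. H \<omega> = \<phi> (Y \<omega>))"

definition malliavin_diff ::
  "real \<Rightarrow> ('a \<Rightarrow> real \<Rightarrow> real) \<Rightarrow> ((real \<Rightarrow> real) \<Rightarrow> real) \<Rightarrow> 'a \<times> real \<times> real \<Rightarrow> real" where
  "malliavin_diff T Y \<psi> = (\<lambda>(\<omega>, u, v). \<psi> (shift_path T (Y \<omega>) u v) - \<psi> (Y \<omega>))"

text \<open>The path-valued derivative \<open>D\<^bsub>u,v\<^esub>H = \<phi>(Y + v 1\<^bsub>[u,T]\<^esub>) - \<phi>(Y)\<close> of a process \<open>H = \<phi>(Y)\<close>.\<close>

definition malliavin_path ::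
  "real \<Rightarrow> ('a \<Rightarrow> real \<Rightarrow> real) \<Rightarrow> ((real \<Rightarrow> real) \<Rightarrow> real \<Rightarrow> real)
     \<Rightarrow> real \<Rightarrow> real \<Rightarrow> 'a \<Rightarrow> real \<Rightarrow> real" where
  "malliavin_path T Y \<phi> u v \<omega> = path_diff T (\<phi> (shift_path T (Y \<omega>) u v)) (\<phi> (Y \<omega>))"

definition malliavin_domain ::
  "real \<Rightarrow> 'a measure \<Rightarrow> real measure \<Rightarrow> ('a \<Rightarrow> real \<Rightarrow> real) \<Rightarrow> ('a \<Rightarrow> real) set" where
  "malliavin_domain T M \<nu> Y =
     {Z. square_integrable M Z \<and>
         (\<exists>\<psi>. represents T M Y \<psi> Z \<and> square_integrable (M \<Otimes>\<^sub>M (leb T \<Otimes>\<^sub>M \<nu>)) (malliavin_diff T Y \<psi>))}"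

text \<open>\<open>Z\<close> is in the domain and the equivalence class \<open>D\<^bsub>u,v\<^esub>Z\<close>, computed from an arbitrary
  representing functional \<open>\<psi>\<close>, is the class of \<open>R\<close>.\<close>

definition has_malliavin_deriv ::
  "real \<Rightarrow> 'a measure \<Rightarrow> real measure \<Rightarrow> ('a \<Rightarrow> real \<Rightarrow> real) \<Rightarrow> ('a \<Rightarrow> real)
     \<Rightarrow> ('a \<times> real \<times> real \<Rightarrow> real) \<Rightarrow> bool" where
  "has_malliavin_deriv T M \<nu> Y Z R \<longleftrightarrow>
     Z \<in> malliavin_domain T M \<nu> Y \<and>
     (\<forall>\<psi>. represents T M Y \<psi> Z \<longrightarrow>
        (AE z in M \<Otimes>\<^sub>M (leb T \<Otimes>\<^sub>M \<nu>). malliavin_diff T Y \<psi> z = R z))"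

end

theory Submission
  imports Defs
begin

text \<open>Since \<open>Y\<close> is a semimartingale, uniqueness gives \<open>X\<^sub>t = \<psi>(Y)\<close> with
  \<open>\<psi>(y) = \<Psi>(\<phi>\<^sub>H(y), \<phi>\<^sub>G(y), y)\<^sub>t\<close>, and the asserted right-hand side is \<open>\<psi>(Y + v 1\<^bsub>[u,T]\<^esub>) - \<psi>(Y)\<close>. It
  remains to see that the derivative does not depend on the representing functional, that is, that the
  law of \<open>Y + v 1\<^bsub>[u,T]\<^esub>\<close> under \<open>P \<otimes> \<lambda> \<otimes> \<nu>\<close> is absolutely continuous with respect to the law of \<open>Y\<close>.
  This is the Mecke formula \<open>E [F(Y) N(C)] = \<integral>\<^sub>C E [F(Y + v 1\<^bsub>[u,T]\<^esub>)] du \<nu>(dv)\<close> for the jump measure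
  \<open>N\<close>: it reduces to the recursion of the Poisson weights for functionals of finitely many cells, and
  passes to \<open>Y\<close> by the Levy--Ito representation. For the semimartingale property, the jumps of size
  larger than one are removed by a continuous truncation; the rest, after subtracting a linear
  drift, is integrable and centred with increments independent of the past, hence a martingale.\<close>

section \<open>Jumps of cadlag paths\<close>

text \<open>The Poisson property of the jump measure is stated relative to all of \<open>M\<close>,
  while adaptedness and independence of the past are stated for the values and single increments of
  \<open>Y\<close>. The two are linked by writing a sum over jumps as a limit of sums over
  increments; this needs a continuous summand that vanishes near 0, hence the continuous truncation.
  The compensated small-jump integral is given for each time separately and only as an L^2 limit. It
  is used for two facts: it has mean 0, and along a subsequence its approximations converge almost
  surely at finitely many times. This is why the Mecke formula is tested on products of continuous
  functions of finitely many coordinates: such tests pass to almost sure limits and still determine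
  a finite measure on the product space. The added atoms have size above some \<epsilon> > 0: there
  the intensity is finite, and truncating jumps at a level below \<epsilon> leaves the atom
  unchanged. Such atoms exhaust all (u,v) except u = 0 and v = 0, which are null.\<close>

lemma cadlag_on_left_limit:
  assumes "cadlag_on T y" "t \<in> {0<..T}"
  shows "(y \<longlongrightarrow> y t - jump y t) (at_left t)"
proof -
  obtain l where l: "(y \<longlongrightarrow> l) (at_left t)"
    using assms unfolding cadlag_on_def by blast
  have "Lim (at_left t) y = l"
    using l by (intro tendsto_Lim) auto
  then show ?thesis
    using l by (simp add: jump_def)
qed

lemma cadlag_on_right_limit:
  assumes "cadlag_on T y" "t \<in> {0..<T}"
  shows "(y \<longlongrightarrow> y t) (at_right t)"
  using assms unfolding cadlag_on_def by blast

text \<open>Compactness makes the one-sided limits uniform: every window of radius \<delta> contains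
  at most one relevant break \<open>c\<close>, with \<open>y\<close> nearly constant on either side
  of it.\<close>

lemma cadlag_on_modulus:
  assumes y: "cadlag_on T y" and "0 < \<epsilon>"
  obtains \<delta> where "0 < \<delta>"
    "\<And>a. a \<in> {0..T} \<Longrightarrow> \<exists>c\<in>{0..T}. \<forall>x\<in>{0..T}. \<bar>x - a\<bar> < \<delta> \<longrightarrow>
       (x < c \<longrightarrow> 0 < c \<and> \<bar>y x - (y c - jump y c)\<bar> < \<epsilon>) \<and> (c \<le> x \<longrightarrow> \<bar>y x - y c\<bar> < \<epsilon>)"
proof -
  define good where "good c d \<longleftrightarrow> (\<forall>x\<in>{0..T}. \<bar>x - c\<bar> < d \<longrightarrow>
       (x < c \<longrightarrow> 0 < c \<and> \<bar>y x - (y c - jump y c)\<bar> < \<epsilon>) \<and> (c \<le> x \<longrightarrow> \<bar>y x - y c\<bar> < \<epsilon>))" for c d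
  have "\<exists>d>0. good c d" if c: "c \<in> {0..T}" for c
  proof -
    have "\<exists>d>0. \<forall>x\<in>{0..T}. c \<le> x \<and> x < c + d \<longrightarrow> \<bar>y x - y c\<bar> < \<epsilon>"
    proof (cases "c < T")
      case True
      then have "eventually (\<lambda>x. dist (y x) (y c) < \<epsilon>) (at_right c)"
        using cadlag_on_right_limit[OF y, of c] c \<open>0 < \<epsilon>\<close> by (auto dest: tendstoD)
      then obtain b where "c < b" "\<And>x. c < x \<Longrightarrow> x < b \<Longrightarrow> dist (y x) (y c) < \<epsilon>"
        unfolding eventually_at_right_field by auto
      then show ?thesis
        using \<open>0 < \<epsilon>\<close> by (intro exI[of _ "b - c"]) (auto simp: dist_real_def order.order_iff_strict)
    next
      case False
      then have "x = c" if "c \<le> x" "x \<in> {0..T}" for x using that c by auto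
      then show ?thesis
        using \<open>0 < \<epsilon>\<close> by (intro exI[of _ 1]) force
    qed
    then obtain d1 where d1: "d1 > 0"
      "\<And>x. x \<in> {0..T} \<Longrightarrow> c \<le> x \<Longrightarrow> x < c + d1 \<Longrightarrow> \<bar>y x - y c\<bar> < \<epsilon>" by blast
    have "\<exists>d>0. \<forall>x\<in>{0..T}. x < c \<and> c - d < x \<longrightarrow> 0 < c \<and> \<bar>y x - (y c - jump y c)\<bar> < \<epsilon>"
    proof (cases "0 < c")
      case True
      then have "eventually (\<lambda>x. dist (y x) (y c - jump y c) < \<epsilon>) (at_left c)"
        using cadlag_on_left_limit[OF y, of c] c \<open>0 < \<epsilon>\<close> by (auto dest: tendstoD)
      then obtain b where "b < c" "\<And>x. b < x \<Longrightarrow> x < c \<Longrightarrow> dist (y x) (y c - jump y c) < \<epsilon>"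
        unfolding eventually_at_left_field by auto
      then show ?thesis
        using True by (intro exI[of _ "c - b"]) (auto simp: dist_real_def)
    next
      case False
      then show ?thesis by (intro exI[of _ 1]) auto
    qed
    then obtain d2 where d2: "d2 > 0"
      "\<And>x. x \<in> {0..T} \<Longrightarrow> x < c \<Longrightarrow> c - d2 < x \<Longrightarrow> 0 < c \<and> \<bar>y x - (y c - jump y c)\<bar> < \<epsilon>"
      by blast
    have "good c (min d1 d2)"
      unfolding good_def using d1(2) d2(2) by (auto simp: abs_if split: if_splits)
    then show ?thesis
      using d1(1) d2(1) by (metis min_less_iff_conj)
  qed
  then obtain d where d: "\<And>c. c \<in> {0..T} \<Longrightarrow> d c > 0 \<and> good c (d c)"
    by metis
  \<comment> \<open>\<delta> is a Lebesgue number of the cover by the balls just found.\<close>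
  obtain \<delta> where \<delta>: "0 < \<delta>"
    "\<And>x. x \<in> {0..T} \<Longrightarrow> \<exists>B\<in>(\<lambda>c. ball c (d c)) ` {0..T}. ball x \<delta> \<subseteq> B"
    by (rule Heine_Borel_lemma[of "{0..T}" "(\<lambda>c. ball c (d c)) ` {0..T}"]) (use d in auto)
  show thesis
  proof (rule that[OF \<delta>(1)])
    fix a assume "a \<in> {0..T}"
    then obtain c where c: "c \<in> {0..T}" "ball a \<delta> \<subseteq> ball c (d c)"
      using \<delta>(2) by blast
    have "\<bar>x - c\<bar> < d c" if "\<bar>x - a\<bar> < \<delta>" for x
      using c(2) that by (auto simp: subset_iff dist_real_def abs_minus_commute)
    then show "\<exists>c\<in>{0..T}. \<forall>x\<in>{0..T}. \<bar>x - a\<bar> < \<delta> \<longrightarrow>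
       (x < c \<longrightarrow> 0 < c \<and> \<bar>y x - (y c - jump y c)\<bar> < \<epsilon>) \<and> (c \<le> x \<longrightarrow> \<bar>y x - y c\<bar> < \<epsilon>)"
      using d[OF c(1)] c(1) unfolding good_def by blast
  qed
qed

text \<open>Infinitely many large jumps would accumulate at some \<open>a\<close>. In the window of
  the modulus around \<open>a\<close> with tolerance e/2, the value and the left limit at any point
  other than \<open>c\<close> are both close to one number, so only \<open>c\<close> can carry a
  jump above \<open>e\<close>.\<close>

lemma finite_large_jumps:
  assumes y: "cadlag_on T y" and "0 < e"
  shows "finite {r\<in>{0<..T}. e < \<bar>jump y r\<bar>}"
proof (rule ccontr)
  let ?D = "{r\<in>{0<..T}. e < \<bar>jump y r\<bar>}"
  assume inf: "infinite ?D"
  obtain a where a: "a \<in> {0..T}" "a islimpt ?D"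
    by (rule Heine_Borel_imp_Bolzano_Weierstrass[of "{0..T}" ?D, THEN bexE])
       (use inf in auto)
  obtain \<delta> where \<delta>: "0 < \<delta>"
    "\<And>a. a \<in> {0..T} \<Longrightarrow> \<exists>c\<in>{0..T}. \<forall>x\<in>{0..T}. \<bar>x - a\<bar> < \<delta> \<longrightarrow>
       (x < c \<longrightarrow> 0 < c \<and> \<bar>y x - (y c - jump y c)\<bar> < e/2) \<and> (c \<le> x \<longrightarrow> \<bar>y x - y c\<bar> < e/2)"
    using cadlag_on_modulus[OF y, of "e/2"] \<open>0 < e\<close> by auto
  then obtain c where c: "c \<in> {0..T}" "\<And>x. x \<in> {0..T} \<Longrightarrow> \<bar>x - a\<bar> < \<delta> \<Longrightarrow>
       (x < c \<longrightarrow> 0 < c \<and> \<bar>y x - (y c - jump y c)\<bar> < e/2) \<and> (c \<le> x \<longrightarrow> \<bar>y x - y c\<bar> < e/2)"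
    using a(1) by blast
  have "r = c" if "r \<in> ?D \<inter> ball a \<delta>" for r
  proof (rule ccontr)
    assume "r \<noteq> c"
    \<comment> \<open>The number near which \<open>y\<close> stays on the side of \<open>c\<close>
      where \<open>r\<close> lies.\<close>
    define l where "l = (if r < c then y c - jump y c else y c)"
    have r: "r \<in> {0..T}" "0 < r" "\<bar>r - a\<bar> < \<delta>" "e < \<bar>jump y r\<bar>"
      using that by (auto simp: dist_real_def)
    have yr: "\<bar>y r - l\<bar> < e/2"
      using c(2)[OF r(1,3)] by (auto simp: l_def)
    \<comment> \<open>The lower bound keeps \<open>x\<close> in [0,T], in the window around
      \<open>a\<close>, and on the same side of \<open>c\<close> as \<open>r\<close>.\<close>
    have "eventually (\<lambda>x. max (max 0 (a - \<delta>)) (if r < c then 0 else c) < x \<and> x < r) (at_left r)"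
      unfolding eventually_at_left_field using r \<open>r \<noteq> c\<close>
      by (intro exI[of _ "max (max 0 (a - \<delta>)) (if r < c then 0 else c)"]) (auto simp: abs_less_iff)
    then have ev: "eventually (\<lambda>x. \<bar>y x - l\<bar> \<le> e/2) (at_left r)"
    proof eventually_elim
      case (elim x)
      then have "x \<in> {0..T}" "\<bar>x - a\<bar> < \<delta>" using r by auto
      from c(2)[OF this] elim show ?case
        by (auto simp: l_def split: if_splits)
    qed
    have "((\<lambda>x. \<bar>y x - l\<bar>) \<longlongrightarrow> \<bar>(y r - jump y r) - l\<bar>) (at_left r)"
      using r by (intro tendsto_intros cadlag_on_left_limit[OF y]) auto
    then have "\<bar>(y r - jump y r) - l\<bar> \<le> e/2"
      using ev by (rule tendsto_upperbound) auto
    then show False using yr r(4) by linarith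
  qed
  then have "?D \<inter> ball a \<delta> \<subseteq> {c}" by blast
  then have "finite (?D \<inter> ball a \<delta>)" by (rule finite_subset) auto
  then show False
    using a(2) \<delta>(1) by (auto simp: islimpt_eq_infinite_ball)
qed

lemma finite_jump_support:
  assumes "cadlag_on T y" "0 < e" "\<And>x. \<bar>x\<bar> \<le> e \<Longrightarrow> k x = 0" "t \<le> T"
  shows "finite {r\<in>{s<..t}. 0 < r \<and> k (jump y r) \<noteq> (0::real)}"
  by (rule finite_subset[OF _ finite_large_jumps[OF assms(1,2)]])
     (use assms(3,4) in \<open>force simp: not_less[symmetric]\<close>)

lemma cadlag_on_seq_right:
  assumes y: "cadlag_on T y" and x: "x \<longlonglongrightarrow> r" "\<And>n. x n \<in> {r..T}" "0 \<le> r"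
  shows "(\<lambda>n. y (x n)) \<longlonglongrightarrow> y r"
proof (cases "r < T")
  case True
  show ?thesis
  proof (rule tendstoI)
    fix e :: real assume "0 < e"
    then have "eventually (\<lambda>x. dist (y x) (y r) < e) (at_right r)"
      using cadlag_on_right_limit[OF y, of r] True x(3) by (auto dest: tendstoD)
    then obtain b where b: "r < b" "\<And>x. r < x \<Longrightarrow> x < b \<Longrightarrow> dist (y x) (y r) < e"
      unfolding eventually_at_right_field by auto
    have "eventually (\<lambda>n. x n < b) sequentially"
      using x(1) b(1) by (rule order_tendstoD)
    then show "eventually (\<lambda>n. dist (y (x n)) (y r) < e) sequentially"
    proof eventually_elim
      case (elim n)
      then show ?case using b(2)[of "x n"] x(2)[of n] \<open>0 < e\<close> by (cases "x n = r") auto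
    qed
  qed
next
  case False
  then have "x n = r" for n using x(2)[of n] by auto
  then show ?thesis by simp
qed

lemma cadlag_on_seq_left:
  assumes y: "cadlag_on T y" and x: "x \<longlonglongrightarrow> r" "\<And>n. x n < r" "r \<in> {0<..T}"
  shows "(\<lambda>n. y (x n)) \<longlonglongrightarrow> y r - jump y r"
proof -
  have "filterlim x (at_left r) sequentially"
    using x by (auto simp: filterlim_at less_imp_neq)
  from filterlim_compose[OF cadlag_on_left_limit[OF y x(3)] this] show ?thesis .
qed

text \<open>If \<open>a\<close> and \<open>b\<close> lie on the same side of the break
  \<open>c\<close>, the increment is below e/4 + e/4; otherwise crossing \<open>c\<close> adds its
  jump, at most e/2. This fixes the tolerance e/4 in the modulus.\<close>

lemma cadlag_on_small_increment:
  assumes y: "cadlag_on T y" and "0 < e"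
  obtains \<delta> where "0 < \<delta>"
    "\<And>a b. 0 \<le> a \<Longrightarrow> a \<le> b \<Longrightarrow> b \<le> T \<Longrightarrow> b - a < \<delta> \<Longrightarrow>
       (\<And>r. a < r \<Longrightarrow> r \<le> b \<Longrightarrow> \<bar>jump y r\<bar> \<le> e/2) \<Longrightarrow> \<bar>y b - y a\<bar> \<le> e"
proof -
  obtain \<delta> where \<delta>: "0 < \<delta>"
    "\<And>a. a \<in> {0..T} \<Longrightarrow> \<exists>c\<in>{0..T}. \<forall>x\<in>{0..T}. \<bar>x - a\<bar> < \<delta> \<longrightarrow>
       (x < c \<longrightarrow> 0 < c \<and> \<bar>y x - (y c - jump y c)\<bar> < e/4) \<and> (c \<le> x \<longrightarrow> \<bar>y x - y c\<bar> < e/4)"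
    using cadlag_on_modulus[OF y, of "e/4"] \<open>0 < e\<close> by auto
  show thesis
  proof (rule that[OF \<delta>(1)])
    fix a b assume ab: "0 \<le> a" "a \<le> b" "b \<le> T" "b - a < \<delta>"
      and J: "\<And>r. a < r \<Longrightarrow> r \<le> b \<Longrightarrow> \<bar>jump y r\<bar> \<le> e/2"
    obtain c where c: "\<And>x. x \<in> {0..T} \<Longrightarrow> \<bar>x - a\<bar> < \<delta> \<Longrightarrow>
       (x < c \<longrightarrow> 0 < c \<and> \<bar>y x - (y c - jump y c)\<bar> < e/4) \<and> (c \<le> x \<longrightarrow> \<bar>y x - y c\<bar> < e/4)"
      using \<delta>(2)[of a] ab by (metis atLeastAtMost_iff order_trans)
    show "\<bar>y b - y a\<bar> \<le> e"
      using c[of a] c[of b] ab J[of c] \<delta>(1) by (cases "a < c"; cases "b < c") (simp_all, (linarith | argo)+)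
  qed
qed

text \<open>Meant for \<open>k\<close> vanishing near 0, where the index set is finite on [0,T]; a
  sum over an infinite set would be 0 by default.\<close>

definition jump_sum :: "(real \<Rightarrow> real) \<Rightarrow> (real \<Rightarrow> real) \<Rightarrow> real \<Rightarrow> real" where
  "jump_sum k y t = (\<Sum>r\<in>{r\<in>{0<..t}. k (jump y r) \<noteq> 0}. k (jump y r))"

lemma jump_sum_diff:
  assumes y: "cadlag_on T y" and k: "0 < e" "\<And>x. \<bar>x\<bar> \<le> e \<Longrightarrow> k x = 0"
    and st: "0 \<le> s" "s \<le> t" "t \<le> T"
  shows "jump_sum k y t - jump_sum k y s = (\<Sum>r\<in>{r\<in>{s<..t}. k (jump y r) \<noteq> 0}. k (jump y r))"
proof -
  have *: "{r\<in>{0<..t}. k (jump y r) \<noteq> 0} = {r\<in>{0<..s}. k (jump y r) \<noteq> 0} \<union> {r\<in>{s<..t}. k (jump y r) \<noteq> 0}"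
    using st by auto
  have fin: "finite {r\<in>{a<..b}. k (jump y r) \<noteq> 0}" if "0 \<le> a" "b \<le> T" for a b
    by (rule finite_subset[OF _ finite_jump_support[OF y k that(2), where s = a]]) (use that in auto)
  show ?thesis
    unfolding jump_sum_def * using st by (subst sum.union_disjoint[OF fin fin]) auto
qed

lemma jump_sum_0: "jump_sum k y 0 = 0"
  by (simp add: jump_sum_def)

text \<open>Provides an index set that does not depend on \<open>k\<close>, so that jump sums for
  different \<open>k\<close> can be subtracted or passed to a limit term by term.\<close>

lemma jump_sum_superset:
  assumes y: "cadlag_on T y" and e: "0 < e" "\<And>x. \<bar>x\<bar> \<le> e \<Longrightarrow> k x = 0" and t: "t \<le> T"
  shows "jump_sum k y t = (\<Sum>r\<in>{r\<in>{0<..t}. e < \<bar>jump y r\<bar>}. k (jump y r))"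
proof -
  have fin: "finite {r\<in>{0<..t}. e < \<bar>jump y r\<bar>}"
    by (rule finite_subset[OF _ finite_large_jumps[OF y e(1)]]) (use t in auto)
  have "e < \<bar>jump y r\<bar>" if "k (jump y r) \<noteq> 0" for r
    using that e(2)[of "jump y r"] by linarith
  then show ?thesis
    unfolding jump_sum_def using fin by (intro sum.mono_neutral_left) auto
qed

text \<open>For a fine mesh every interval of the partition that contains no large jump contributes
  nothing, and the others isolate the large jumps one by one.\<close>

lemma jump_sum_riemann:
  assumes y: "cadlag_on T y" and e: "0 < e" "\<And>x. \<bar>x\<bar> \<le> e \<Longrightarrow> k x = 0"
    and k: "continuous_on UNIV k" and st: "0 \<le> s" "s < t" "t \<le> T"
  shows "(\<lambda>n. \<Sum>i<n. k (y (s + (t - s) * real (Suc i) / n) - y (s + (t - s) * real i / n)))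
    \<longlonglongrightarrow> jump_sum k y t - jump_sum k y s"
proof -
  define p where "p n i = s + (t - s) * real i / real n" for n i :: nat
  \<comment> \<open>The threshold is e/2 because a cell without jumps above e/2 has an increment of
    size at most \<open>e\<close>, where \<open>k\<close> vanishes. Jumps between e/2 and
    \<open>e\<close> contribute 0 in the limit.\<close>
  define D where "D = {r\<in>{s<..t}. e/2 < \<bar>jump y r\<bar>}"
  \<comment> \<open>Index of the cell containing \<open>r\<close>; cells are closed on the right,
    hence the ceiling minus one.\<close>
  define ix where "ix n r = nat \<lceil>(r - s) * real n / (t - s)\<rceil> - 1" for n r
  have finD: "finite D"
    by (rule finite_subset[OF _ finite_large_jumps[OF y, of "e/2"]]) (use e st in \<open>auto simp: D_def\<close>)
  obtain \<delta> where \<delta>: "0 < \<delta>"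
    "\<And>a b. 0 \<le> a \<Longrightarrow> a \<le> b \<Longrightarrow> b \<le> T \<Longrightarrow> b - a < \<delta> \<Longrightarrow>
       (\<And>r. a < r \<Longrightarrow> r \<le> b \<Longrightarrow> \<bar>jump y r\<bar> \<le> e/2) \<Longrightarrow> \<bar>y b - y a\<bar> \<le> e"
    using cadlag_on_small_increment[OF y e(1)] by blast
  have p_range: "p n i \<in> {s..t}" if "i \<le> n" "0 < n" for n i
  proof -
    have "(t - s) * real i / real n \<le> (t - s) * 1"
      unfolding times_divide_eq_right[symmetric] using that st by (intro mult_left_mono) auto
    then show ?thesis using that st by (auto simp: p_def)
  qed
  have p_Suc: "p n (Suc i) = p n i + (t - s) / n" for n i
    by (simp add: p_def algebra_simps add_divide_distrib diff_divide_distrib)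
  have ix: "p n (ix n r) < r" "r \<le> p n (Suc (ix n r))" "ix n r < n" if "r \<in> D" "0 < n" for n r
  proof -
    let ?q = "(r - s) * real n / (t - s)"
    have q: "0 < ?q" "?q \<le> n" using that st by (auto simp: D_def field_simps)
    have c: "1 \<le> \<lceil>?q\<rceil>" "\<lceil>?q\<rceil> \<le> int n" using q by (auto simp: ceiling_le_iff one_le_ceiling)
    then have i: "real (ix n r) = of_int \<lceil>?q\<rceil> - 1" "real (Suc (ix n r)) = of_int \<lceil>?q\<rceil>"
      by (auto simp: ix_def of_nat_diff nat_le_iff le_nat_iff)
    have q': "(t - s) * ?q / n = r - s" using that(2) st by simp
    have c': "of_int \<lceil>?q\<rceil> - 1 < ?q" "?q \<le> of_int \<lceil>?q\<rceil>" by linarith+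
    show "ix n r < n" using c i(2) by (simp add: ix_def) linarith
    have "(t - s) * real (ix n r) / n < (t - s) * ?q / n"
      unfolding i(1) using c' that(2) st by (intro divide_strict_right_mono mult_strict_left_mono) auto
    then show "p n (ix n r) < r" unfolding q' by (simp add: p_def)
    have "(t - s) * real (Suc (ix n r)) / n \<ge> (t - s) * ?q / n"
      unfolding i(2) using c' that(2) st by (intro divide_right_mono mult_left_mono) auto
    then show "r \<le> p n (Suc (ix n r))" unfolding q' by (simp add: p_def)
  qed
  have mesh: "(\<lambda>n. (t - s) / real n) \<longlonglongrightarrow> 0"
    by (rule lim_const_over_n)
  \<comment> \<open>Once the mesh is below the distances between the finitely many points of
    \<open>D\<close>, no cell holds two of them.\<close>
  have "eventually (\<lambda>n. inj_on (ix n) D) sequentially"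
  proof -
    have "eventually (\<lambda>n. ix n r \<noteq> ix n r') sequentially" if "r \<in> D" "r' \<in> D" "r \<noteq> r'" for r r'
    proof -
      have "eventually (\<lambda>n. (t - s) / real n < \<bar>r - r'\<bar>) sequentially"
        using mesh that(3) by (intro order_tendstoD) auto
      then show ?thesis using eventually_gt_at_top[of "0::nat"]
      proof eventually_elim
        case (elim n)
        then show ?case
          using ix(1,2)[OF that(1), of n] ix(1,2)[OF that(2), of n] by (auto simp: p_Suc abs_if split: if_splits)
      qed
    qed
    then have "eventually (\<lambda>n. \<forall>r\<in>D. \<forall>r'\<in>D. r \<noteq> r' \<longrightarrow> ix n r \<noteq> ix n r') sequentially"
      using finD by (intro eventually_ball_finite ballI) (auto intro: eventually_mono)
    then show ?thesis by eventually_elim (auto simp: inj_on_def)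
  qed
  moreover have "eventually (\<lambda>n. (t - s) / real n < \<delta>) sequentially"
    using mesh \<delta>(1) by (rule order_tendstoD)
  ultimately have "eventually (\<lambda>n. (\<Sum>r\<in>D. k (y (p n (Suc (ix n r))) - y (p n (ix n r)))) =
      (\<Sum>i<n. k (y (p n (Suc i)) - y (p n i)))) sequentially"
    using eventually_gt_at_top[of "0::nat"]
  proof eventually_elim
    case (elim n)
    have "(\<Sum>i<n. k (y (p n (Suc i)) - y (p n i))) = (\<Sum>i\<in>ix n ` D. k (y (p n (Suc i)) - y (p n i)))"
    proof (rule sum.mono_neutral_right)
      show "ix n ` D \<subseteq> {..<n}" using ix(3) elim by auto
      show "\<forall>i\<in>{..<n} - ix n ` D. k (y (p n (Suc i)) - y (p n i)) = 0"
      proof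
        fix i assume i: "i \<in> {..<n} - ix n ` D"
        have "\<bar>y (p n (Suc i)) - y (p n i)\<bar> \<le> e"
        proof (rule \<delta>(2))
          fix r assume r: "p n i < r" "r \<le> p n (Suc i)"
          show "\<bar>jump y r\<bar> \<le> e/2"
          proof (rule ccontr)
            assume "\<not> \<bar>jump y r\<bar> \<le> e/2"
            then have rD: "r \<in> D"
              using r p_range[of i n] p_range[of "Suc i" n] i elim by (auto simp: D_def)
            have "p n i < p n (Suc (ix n r))" "p n (ix n r) < p n (Suc i)"
              using r ix(1,2)[OF rD, of n] elim by auto
            then have "i < Suc (ix n r)" "ix n r < Suc i"
              using st elim by (auto simp: p_def divide_less_cancel)
            then have "i = ix n r" by simp
            then show False using i rD by blast
          qed
        qed (use i elim p_range[of i n] p_range[of "Suc i" n] st in \<open>auto simp: p_Suc\<close>)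
        then show "k (y (p n (Suc i)) - y (p n i)) = 0" by (rule e(2))
      qed
    qed simp
    also have "\<dots> = (\<Sum>r\<in>D. k (y (p n (Suc (ix n r))) - y (p n (ix n r))))"
      using elim by (simp add: sum.reindex)
    finally show ?case ..
  qed
  moreover have "(\<lambda>n. \<Sum>r\<in>D. k (y (p n (Suc (ix n r))) - y (p n (ix n r)))) \<longlonglongrightarrow> (\<Sum>r\<in>D. k (jump y r))"
  proof (intro tendsto_sum)
    fix r assume r: "r \<in> D"
    have rT: "r \<in> {0<..T}" using r st by (auto simp: D_def)
    \<comment> \<open>The index is \<open>Suc n\<close> because the bounds on \<open>ix\<close>
      require a positive number of cells; \<open>LIMSEQ_imp_Suc\<close> undoes the shift at the
      end.\<close>
    have l: "(\<lambda>n. p (Suc n) (ix (Suc n) r)) \<longlonglongrightarrow> r"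
    proof (rule tendsto_sandwich)
      show "eventually (\<lambda>n. r - (t - s) / real (Suc n) \<le> p (Suc n) (ix (Suc n) r)) sequentially"
      proof (intro always_eventually allI)
        fix n
        show "r - (t - s) / real (Suc n) \<le> p (Suc n) (ix (Suc n) r)"
          using ix(2)[OF r, of "Suc n"] by (simp add: p_Suc del: of_nat_Suc)
      qed
      show "eventually (\<lambda>n. p (Suc n) (ix (Suc n) r) \<le> r) sequentially"
        using ix(1)[OF r] by (intro always_eventually allI less_imp_le) auto
      have "(\<lambda>n. r - (t - s) / real (Suc n)) \<longlonglongrightarrow> r - 0"
        by (intro tendsto_diff tendsto_const LIMSEQ_Suc[OF mesh])
      then show "(\<lambda>n. r - (t - s) / real (Suc n)) \<longlonglongrightarrow> r" by simp
    qed auto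
    have "(\<lambda>n. p (Suc n) (ix (Suc n) r) + (t - s) / real (Suc n)) \<longlonglongrightarrow> r + 0"
      by (intro tendsto_add l LIMSEQ_Suc[OF mesh])
    then have u: "(\<lambda>n. p (Suc n) (Suc (ix (Suc n) r))) \<longlonglongrightarrow> r"
      by (simp add: p_Suc del: of_nat_Suc)
    \<comment> \<open>Right endpoints approach \<open>r\<close> from the right and left endpoints
      strictly from the left, so the increment over the cell tends to the jump at
      \<open>r\<close>.\<close>
    have "(\<lambda>n. y (p (Suc n) (Suc (ix (Suc n) r)))) \<longlonglongrightarrow> y r"
    proof (rule cadlag_on_seq_right[OF y u])
      show "p (Suc n) (Suc (ix (Suc n) r)) \<in> {r..T}" for n
        using ix(2,3)[OF r, of "Suc n"] p_range[of "Suc (ix (Suc n) r)" "Suc n"] st by auto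
    qed (use rT in auto)
    moreover have "(\<lambda>n. y (p (Suc n) (ix (Suc n) r))) \<longlonglongrightarrow> y r - jump y r"
      using ix(1)[OF r] rT by (intro cadlag_on_seq_left[OF y l]) auto
    ultimately have "(\<lambda>n. y (p (Suc n) (Suc (ix (Suc n) r))) - y (p (Suc n) (ix (Suc n) r)))
        \<longlonglongrightarrow> y r - (y r - jump y r)"
      by (rule tendsto_diff)
    then have "(\<lambda>n. k (y (p (Suc n) (Suc (ix (Suc n) r))) - y (p (Suc n) (ix (Suc n) r))))
        \<longlonglongrightarrow> k (jump y r)"
      using continuous_on_tendsto_compose[OF k, of _ "jump y r"] by simp
    then show "(\<lambda>n. k (y (p n (Suc (ix n r))) - y (p n (ix n r)))) \<longlonglongrightarrow> k (jump y r)"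
      by (rule LIMSEQ_imp_Suc)
  qed
  ultimately have "(\<lambda>n. \<Sum>i<n. k (y (p n (Suc i)) - y (p n i))) \<longlonglongrightarrow> (\<Sum>r\<in>D. k (jump y r))"
    by (rule Lim_transform_eventually[rotated])
  also have "(\<Sum>r\<in>D. k (jump y r)) = jump_sum k y t - jump_sum k y s"
  proof -
    have "{r \<in> {s<..t}. k (jump y r) \<noteq> 0} \<subseteq> D"
    proof safe
      fix r assume r: "r \<in> {s<..t}" "k (jump y r) \<noteq> 0"
      then have "e < \<bar>jump y r\<bar>" using e(2)[of "jump y r"] by linarith
      then show "r \<in> D" using r(1) e(1) by (simp add: D_def)
    qed
    then show ?thesis
      using st e finD by (subst jump_sum_diff[OF y e]) (auto intro!: sum.mono_neutral_right simp: D_def)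
  qed
  finally show ?thesis by (simp add: p_def)
qed

section \<open>Closure properties of cadlag paths and of paths of finite variation\<close>

lemma cadlag_on_cong:
  assumes "\<And>t. t \<in> {0..T} \<Longrightarrow> x t = y t"
  shows "cadlag_on T x \<longleftrightarrow> cadlag_on T y"
proof -
  have "(x \<longlongrightarrow> x t) (at_right t) \<longleftrightarrow> (y \<longlongrightarrow> y t) (at_right t)" if "t \<in> {0..<T}" for t
  proof -
    have "eventually (\<lambda>s. x s = y s) (at_right t)"
      using that assms by (auto simp: eventually_at_right_field intro!: exI[of _ T])
    then show ?thesis using that assms by (simp add: tendsto_cong)
  qed
  moreover have "(x \<longlongrightarrow> l) (at_left t) \<longleftrightarrow> (y \<longlongrightarrow> l) (at_left t)" if "t \<in> {0<..T}" for t l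
  proof -
    have "eventually (\<lambda>s. x s = y s) (at_left t)"
      using that assms by (auto simp: eventually_at_left_field intro!: exI[of _ 0])
    then show ?thesis by (simp add: tendsto_cong)
  qed
  ultimately show ?thesis by (simp add: cadlag_on_def)
qed

lemma cadlag_on_add:
  assumes "cadlag_on T x" "cadlag_on T y"
  shows "cadlag_on T (\<lambda>s. x s + y s)"
  using assms unfolding cadlag_on_def by (blast intro: tendsto_add)

lemma cadlag_on_continuous:
  assumes "continuous_on UNIV x"
  shows "cadlag_on T x"
  using assms unfolding cadlag_on_def continuous_on_def
  by (auto intro: tendsto_within_subset[OF _ subset_UNIV])

lemma cadlag_on_mult_left:
  assumes "cadlag_on T x"
  shows "cadlag_on T (\<lambda>s. c * x s)"
  using assms unfolding cadlag_on_def by (blast intro: tendsto_mult_left)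

lemma cadlag_on_diff:
  assumes "cadlag_on T x" "cadlag_on T y"
  shows "cadlag_on T (\<lambda>s. x s - y s)"
  using assms unfolding cadlag_on_def by (blast intro: tendsto_diff)

lemma cadlag_on_indicator: "cadlag_on T (indicator {r..})"
proof -
  have "((indicator {r..} :: real \<Rightarrow> real) \<longlongrightarrow> indicator {r..} t) (at_right t)" for t
  proof (rule tendsto_eventually)
    show "eventually (\<lambda>s. indicator {r..} s = (indicator {r..} t :: real)) (at_right t)"
      unfolding eventually_at_right_field
      by (rule exI[of _ "if t < r then r else t + 1"]) (auto simp: indicator_def)
  qed
  moreover have "((indicator {r..} :: real \<Rightarrow> real) \<longlongrightarrow> (if t \<le> r then 0 else 1)) (at_left t)" for t
  proof (rule tendsto_eventually)
    show "eventually (\<lambda>s. indicator {r..} s = ((if t \<le> r then 0 else 1) :: real)) (at_left t)"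
      unfolding eventually_at_left_field
      by (rule exI[of _ "if t \<le> r then t - 1 else r"]) (auto simp: indicator_def)
  qed
  ultimately show ?thesis unfolding cadlag_on_def by blast
qed

lemma cadlag_on_sum:
  assumes "\<And>i. i \<in> I \<Longrightarrow> cadlag_on T (x i)"
  shows "cadlag_on T (\<lambda>s. \<Sum>i\<in>I. x i s)"
  using assms
  by (induction I rule: infinite_finite_induct) (auto intro: cadlag_on_add cadlag_on_continuous)

lemma finite_variation_on_cong:
  assumes "\<And>t. t \<in> {0..T} \<Longrightarrow> x t = y t" "finite_variation_on T y"
  shows "finite_variation_on T x"
proof -
  have "x (p i) = y (p i)" if "p ` {..n::nat} \<subseteq> {0..T}" "i \<le> n" for p n i
    using that assms(1) by auto
  then have "(\<Sum>i<n. \<bar>x (p (Suc i)) - x (p i)\<bar>) = (\<Sum>i<n. \<bar>y (p (Suc i)) - y (p i)\<bar>)"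
    if "p ` {..n::nat} \<subseteq> {0..T}" for p n
    using that by (intro sum.cong) auto
  then show ?thesis
    using assms(2) unfolding finite_variation_on_def by metis
qed

lemma finite_variation_on_add:
  assumes "finite_variation_on T x" "finite_variation_on T y"
  shows "finite_variation_on T (\<lambda>s. x s + y s)"
proof -
  obtain K L where KL:
    "\<And>(n::nat) p. mono_on {..n} p \<Longrightarrow> p ` {..n} \<subseteq> {0..T} \<Longrightarrow> (\<Sum>i<n. \<bar>x (p (Suc i)) - x (p i)\<bar>) \<le> K"
    "\<And>(n::nat) p. mono_on {..n} p \<Longrightarrow> p ` {..n} \<subseteq> {0..T} \<Longrightarrow> (\<Sum>i<n. \<bar>y (p (Suc i)) - y (p i)\<bar>) \<le> L"
    using assms unfolding finite_variation_on_def by blast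
  have "(\<Sum>i<n. \<bar>x (p (Suc i)) + y (p (Suc i)) - (x (p i) + y (p i))\<bar>) \<le> K + L"
    if "mono_on {..n} p" "p ` {..n} \<subseteq> {0..T}" for n :: nat and p
  proof -
    have "(\<Sum>i<n. \<bar>x (p (Suc i)) + y (p (Suc i)) - (x (p i) + y (p i))\<bar>) \<le>
      (\<Sum>i<n. \<bar>x (p (Suc i)) - x (p i)\<bar> + \<bar>y (p (Suc i)) - y (p i)\<bar>)"
      by (intro sum_mono) linarith
    also have "\<dots> \<le> K + L"
      using KL[OF that] by (simp add: sum.distrib)
    finally show ?thesis .
  qed
  then show ?thesis unfolding finite_variation_on_def by blast
qed

lemma finite_variation_on_mult_mono:
  assumes "mono x"
  shows "finite_variation_on T (\<lambda>s. c * x s)"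
proof -
  have "(\<Sum>i<n. \<bar>c * x (p (Suc i)) - c * x (p i)\<bar>) \<le> \<bar>c\<bar> * (x T - x 0)"
    if p: "mono_on {..n} p" "p ` {..n} \<subseteq> {0..T}" for n :: nat and p
  proof -
    have "(\<Sum>i<n. \<bar>c * x (p (Suc i)) - c * x (p i)\<bar>) = (\<Sum>i<n. \<bar>c\<bar> * (x (p (Suc i)) - x (p i)))"
    proof (rule sum.cong)
      fix i assume "i \<in> {..<n}"
      then have "x (p i) \<le> x (p (Suc i))"
        using p(1) assms by (auto simp: mono_on_def mono_def)
      then show "\<bar>c * x (p (Suc i)) - c * x (p i)\<bar> = \<bar>c\<bar> * (x (p (Suc i)) - x (p i))"
        by (simp add: abs_mult flip: right_diff_distrib)
    qed simp
    also have "\<dots> = \<bar>c\<bar> * (x (p n) - x (p 0))"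
      by (simp only: sum_distrib_left[symmetric] sum_lessThan_telescope[of "\<lambda>i. x (p i)"])
    also have "\<dots> \<le> \<bar>c\<bar> * (x T - x 0)"
    proof -
      have "p n \<in> {0..T}" "p 0 \<in> {0..T}" using p(2) by auto
      then have "x (p n) \<le> x T" "x 0 \<le> x (p 0)" using assms by (auto simp: mono_def)
      then show ?thesis by (intro mult_left_mono) auto
    qed
    finally show ?thesis .
  qed
  then show ?thesis unfolding finite_variation_on_def by blast
qed

lemma finite_variation_on_sum:
  assumes "\<And>i. i \<in> I \<Longrightarrow> finite_variation_on T (x i)"
  shows "finite_variation_on T (\<lambda>s. \<Sum>i\<in>I. x i s)"
  using assms
proof (induction I rule: infinite_finite_induct)
  case (insert i I)
  then show ?case by (auto intro: finite_variation_on_add)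
qed (auto simp: finite_variation_on_def)

text \<open>Only finitely many jumps count, so the path is a finite combination of right-continuous
  steps with a time-independent index set. Both the cadlag property and finite variation are read
  off from this form.\<close>

lemma jump_sum_eq_step:
  assumes y: "cadlag_on T y" and e: "0 < e" "\<And>x. \<bar>x\<bar> \<le> e \<Longrightarrow> k x = 0" and "t \<le> T"
  shows "jump_sum k y t =
    (\<Sum>r\<in>{r\<in>{0<..T}. k (jump y r) \<noteq> 0}. k (jump y r) * indicator {r..} t)"
proof -
  have "finite {r\<in>{0<..T}. k (jump y r) \<noteq> 0}"
    by (rule finite_subset[OF _ finite_jump_support[OF y e order_refl, where s = 0]]) auto
  then show ?thesis
    unfolding jump_sum_def using \<open>t \<le> T\<close>
    by (intro sum.mono_neutral_cong_left) (auto simp: indicator_def)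
qed

lemma cadlag_on_jump_sum:
  assumes "cadlag_on T y" "0 < e" "\<And>x. \<bar>x\<bar> \<le> e \<Longrightarrow> k x = 0"
  shows "cadlag_on T (jump_sum k y)"
  by (subst cadlag_on_cong[OF jump_sum_eq_step[OF assms]])
     (auto intro!: cadlag_on_sum cadlag_on_mult_left cadlag_on_indicator)

lemma finite_variation_on_jump_sum:
  assumes "cadlag_on T y" "0 < e" "\<And>x. \<bar>x\<bar> \<le> e \<Longrightarrow> k x = 0"
  shows "finite_variation_on T (jump_sum k y)"
  by (rule finite_variation_on_cong[OF jump_sum_eq_step[OF assms]])
     (auto intro!: finite_variation_on_sum finite_variation_on_mult_mono simp: mono_def indicator_def)

subsection \<open>The path space\<close>

lemma space_DD: "space (DD T) = {x \<in> extensional {0..T}. cadlag_on T x}"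
  by (auto simp: DD_def space_restrict_space space_PiM PiE_def)

lemma restrict_in_DD: "cadlag_on T x \<Longrightarrow> restrict x {0..T} \<in> space (DD T)"
  using cadlag_on_cong[of T "restrict x {0..T}" x] by (simp add: space_DD)

text \<open>\<open>DD T\<close> carries the trace of the product sigma-algebra, so measurability can
  be tested on coordinates once the values are known to be cadlag paths.\<close>

lemma measurable_into_DD:
  assumes "\<And>x. x \<in> space L \<Longrightarrow> f x \<in> space (DD T)" "\<And>t. t \<in> {0..T} \<Longrightarrow> (\<lambda>x. f x t) \<in> borel_measurable L"
  shows "f \<in> measurable L (DD T)"
  unfolding DD_def
proof (rule measurable_restrict_space2)
  show "f \<in> space L \<rightarrow> {x. cadlag_on T x}"
    using assms(1) by (auto simp: space_DD)
  have "(\<lambda>x. \<lambda>t\<in>{0..T}. f x t) \<in> measurable L (Pi\<^sub>M {0..T} (\<lambda>_. borel))"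
    using assms(2) by (rule measurable_restrict)
  also have "?this \<longleftrightarrow> f \<in> measurable L (Pi\<^sub>M {0..T} (\<lambda>_. borel))"
    using assms(1) by (intro measurable_cong) (auto simp: space_DD extensional_def fun_eq_iff)
  finally show "f \<in> measurable L (Pi\<^sub>M {0..T} (\<lambda>_. borel))" .
qed

lemma measurable_DD_eval:
  assumes "t \<in> {0..T}"
  shows "(\<lambda>x. x t) \<in> borel_measurable (DD T)"
  unfolding DD_def using assms by (intro measurable_restrict_space1 measurable_component_singleton)

lemma shift_path_apply:
  assumes "t \<in> {0..T}"
  shows "shift_path T y u v t = y t + (if u \<le> t then v else 0)"
  using assms by (auto simp: shift_path_def path_add_def indicator_def)

lemma shift_path_in_DD:
  assumes "cadlag_on T y"
  shows "shift_path T y u v \<in> space (DD T)"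
proof -
  have "cadlag_on T (\<lambda>s. y s + v * indicator {u..} s)"
    by (intro cadlag_on_add assms cadlag_on_mult_left cadlag_on_indicator)
  then have "(\<lambda>s\<in>{0..T}. y s + v * indicator {u..} s) \<in> space (DD T)"
    by (rule restrict_in_DD)
  also have "(\<lambda>s\<in>{0..T}. y s + v * indicator {u..} s) = shift_path T y u v"
    by (auto simp: shift_path_def path_add_def indicator_def fun_eq_iff)
  finally show ?thesis .
qed

section \<open>Poisson random measures\<close>

locale prm = prob_space M for M :: "'a measure" +
  fixes N :: "'a \<Rightarrow> 'b measure" and \<mu> :: "'b measure"
  assumes prm: "poisson_random_measure M N \<mu>"
begin

lemma sets_N: "\<omega> \<in> space M \<Longrightarrow> sets (N \<omega>) = sets \<mu>"
  using prm by (simp add: poisson_random_measure_def)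

lemma space_N: "\<omega> \<in> space M \<Longrightarrow> space (N \<omega>) = space \<mu>"
  using sets_N by (rule sets_eq_imp_space_eq)

lemma measurable_emeasure_N [measurable]:
  "B \<in> sets \<mu> \<Longrightarrow> (\<lambda>\<omega>. emeasure (N \<omega>) B) \<in> borel_measurable M"
  using prm by (simp add: poisson_random_measure_def)

text \<open>The Poisson weights of the natural numbers already sum to 1 by the exponential series,
  so all other values of the count form a null event and expectations become series.\<close>

lemma
  assumes B: "B \<in> sets \<mu>" "emeasure \<mu> B < \<infinity>"
  shows AE_emeasure_N_nat: "AE \<omega> in M. \<exists>k::nat. emeasure (N \<omega>) B = of_nat k"
    and nn_integral_emeasure_N: "f \<in> borel_measurable borel \<Longrightarrow> (\<integral>\<^sup>+\<omega>. f (emeasure (N \<omega>) B) \<partial>M) =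
      (\<Sum>k. f (of_nat k) * ennreal (measure \<mu> B ^ k / fact k * exp (- measure \<mu> B)))"
proof -
  define A where "A k = {\<omega>\<in>space M. emeasure (N \<omega>) B = of_nat k}" for k :: nat
  have A: "A k \<in> sets M" for k
    unfolding A_def using B by measurable
  have mA: "measure M (A k) = measure \<mu> B ^ k / fact k * exp (- measure \<mu> B)" for k
    using prm B by (simp add: poisson_random_measure_def A_def)
  have disj: "disjoint_family A"
    by (auto simp: disjoint_family_on_def A_def)
  have "(\<lambda>k. measure \<mu> B ^ k / fact k * exp (- measure \<mu> B)) sums (exp (measure \<mu> B) * exp (- measure \<mu> B))"
    using exp_converges[of "measure \<mu> B"]
    by (intro sums_mult2) (simp add: field_simps scaleR_conv_of_real)
  then have "(\<lambda>k. measure M (A k)) sums 1"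
    by (simp add: mA flip: exp_add)
  moreover have "(\<lambda>k. measure M (A k)) sums measure M (\<Union>k. A k)"
    using A disj by (intro finite_measure_UNION) auto
  ultimately have "measure M (\<Union>k. A k) = 1"
    using sums_unique2 by blast
  then have "AE \<omega> in M. \<omega> \<in> (\<Union>k. A k)"
    using A by (subst (asm) prob_eq_1) auto
  then show AE: "AE \<omega> in M. \<exists>k::nat. emeasure (N \<omega>) B = of_nat k"
    by eventually_elim (auto simp: A_def)
  assume f [measurable]: "f \<in> borel_measurable borel"
  have "(\<integral>\<^sup>+\<omega>. f (emeasure (N \<omega>) B) \<partial>M) = (\<integral>\<^sup>+\<omega>. (\<Sum>k. f (of_nat k) * indicator (A k) \<omega>) \<partial>M)"
  proof (rule nn_integral_cong_AE, use AE AE_space in eventually_elim)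
    case (elim \<omega>)
    then obtain k :: nat where k: "emeasure (N \<omega>) B = of_nat k" by blast
    have "(\<Sum>j. f (of_nat j) * indicator (A j) \<omega>) = (\<Sum>j\<in>{k}. f (of_nat j) * indicator (A j) \<omega>)"
      using k elim by (intro suminf_finite) (auto simp: A_def indicator_def)
    then show ?case using k elim by (simp add: A_def)
  qed
  also have "\<dots> = (\<Sum>k. f (of_nat k) * emeasure M (A k))"
    using A by (subst nn_integral_suminf) (auto simp: nn_integral_cmult_indicator)
  finally show "(\<integral>\<^sup>+\<omega>. f (emeasure (N \<omega>) B) \<partial>M) =
      (\<Sum>k. f (of_nat k) * ennreal (measure \<mu> B ^ k / fact k * exp (- measure \<mu> B)))"
    by (simp add: emeasure_eq_measure mA)
qed

lemma AE_emeasure_N_finite: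
  assumes "B \<in> sets \<mu>" "emeasure \<mu> B < \<infinity>"
  shows "AE \<omega> in M. emeasure (N \<omega>) B < \<infinity>"
  using AE_emeasure_N_nat[OF assms] by eventually_elim (auto simp: less_top[symmetric])

text \<open>With the Poisson weights \<open>p k\<close> this is \<open>(k + 1) p (k + 1) = m p k\<close>.\<close>

lemma nn_integral_emeasure_N_shift:
  assumes B: "B \<in> sets \<mu>" "emeasure \<mu> B < \<infinity>" and f [measurable]: "f \<in> borel_measurable borel"
  shows "(\<integral>\<^sup>+\<omega>. f (emeasure (N \<omega>) B) * emeasure (N \<omega>) B \<partial>M) =
    emeasure \<mu> B * (\<integral>\<^sup>+\<omega>. f (emeasure (N \<omega>) B + 1) \<partial>M)"
proof -
  define m where "m = measure \<mu> B"
  have m: "emeasure \<mu> B = ennreal m" "0 \<le> m"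
    using B(2) by (auto simp: m_def emeasure_eq_ennreal_measure)
  define p where "p k = m ^ k / fact k * exp (- m)" for k :: nat
  have p: "0 \<le> p k" for k using m by (simp add: p_def)
  have pS: "real (Suc k) * p (Suc k) = m * p k" for k
    by (simp add: p_def field_simps del: of_nat_Suc)
  have "(\<integral>\<^sup>+\<omega>. f (emeasure (N \<omega>) B) * emeasure (N \<omega>) B \<partial>M) =
      (\<Sum>k. f (of_nat k) * of_nat k * ennreal (p k))"
    using nn_integral_emeasure_N[OF B, of "\<lambda>x. f x * x"] by (simp add: p_def m_def)
  \<comment> \<open>The term k = 0 vanishes because of the factor \<open>of_nat k\<close>, so the
    index can be shifted by one.\<close>
  also have "\<dots> = (\<Sum>k. f (of_nat (Suc k)) * of_nat (Suc k) * ennreal (p (Suc k)))"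
    using suminf_offset[OF summableI, of "\<lambda>k. f (of_nat k) * of_nat k * ennreal (p k)" 1] by simp
  also have "\<dots> = (\<Sum>k. ennreal m * (f (of_nat k + 1) * ennreal (p k)))"
  proof (intro suminf_cong)
    fix k
    have "of_nat (Suc k) * ennreal (p (Suc k)) = ennreal (real (Suc k) * p (Suc k))"
      by (simp add: ennreal_mult'' p ennreal_of_nat_eq_real_of_nat del: of_nat_Suc)
    also have "\<dots> = ennreal m * ennreal (p k)"
      unfolding pS using m p by (simp add: ennreal_mult)
    finally show "f (of_nat (Suc k)) * of_nat (Suc k) * ennreal (p (Suc k)) =
        ennreal m * (f (of_nat k + 1) * ennreal (p k))"
      by (simp only: mult.assoc) (simp add: ac_simps)
  qed
  also have "\<dots> = ennreal m * (\<integral>\<^sup>+\<omega>. f (emeasure (N \<omega>) B + 1) \<partial>M)"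
    using nn_integral_emeasure_N[OF B, of "\<lambda>x. f (x + 1)"] by (simp add: p_def m_def)
  finally show ?thesis by (simp add: m)
qed

lemma nn_integral_emeasure_N_mean:
  assumes B: "B \<in> sets \<mu>"
  shows "(\<integral>\<^sup>+\<omega>. emeasure (N \<omega>) B \<partial>M) = emeasure \<mu> B"
proof (cases "emeasure \<mu> B < \<infinity>")
  case True
  then show ?thesis
    using nn_integral_emeasure_N_shift[OF B, of "\<lambda>_. 1"] by (simp add: emeasure_space_1)
next
  case False
  then have "AE \<omega> in M. emeasure (N \<omega>) B = \<infinity>"
    using prm B by (auto simp: poisson_random_measure_def less_top)
  then have "(\<integral>\<^sup>+\<omega>. emeasure (N \<omega>) B \<partial>M) = (\<integral>\<^sup>+\<omega>. \<infinity> \<partial>M)"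
    by (rule nn_integral_cong_AE)
  moreover have "emeasure \<mu> B = \<infinity>"
    using False by (metis infinity_ennreal_def top.not_eq_extremum)
  ultimately show ?thesis by (simp add: emeasure_space_1)
qed

text \<open>Induction over measurable functions, starting from the mean of a count. The two claims
  go together because additivity and monotone convergence of the outer integral need measurability
  of the inner one.\<close>

lemma
  assumes "f \<in> borel_measurable \<mu>"
  shows measurable_nn_integral_N: "(\<lambda>\<omega>. \<integral>\<^sup>+z. f z \<partial>N \<omega>) \<in> borel_measurable M"
    and campbell: "(\<integral>\<^sup>+\<omega>. \<integral>\<^sup>+z. f z \<partial>N \<omega> \<partial>M) = (\<integral>\<^sup>+z. f z \<partial>\<mu>)"
proof -
  have "(\<lambda>\<omega>. \<integral>\<^sup>+z. f z \<partial>N \<omega>) \<in> borel_measurable M \<and>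
    (\<integral>\<^sup>+\<omega>. \<integral>\<^sup>+z. f z \<partial>N \<omega> \<partial>M) = (\<integral>\<^sup>+z. f z \<partial>\<mu>)"
    using assms
  proof (induction rule: borel_measurable_induct)
    case (cong f g)
    have "(\<integral>\<^sup>+z. f z \<partial>N \<omega>) = (\<integral>\<^sup>+z. g z \<partial>N \<omega>)" if "\<omega> \<in> space M" for \<omega>
      using cong(3) that by (intro nn_integral_cong) (simp add: space_N)
    then show ?case
      using cong(4) by (simp cong: measurable_cong nn_integral_cong)
        (metis (no_types, lifting) cong.hyps(3) nn_integral_cong)
  next
    case (set A)
    have *: "(\<integral>\<^sup>+z. indicator A z \<partial>N \<omega>) = emeasure (N \<omega>) A" if "\<omega> \<in> space M" for \<omega>
      using set that by (simp add: sets_N)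
    show ?case
      using set by (simp add: * nn_integral_emeasure_N_mean cong: measurable_cong nn_integral_cong)
  next
    case (mult u c)
    then have *: "(\<integral>\<^sup>+z. c * u z \<partial>N \<omega>) = c * (\<integral>\<^sup>+z. u z \<partial>N \<omega>)" if "\<omega> \<in> space M" for \<omega>
      using that by (intro nn_integral_cmult) (simp add: measurable_cong_sets[OF sets_N refl])
    show ?case
      using mult by (auto simp: * nn_integral_cmult cong: measurable_cong nn_integral_cong)
  next
    case (add u v)
    then have *: "(\<integral>\<^sup>+z. v z + u z \<partial>N \<omega>) = (\<integral>\<^sup>+z. v z \<partial>N \<omega>) + (\<integral>\<^sup>+z. u z \<partial>N \<omega>)"
      if "\<omega> \<in> space M" for \<omega>
      using that by (intro nn_integral_add) (simp_all add: measurable_cong_sets[OF sets_N refl])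
    show ?case
      using add by (auto simp: * nn_integral_add cong: measurable_cong nn_integral_cong intro!: borel_measurable_add)
  next
    case (seq U)
    have *: "(\<integral>\<^sup>+z. (SUP i. U i) z \<partial>N \<omega>) = (SUP i. \<integral>\<^sup>+z. U i z \<partial>N \<omega>)"
      if "\<omega> \<in> space M" for \<omega>
      unfolding SUP_apply using that seq
      by (intro nn_integral_monotone_convergence_SUP) (simp_all add: measurable_cong_sets[OF sets_N refl])
    have mono: "incseq (\<lambda>i \<omega>. \<integral>\<^sup>+z. U i z \<partial>N \<omega>)"
      using \<open>incseq U\<close> by (auto simp: incseq_def le_fun_def intro!: nn_integral_mono)
    have "(\<integral>\<^sup>+\<omega>. (SUP i. \<integral>\<^sup>+z. U i z \<partial>N \<omega>) \<partial>M) = (SUP i. \<integral>\<^sup>+\<omega>. \<integral>\<^sup>+z. U i z \<partial>N \<omega> \<partial>M)"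
      using seq mono by (intro nn_integral_monotone_convergence_SUP) auto
    also have "\<dots> = (\<integral>\<^sup>+z. (SUP i. U i) z \<partial>\<mu>)"
      unfolding SUP_apply using seq by (simp add: nn_integral_monotone_convergence_SUP)
    finally have I: "(\<integral>\<^sup>+\<omega>. (SUP i. \<integral>\<^sup>+z. U i z \<partial>N \<omega>) \<partial>M) = (\<integral>\<^sup>+z. (SUP i. U i) z \<partial>\<mu>)" .
    have "(\<lambda>\<omega>. SUP i. \<integral>\<^sup>+z. U i z \<partial>N \<omega>) \<in> borel_measurable M"
      using seq by (intro borel_measurable_SUP) auto
    then have "(\<lambda>\<omega>. \<integral>\<^sup>+z. (SUP i. U i) z \<partial>N \<omega>) \<in> borel_measurable M"
      by (subst measurable_cong[OF *])
    moreover have "(\<integral>\<^sup>+\<omega>. \<integral>\<^sup>+z. (SUP i. U i) z \<partial>N \<omega> \<partial>M) = (\<integral>\<^sup>+z. (SUP i. U i) z \<partial>\<mu>)"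
      by (subst nn_integral_cong[OF *]) (simp_all only: I)
    ultimately show ?case
      unfolding \<open>f = _\<close> by blast
  qed
  then show "(\<lambda>\<omega>. \<integral>\<^sup>+z. f z \<partial>N \<omega>) \<in> borel_measurable M"
    "(\<integral>\<^sup>+\<omega>. \<integral>\<^sup>+z. f z \<partial>N \<omega> \<partial>M) = (\<integral>\<^sup>+z. f z \<partial>\<mu>)" by auto
qed

text \<open>Splits the integral into two nonnegative ones and makes the default value 0 explicit, so
  that measurability in \<omega> follows from the nonnegative case.\<close>

lemma integral_N_eq:
  fixes f :: "'b \<Rightarrow> real"
  assumes f: "f \<in> borel_measurable \<mu>" and \<omega>: "\<omega> \<in> space M"
  defines "P \<equiv> \<integral>\<^sup>+z. ennreal (f z) \<partial>N \<omega>" and "Q \<equiv> \<integral>\<^sup>+z. ennreal (- f z) \<partial>N \<omega>"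
  shows "(\<integral>z. f z \<partial>N \<omega>) = (if P \<noteq> \<infinity> \<and> Q \<noteq> \<infinity> then enn2real P - enn2real Q else 0)"
proof (cases "P \<noteq> \<infinity> \<and> Q \<noteq> \<infinity>")
  case True
  then have "integrable (N \<omega>) f"
    using assms by (simp add: real_integrable_def measurable_cong_sets[OF sets_N refl])
  then show ?thesis
    using True unfolding P_def Q_def by (simp add: real_lebesgue_integral_def)
next
  case False
  then have "\<not> integrable (N \<omega>) f"
    unfolding P_def Q_def real_integrable_def by auto
  then show ?thesis using False by (auto simp: not_integrable_integral_eq)
qed

lemma measurable_integral_N:
  fixes f :: "'b \<Rightarrow> real"
  assumes [measurable]: "f \<in> borel_measurable \<mu>"
  shows "(\<lambda>\<omega>. \<integral>z. f z \<partial>N \<omega>) \<in> borel_measurable M"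
proof -
  have [measurable]: "(\<lambda>\<omega>. \<integral>\<^sup>+z. ennreal (f z) \<partial>N \<omega>) \<in> borel_measurable M"
    "(\<lambda>\<omega>. \<integral>\<^sup>+z. ennreal (- f z) \<partial>N \<omega>) \<in> borel_measurable M"
    by (auto intro!: measurable_nn_integral_N)
  show ?thesis
    by (subst measurable_cong[OF integral_N_eq[OF assms]]) auto
qed

text \<open>The positive and negative parts have finite expectation by \<open>campbell\<close>,
  hence are finite almost surely; outside that event the inner integral is a mere default value and
  does not affect the outer one.\<close>

lemma
  fixes f :: "'b \<Rightarrow> real"
  assumes f: "integrable \<mu> f"
  shows campbell_integrable: "integrable M (\<lambda>\<omega>. \<integral>z. f z \<partial>N \<omega>)"
    and campbell_integral: "(\<integral>\<omega>. \<integral>z. f z \<partial>N \<omega> \<partial>M) = (\<integral>z. f z \<partial>\<mu>)"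
proof -
  have fm [measurable]: "f \<in> borel_measurable \<mu>" using f by auto
  define P where "P \<omega> = (\<integral>\<^sup>+z. ennreal (f z) \<partial>N \<omega>)" for \<omega>
  define Q where "Q \<omega> = (\<integral>\<^sup>+z. ennreal (- f z) \<partial>N \<omega>)" for \<omega>
  have [measurable]: "P \<in> borel_measurable M" "Q \<in> borel_measurable M"
    unfolding P_def Q_def by (auto intro!: measurable_nn_integral_N)
  have iP: "(\<integral>\<^sup>+\<omega>. P \<omega> \<partial>M) = (\<integral>\<^sup>+z. ennreal (f z) \<partial>\<mu>)"
    unfolding P_def by (rule campbell) auto
  have iQ: "(\<integral>\<^sup>+\<omega>. Q \<omega> \<partial>M) = (\<integral>\<^sup>+z. ennreal (- f z) \<partial>\<mu>)"
    unfolding Q_def by (rule campbell) auto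
  have finP: "(\<integral>\<^sup>+\<omega>. P \<omega> \<partial>M) \<noteq> \<infinity>" and finQ: "(\<integral>\<^sup>+\<omega>. Q \<omega> \<partial>M) \<noteq> \<infinity>"
    using f unfolding iP iQ real_integrable_def by auto
  have AP: "AE \<omega> in M. P \<omega> \<noteq> \<infinity>" and AQ: "AE \<omega> in M. Q \<omega> \<noteq> \<infinity>"
    by (rule nn_integral_PInf_AE[OF _ finP], simp, rule nn_integral_PInf_AE[OF _ finQ], simp)
  have eP: "(\<integral>\<^sup>+\<omega>. ennreal (enn2real (P \<omega>)) \<partial>M) = (\<integral>\<^sup>+\<omega>. P \<omega> \<partial>M)"
    using AP by (intro nn_integral_cong_AE) (auto elim!: eventually_mono simp: less_top)
  have eQ: "(\<integral>\<^sup>+\<omega>. ennreal (enn2real (Q \<omega>)) \<partial>M) = (\<integral>\<^sup>+\<omega>. Q \<omega> \<partial>M)"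
    using AQ by (intro nn_integral_cong_AE) (auto elim!: eventually_mono simp: less_top)
  have intP: "integrable M (\<lambda>\<omega>. enn2real (P \<omega>))" and intQ: "integrable M (\<lambda>\<omega>. enn2real (Q \<omega>))"
    using finP finQ eP eQ by (auto intro!: integrableI_nonneg simp: less_top)
  have NAE: "AE \<omega> in M. enn2real (P \<omega>) - enn2real (Q \<omega>) = (\<integral>z. f z \<partial>N \<omega>)"
    using AP AQ AE_space by eventually_elim (simp add: integral_N_eq[OF fm] P_def Q_def)
  note meas = measurable_integral_N[OF fm]
  show "integrable M (\<lambda>\<omega>. \<integral>z. f z \<partial>N \<omega>)"
    using integrable_cong_AE_imp[OF Bochner_Integration.integrable_diff[OF intP intQ] meas NAE] .
  have "(\<integral>\<omega>. \<integral>z. f z \<partial>N \<omega> \<partial>M) = (\<integral>\<omega>. enn2real (P \<omega>) - enn2real (Q \<omega>) \<partial>M)"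
    using NAE meas by (intro integral_cong_AE) auto
  also have "\<dots> = enn2real (\<integral>\<^sup>+\<omega>. P \<omega> \<partial>M) - enn2real (\<integral>\<^sup>+\<omega>. Q \<omega> \<partial>M)"
    using intP intQ by (simp add: integral_eq_nn_integral eP eQ)
  also have "\<dots> = (\<integral>z. f z \<partial>\<mu>)"
    unfolding iP iQ using f by (simp add: real_lebesgue_integral_def)
  finally show "(\<integral>\<omega>. \<integral>z. f z \<partial>N \<omega> \<partial>M) = (\<integral>z. f z \<partial>\<mu>)" .
qed

section \<open>The Mecke formula, from finitely many cells to limits\<close>

lemma mecke_cells:
  fixes n :: nat
  assumes B: "\<And>i. i < n \<Longrightarrow> B i \<in> sets \<mu>" "disjoint_family_on B {..<n}" and j: "j < n"
    and fin: "emeasure \<mu> (B j) < \<infinity>"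
    and K [measurable]: "K \<in> borel_measurable (Pi\<^sub>M {..<n} (\<lambda>_. borel))"
  shows "(\<integral>\<^sup>+\<omega>. K (\<lambda>i\<in>{..<n}. emeasure (N \<omega>) (B i)) * emeasure (N \<omega>) (B j) \<partial>M) =
    emeasure \<mu> (B j) * (\<integral>\<^sup>+\<omega>. K (\<lambda>i\<in>{..<n}. emeasure (N \<omega>) (B i) + (if i = j then 1 else 0)) \<partial>M)"
proof -
  let ?I = "{..<n} - {j}"
  let ?S = "Pi\<^sub>M ?I (\<lambda>_. borel :: ennreal measure)"
  define Xj where "Xj \<omega> = emeasure (N \<omega>) (B j)" for \<omega>
  let ?Sj = "Pi\<^sub>M {j} (\<lambda>_. borel :: ennreal measure)"
  \<comment> \<open>\<open>indep_var_restrict\<close> speaks of vectors indexed by sets, so the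
    count of cell \<open>j\<close> is also kept as a function on {j}.\<close>
  define Xf where "Xf \<omega> = (\<lambda>i\<in>{j}. emeasure (N \<omega>) (B i))" for \<omega>
  have Xfj: "Xf \<omega> j = Xj \<omega>" for \<omega>
    by (simp add: Xf_def Xj_def)
  define R where "R \<omega> = (\<lambda>i\<in>?I. emeasure (N \<omega>) (B i))" for \<omega>
  have [measurable]: "Xj \<in> borel_measurable M" "R \<in> measurable M ?S" "Xf \<in> measurable M ?Sj"
    unfolding Xj_def R_def Xf_def using B j by auto
  have ind: "indep_vars (\<lambda>_. borel) (\<lambda>i \<omega>. emeasure (N \<omega>) (B i)) {..<n}"
  proof -
    have "\<forall>(n::nat) B. (\<forall>i<n. B i \<in> sets \<mu>) \<and> disjoint_family_on B {..<n} \<longrightarrow>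
        indep_vars (\<lambda>_. borel) (\<lambda>i \<omega>. emeasure (N \<omega>) (B i)) {..<n}"
      using prm unfolding poisson_random_measure_def by (elim conjE)
    from this[THEN spec, of n, THEN spec, of B] show ?thesis
      using B by simp
  qed
  have "indep_var ?S R (Pi\<^sub>M {j} (\<lambda>_. borel)) (\<lambda>\<omega>. \<lambda>i\<in>{j}. emeasure (N \<omega>) (B i))"
    unfolding R_def using ind j by (intro indep_var_restrict) auto
  then have distr: "distr M (?S \<Otimes>\<^sub>M ?Sj) (\<lambda>\<omega>. (R \<omega>, Xf \<omega>)) = distr M ?S R \<Otimes>\<^sub>M distr M ?Sj Xf"
    by (simp add: indep_var_distribution_eq Xf_def[abs_def])
  interpret Xf: prob_space "distr M ?Sj Xf" by (rule prob_space_distr) simp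
  \<comment> \<open>Fubini for the independent pair: the count of cell \<open>j\<close> is
    integrated with all other counts frozen, which leaves the shift formula for one Poisson
    variable.\<close>
  have split: "(\<integral>\<^sup>+\<omega>. h (R \<omega>) (Xj \<omega>) \<partial>M) = (\<integral>\<^sup>+\<omega>'. (\<integral>\<^sup>+\<omega>. h (R \<omega>') (Xj \<omega>) \<partial>M) \<partial>M)"
    if [measurable]: "case_prod h \<in> borel_measurable (?S \<Otimes>\<^sub>M borel)" for h :: "(nat \<Rightarrow> ennreal) \<Rightarrow> ennreal \<Rightarrow> ennreal"
  proof -
    have [measurable]: "(\<lambda>x. x j) \<in> measurable ?Sj borel"
      by (rule measurable_component_singleton) simp
    have "(\<integral>\<^sup>+\<omega>. h (R \<omega>) (Xj \<omega>) \<partial>M) =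
        (\<integral>\<^sup>+p. h (fst p) (snd p j) \<partial>distr M (?S \<Otimes>\<^sub>M ?Sj) (\<lambda>\<omega>. (R \<omega>, Xf \<omega>)))"
      by (subst nn_integral_distr) (auto simp: Xfj)
    also have "\<dots> = (\<integral>\<^sup>+r. (\<integral>\<^sup>+x. h r (x j) \<partial>distr M ?Sj Xf) \<partial>distr M ?S R)"
      unfolding distr by (subst Xf.nn_integral_fst[symmetric]) auto
    also have "\<dots> = (\<integral>\<^sup>+\<omega>'. (\<integral>\<^sup>+x. h (R \<omega>') (x j) \<partial>distr M ?Sj Xf) \<partial>M)"
      by (subst nn_integral_distr) auto
    also have "\<dots> = (\<integral>\<^sup>+\<omega>'. (\<integral>\<^sup>+\<omega>. h (R \<omega>') (Xj \<omega>) \<partial>M) \<partial>M)"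
    proof (rule nn_integral_cong)
      fix \<omega>' assume "\<omega>' \<in> space M"
      then have "R \<omega>' \<in> space ?S" by (auto intro: measurable_space)
      then show "(\<integral>\<^sup>+x. h (R \<omega>') (x j) \<partial>distr M ?Sj Xf) = (\<integral>\<^sup>+\<omega>. h (R \<omega>') (Xj \<omega>) \<partial>M)"
        by (subst nn_integral_distr) (auto simp: Xfj)
    qed
    finally show ?thesis .
  qed
  have ins: "insert j ?I = {..<n}" using j by auto
  define h where "h r x = K (r(j := x))" for r x
  have upd: "(\<lambda>(r, x). r(j := x)) \<in> measurable (?S \<Otimes>\<^sub>M borel) (Pi\<^sub>M {..<n} (\<lambda>_. borel))"
    using measurable_add_dim[of j ?I "\<lambda>_. borel"] unfolding ins by simp
  have [measurable]: "case_prod h \<in> borel_measurable (?S \<Otimes>\<^sub>M borel)"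
    using measurable_compose[OF upd K] by (simp add: h_def case_prod_beta')
  have "(\<integral>\<^sup>+\<omega>. K (\<lambda>i\<in>{..<n}. emeasure (N \<omega>) (B i)) * emeasure (N \<omega>) (B j) \<partial>M) =
      (\<integral>\<^sup>+\<omega>. h (R \<omega>) (Xj \<omega>) * Xj \<omega> \<partial>M)"
    using j by (intro nn_integral_cong arg_cong2[where f="(*)"] arg_cong[where f=K])
      (auto simp: h_def R_def Xj_def fun_eq_iff intro!: arg_cong[where f=K])
  also have "\<dots> = (\<integral>\<^sup>+\<omega>'. (\<integral>\<^sup>+\<omega>. h (R \<omega>') (Xj \<omega>) * Xj \<omega> \<partial>M) \<partial>M)"
    by (rule split) simp
  also have "\<dots> = (\<integral>\<^sup>+\<omega>'. emeasure \<mu> (B j) * (\<integral>\<^sup>+\<omega>. h (R \<omega>') (Xj \<omega> + 1) \<partial>M) \<partial>M)"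
  proof (rule nn_integral_cong)
    fix \<omega>' assume "\<omega>' \<in> space M"
    then have "R \<omega>' \<in> space ?S" by (auto intro: measurable_space)
    then have "h (R \<omega>') \<in> borel_measurable borel" by auto
    from nn_integral_emeasure_N_shift[OF B(1)[OF j] fin this]
    show "(\<integral>\<^sup>+\<omega>. h (R \<omega>') (Xj \<omega>) * Xj \<omega> \<partial>M) = emeasure \<mu> (B j) * (\<integral>\<^sup>+\<omega>. h (R \<omega>') (Xj \<omega> + 1) \<partial>M)"
      by (simp add: Xj_def)
  qed
  also have "\<dots> = emeasure \<mu> (B j) * (\<integral>\<^sup>+\<omega>. h (R \<omega>) (Xj \<omega> + 1) \<partial>M)"
  proof -
    have "(\<integral>\<^sup>+\<omega>. h (R \<omega>) (Xj \<omega> + 1) \<partial>M) = (\<integral>\<^sup>+\<omega>'. (\<integral>\<^sup>+\<omega>. h (R \<omega>') (Xj \<omega> + 1) \<partial>M) \<partial>M)"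
      by (rule split) measurable
    then show ?thesis by (simp add: nn_integral_cmult)
  qed
  also have "(\<integral>\<^sup>+\<omega>. h (R \<omega>) (Xj \<omega> + 1) \<partial>M) =
      (\<integral>\<^sup>+\<omega>. K (\<lambda>i\<in>{..<n}. emeasure (N \<omega>) (B i) + (if i = j then 1 else 0)) \<partial>M)"
    using j by (intro nn_integral_cong)
      (auto simp: h_def R_def Xj_def fun_eq_iff intro!: arg_cong[where f=K])
  finally show ?thesis .
qed

text \<open>The Mecke formula for the functional \<open>V\<close> of the random measure, tested on \<open>C\<close>: adding an atom
  at \<open>z\<close> moves \<open>V\<close> by \<open>q z\<close>.\<close>

definition mecke_pair :: "'b set \<Rightarrow> 't set \<Rightarrow> ('t \<Rightarrow> 'a \<Rightarrow> real) \<Rightarrow> ('t \<Rightarrow> 'b \<Rightarrow> real) \<Rightarrow> bool" where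
  "mecke_pair C J V q \<longleftrightarrow>
     (\<forall>t\<in>J. V t \<in> borel_measurable M \<and> q t \<in> borel_measurable \<mu>) \<and>
     (\<forall>g :: 't \<Rightarrow> real \<Rightarrow> real. (\<forall>t\<in>J. continuous_on UNIV (g t) \<and> range (g t) \<subseteq> {0..1}) \<longrightarrow>
       (\<integral>\<^sup>+\<omega>. ennreal (\<Prod>t\<in>J. g t (V t \<omega>)) * emeasure (N \<omega>) C \<partial>M) =
       (\<integral>\<^sup>+z\<in>C. (\<integral>\<^sup>+\<omega>. ennreal (\<Prod>t\<in>J. g t (V t \<omega> + q t z)) \<partial>M) \<partial>\<mu>))"

text \<open>A deterministic term, such as drift or compensator, is absorbed by translating the test
  functions.\<close>

lemma mecke_pair_shift:
  assumes "mecke_pair C J V q"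
  shows "mecke_pair C J (\<lambda>t \<omega>. V t \<omega> + c t) q"
  unfolding mecke_pair_def
proof (intro conjI allI impI)
  show "\<forall>t\<in>J. (\<lambda>\<omega>. V t \<omega> + c t) \<in> borel_measurable M \<and> q t \<in> borel_measurable \<mu>"
    using assms by (auto simp: mecke_pair_def)
  fix g :: "'c \<Rightarrow> real \<Rightarrow> real"
  assume g: "\<forall>t\<in>J. continuous_on UNIV (g t) \<and> range (g t) \<subseteq> {0..1}"
  have "\<forall>t\<in>J. continuous_on UNIV (\<lambda>x. g t (x + c t)) \<and> range (\<lambda>x. g t (x + c t)) \<subseteq> {0..1}"
  proof (intro ballI conjI)
    fix t assume "t \<in> J"
    then have gt: "continuous_on UNIV (g t)" "range (g t) \<subseteq> {0..1}" using g by auto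
    show "continuous_on UNIV (\<lambda>x. g t (x + c t))"
      by (rule continuous_on_compose2[OF gt(1)]) (auto intro!: continuous_intros)
    show "range (\<lambda>x. g t (x + c t)) \<subseteq> {0..1}"
      using gt(2) by (simp add: image_subset_iff)
  qed
  then have "(\<integral>\<^sup>+\<omega>. ennreal (\<Prod>t\<in>J. g t (V t \<omega> + c t)) * emeasure (N \<omega>) C \<partial>M) =
       (\<integral>\<^sup>+z\<in>C. (\<integral>\<^sup>+\<omega>. ennreal (\<Prod>t\<in>J. g t (V t \<omega> + q t z + c t)) \<partial>M) \<partial>\<mu>)"
    using assms[unfolded mecke_pair_def, THEN conjunct2, THEN spec, of "\<lambda>t x. g t (x + c t)"] by simp
  then show "(\<integral>\<^sup>+\<omega>. ennreal (\<Prod>t\<in>J. g t (V t \<omega> + c t)) * emeasure (N \<omega>) C \<partial>M) =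
       (\<integral>\<^sup>+z\<in>C. (\<integral>\<^sup>+\<omega>. ennreal (\<Prod>t\<in>J. g t (V t \<omega> + c t + q t z)) \<partial>M) \<partial>\<mu>)"
    by (simp add: ac_simps)
qed

text \<open>Dominated convergence on both sides. The tests lie in [0,1], so the left side is
  dominated by the count of \<open>C\<close>, whose mean is finite, and the right side by the
  indicator of \<open>C\<close>; continuity of the tests carries the convergence.\<close>

lemma mecke_pair_limit:
  assumes mp: "\<And>m. mecke_pair C J (V m) (q m)" and J: "finite J"
    and C: "C \<in> sets \<mu>" "emeasure \<mu> C < \<infinity>" and \<mu>: "sigma_finite_measure \<mu>"
    and meas: "\<And>t. t \<in> J \<Longrightarrow> W t \<in> borel_measurable M" "\<And>t. t \<in> J \<Longrightarrow> p t \<in> borel_measurable \<mu>"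
    and lim: "\<And>t. t \<in> J \<Longrightarrow> AE \<omega> in M. (\<lambda>m. V m t \<omega>) \<longlonglongrightarrow> W t \<omega>"
      "\<And>t z. t \<in> J \<Longrightarrow> z \<in> C \<Longrightarrow> (\<lambda>m. q m t z) \<longlonglongrightarrow> p t z"
  shows "mecke_pair C J W p"
  unfolding mecke_pair_def
proof (intro conjI allI impI)
  show "\<forall>t\<in>J. W t \<in> borel_measurable M \<and> p t \<in> borel_measurable \<mu>"
    using meas by auto
  fix g :: "'c \<Rightarrow> real \<Rightarrow> real"
  assume g: "\<forall>t\<in>J. continuous_on UNIV (g t) \<and> range (g t) \<subseteq> {0..1}"
  have gm [measurable]: "g t \<in> borel_measurable borel" if "t \<in> J" for t
    using g that by (auto intro: borel_measurable_continuous_onI)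
  have "0 \<le> g t y" "g t y \<le> 1" if "t \<in> J" for t y
    using g that by (auto simp: image_subset_iff)
  then have g01: "0 \<le> (\<Prod>t\<in>J. g t (x t))" "(\<Prod>t\<in>J. g t (x t)) \<le> 1" for x
    by (auto intro!: prod_nonneg prod_le_1)
  have Vm [measurable]: "V m t \<in> borel_measurable M" "q m t \<in> borel_measurable \<mu>" if "t \<in> J" for m t
    using mp[of m] that by (auto simp: mecke_pair_def)
  note [measurable] = meas
  have tends: "(\<lambda>m. ennreal (\<Prod>t\<in>J. g t (x m t))) \<longlonglongrightarrow> ennreal (\<Prod>t\<in>J. g t (y t))"
    if "\<And>t. t \<in> J \<Longrightarrow> (\<lambda>m. x m t) \<longlonglongrightarrow> y t" for x y
    using g that
    by (intro tendsto_ennrealI tendsto_prod) (auto intro!: continuous_on_tendsto_compose[of UNIV "g _"])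
  have AE_all: "AE \<omega> in M. \<forall>t\<in>J. (\<lambda>m. V m t \<omega>) \<longlonglongrightarrow> W t \<omega>"
    using lim(1) J by (auto intro!: AE_finite_allI)
  have prodm: "(\<lambda>\<omega>. ennreal (\<Prod>t\<in>J. g t (f t \<omega>))) \<in> borel_measurable L"
    if "\<And>t. t \<in> J \<Longrightarrow> f t \<in> borel_measurable L" for f and L :: "'z measure"
    using that gm by (intro measurable_compose[OF _ measurable_ennreal] borel_measurable_prod)
      (auto intro: measurable_compose)
  have "(\<lambda>m. \<integral>\<^sup>+\<omega>. ennreal (\<Prod>t\<in>J. g t (V m t \<omega>)) * emeasure (N \<omega>) C \<partial>M) \<longlonglongrightarrow>
      (\<integral>\<^sup>+\<omega>. ennreal (\<Prod>t\<in>J. g t (W t \<omega>)) * emeasure (N \<omega>) C \<partial>M)"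
  proof (rule nn_integral_dominated_convergence[where w = "\<lambda>\<omega>. emeasure (N \<omega>) C"])
    show "AE \<omega> in M. ennreal (\<Prod>t\<in>J. g t (V m t \<omega>)) * emeasure (N \<omega>) C \<le> emeasure (N \<omega>) C" for m
    proof (intro AE_I2)
      fix \<omega>
      have "ennreal (\<Prod>t\<in>J. g t (V m t \<omega>)) \<le> 1"
        using g01 by (simp add: ennreal_le_1)
      then show "ennreal (\<Prod>t\<in>J. g t (V m t \<omega>)) * emeasure (N \<omega>) C \<le> emeasure (N \<omega>) C"
        using mult_right_mono[of _ 1 "emeasure (N \<omega>) C"] by fastforce
    qed
    show "(\<integral>\<^sup>+\<omega>. emeasure (N \<omega>) C \<partial>M) < \<infinity>"
      using C by (simp add: nn_integral_emeasure_N_mean)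
    show "AE \<omega> in M. (\<lambda>m. ennreal (\<Prod>t\<in>J. g t (V m t \<omega>)) * emeasure (N \<omega>) C)
        \<longlonglongrightarrow> ennreal (\<Prod>t\<in>J. g t (W t \<omega>)) * emeasure (N \<omega>) C"
      \<comment> \<open>A finite count is required because multiplication by infinity is not
        continuous on the extended nonnegative reals.\<close>
      using AE_all AE_emeasure_N_finite[OF C]
    proof eventually_elim
      case (elim \<omega>)
      then show ?case
        by (subst (1 2) mult.commute) (auto intro!: ennreal_tendsto_cmult tends simp: less_top)
    qed
  qed (use C in \<open>auto intro!: borel_measurable_times prodm\<close>)
  moreover have "(\<lambda>m. \<integral>\<^sup>+z\<in>C. (\<integral>\<^sup>+\<omega>. ennreal (\<Prod>t\<in>J. g t (V m t \<omega> + q m t z)) \<partial>M) \<partial>\<mu>) \<longlonglongrightarrow>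
      (\<integral>\<^sup>+z\<in>C. (\<integral>\<^sup>+\<omega>. ennreal (\<Prod>t\<in>J. g t (W t \<omega> + p t z)) \<partial>M) \<partial>\<mu>)"
  proof (rule nn_integral_dominated_convergence[where w = "indicator C"])
    have le1: "(\<integral>\<^sup>+\<omega>. ennreal (\<Prod>t\<in>J. g t (f t \<omega>)) \<partial>M) \<le> 1" for f
    proof -
      have "(\<integral>\<^sup>+\<omega>. ennreal (\<Prod>t\<in>J. g t (f t \<omega>)) \<partial>M) \<le> (\<integral>\<^sup>+\<omega>. 1 \<partial>M)"
        using g01 by (intro nn_integral_mono) (simp add: ennreal_le_1)
      then show ?thesis by (simp add: emeasure_space_1)
    qed
    then show "AE z in \<mu>. (\<integral>\<^sup>+\<omega>. ennreal (\<Prod>t\<in>J. g t (V m t \<omega> + q m t z)) \<partial>M) * indicator C z \<le> indicator C z" for m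
      by (intro AE_I2) (auto simp: indicator_def)
    show "(\<integral>\<^sup>+z. indicator C z \<partial>\<mu>) < \<infinity>"
      using C by simp
    show "AE z in \<mu>. (\<lambda>m. (\<integral>\<^sup>+\<omega>. ennreal (\<Prod>t\<in>J. g t (V m t \<omega> + q m t z)) \<partial>M) * indicator C z) \<longlonglongrightarrow>
       (\<integral>\<^sup>+\<omega>. ennreal (\<Prod>t\<in>J. g t (W t \<omega> + p t z)) \<partial>M) * indicator C z"
    proof (rule AE_I2)
      fix z
      have "(\<lambda>m. (\<integral>\<^sup>+\<omega>. ennreal (\<Prod>t\<in>J. g t (V m t \<omega> + q m t z)) \<partial>M)) \<longlonglongrightarrow>
        (\<integral>\<^sup>+\<omega>. ennreal (\<Prod>t\<in>J. g t (W t \<omega> + p t z)) \<partial>M)" if z: "z \<in> C"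
      proof (rule nn_integral_dominated_convergence[where w = "\<lambda>_. 1"])
        show "AE \<omega> in M. (\<lambda>m. ennreal (\<Prod>t\<in>J. g t (V m t \<omega> + q m t z)))
            \<longlonglongrightarrow> ennreal (\<Prod>t\<in>J. g t (W t \<omega> + p t z))"
          using AE_all
        proof eventually_elim
          case (elim \<omega>)
          then show ?case using lim(2) z by (intro tends tendsto_add) auto
        qed
      qed (use g01 in \<open>auto intro!: prodm simp: emeasure_space_1 ennreal_le_1\<close>)
      then show "(\<lambda>m. (\<integral>\<^sup>+\<omega>. ennreal (\<Prod>t\<in>J. g t (V m t \<omega> + q m t z)) \<partial>M) * indicator C z) \<longlonglongrightarrow>
       (\<integral>\<^sup>+\<omega>. ennreal (\<Prod>t\<in>J. g t (W t \<omega> + p t z)) \<partial>M) * indicator C z"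
        by (auto simp: indicator_def)
    qed
    have mm: "(\<lambda>z. (\<integral>\<^sup>+\<omega>. ennreal (\<Prod>t\<in>J. g t (U t \<omega> + r t z)) \<partial>M) * indicator C z) \<in> borel_measurable \<mu>"
      if [measurable]: "\<And>t. t \<in> J \<Longrightarrow> U t \<in> borel_measurable M" "\<And>t. t \<in> J \<Longrightarrow> r t \<in> borel_measurable \<mu>" for U r
    proof -
      have "(\<lambda>(z, \<omega>). ennreal (\<Prod>t\<in>J. g t (U t \<omega> + r t z))) \<in> borel_measurable (\<mu> \<Otimes>\<^sub>M M)"
        unfolding case_prod_beta' by (intro prodm) simp
      then show ?thesis
        using C by (intro borel_measurable_times_ennreal borel_measurable_nn_integral) auto
    qed
    show "(\<lambda>z. (\<integral>\<^sup>+\<omega>. ennreal (\<Prod>t\<in>J. g t (V m t \<omega> + q m t z)) \<partial>M) * indicator C z) \<in> borel_measurable \<mu>" for m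
      by (intro mm) auto
    show "(\<lambda>z. (\<integral>\<^sup>+\<omega>. ennreal (\<Prod>t\<in>J. g t (W t \<omega> + p t z)) \<partial>M) * indicator C z) \<in> borel_measurable \<mu>"
      by (intro mm meas)
  qed (use C in auto)
  moreover have "(\<integral>\<^sup>+\<omega>. ennreal (\<Prod>t\<in>J. g t (V m t \<omega>)) * emeasure (N \<omega>) C \<partial>M) =
       (\<integral>\<^sup>+z\<in>C. (\<integral>\<^sup>+\<omega>. ennreal (\<Prod>t\<in>J. g t (V m t \<omega> + q m t z)) \<partial>M) \<partial>\<mu>)" for m
    using mp[of m] g unfolding mecke_pair_def by blast
  ultimately show "(\<integral>\<^sup>+\<omega>. ennreal (\<Prod>t\<in>J. g t (W t \<omega>)) * emeasure (N \<omega>) C \<partial>M) =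
       (\<integral>\<^sup>+z\<in>C. (\<integral>\<^sup>+\<omega>. ennreal (\<Prod>t\<in>J. g t (W t \<omega> + p t z)) \<partial>M) \<partial>\<mu>)"
    using LIMSEQ_unique by simp
qed

text \<open>\<open>E\<close> splits into finitely many cells on which every \<open>q t\<close> is
  constant. The functional is then linear in the cell counts, and an atom in cell \<open>j\<close>
  raises that one count by 1, so the formula for cells applies to each cell of \<open>C\<close> and
  the results are added.\<close>

lemma mecke_pair_simple:
  fixes q :: "'t \<Rightarrow> 'b \<Rightarrow> real"
  assumes J: "finite J" and q: "\<And>t. t \<in> J \<Longrightarrow> simple_function \<mu> (q t)"
    and E: "E \<in> sets \<mu>" "emeasure \<mu> E < \<infinity>" and C: "C \<in> sets \<mu>" "C \<subseteq> E"
  shows "mecke_pair C J (\<lambda>t \<omega>. LINT z:E|N \<omega>. q t z) q"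
  unfolding mecke_pair_def
proof (intro conjI allI impI)
  have qm [measurable]: "q t \<in> borel_measurable \<mu>" if "t \<in> J" for t
    using q[OF that] by (rule borel_measurable_simple_function)
  \<comment> \<open>Membership in \<open>C\<close> is part of the label, so that \<open>C\<close> is
    a union of cells.\<close>
  define val where "val z = (restrict (\<lambda>t. q t z) J, z \<in> C)" for z
  have "val ` E \<subseteq> Pi\<^sub>E J (\<lambda>t. q t ` space \<mu>) \<times> UNIV"
    using sets.sets_into_space[OF E(1)] by (auto simp: val_def)
  moreover have "finite (Pi\<^sub>E J (\<lambda>t. q t ` space \<mu>) \<times> (UNIV :: bool set))"
    using J q by (intro finite_cartesian_product finite_PiE) (auto simp: simple_function_def)
  ultimately have "finite (val ` E)" by (rule finite_subset)
  then obtain h and n :: nat where h: "bij_betw h {..<n} (val ` E)"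
    using ex_bij_betw_nat_finite[of "val ` E"] by (auto simp: atLeast0LessThan)
  define B where "B i = {z\<in>E. val z = h i}" for i
  define c where "c t i = fst (h i) t" for t i
  define IC where "IC = {i. i < n \<and> snd (h i)}"
  have Esub: "z \<in> E \<Longrightarrow> z \<in> space \<mu>" for z using sets.sets_into_space[OF E(1)] by auto
  have B_sets: "B i \<in> sets \<mu>" if "i < n" for i
  proof -
    have hi: "h i \<in> val ` E" using h that by (auto simp: bij_betw_def)
    then have "fst (h i) \<in> extensional J" by (auto simp: val_def)
    then have "B i = {z\<in>space \<mu>. z \<in> E \<and> (\<forall>t\<in>J. q t z = fst (h i) t) \<and> (z \<in> C \<longleftrightarrow> snd (h i))}"
      using Esub by (auto simp: B_def val_def prod_eq_iff fun_eq_iff extensional_def)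
    also have "\<dots> \<in> sets \<mu>"
      using E C J by measurable
    finally show ?thesis .
  qed
  have B_disj: "disjoint_family_on B {..<n}"
    using h by (auto simp: disjoint_family_on_def B_def bij_betw_def inj_on_def)
  have B_UN: "(\<Union>i<n. B i) = E"
  proof (intro set_eqI iffI)
    fix z assume "z \<in> E"
    then have "val z \<in> h ` {..<n}" using bij_betw_imp_surj_on[OF h] by simp
    then show "z \<in> (\<Union>i<n. B i)" using \<open>z \<in> E\<close> by (auto simp: B_def)
  qed (auto simp: B_def)
  have q_B: "q t z = c t i" if "z \<in> B i" "t \<in> J" for t z i
  proof -
    have "fst (val z) t = fst (h i) t" using that by (simp add: B_def)
    then show ?thesis using that by (simp add: val_def c_def)
  qed
  have C_UN: "(\<Union>i\<in>IC. B i) = C"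
  proof -
    have "z \<in> C \<longleftrightarrow> i \<in> IC" if "z \<in> B i" "i < n" for z i
    proof -
      have "snd (val z) = snd (h i)" using that by (simp add: B_def)
      then show ?thesis using that by (simp add: val_def IC_def)
    qed
    moreover have "\<exists>i<n. z \<in> B i" if "z \<in> C" for z
      using that C B_UN by blast
    moreover have "i < n" if "i \<in> IC" for i
      using that by (simp add: IC_def)
    ultimately show ?thesis by blast
  qed
  have IC: "finite IC" "IC \<subseteq> {..<n}" by (auto simp: IC_def)
  have B_fin: "emeasure \<mu> (B i) < \<infinity>" if "i < n" for i
    using emeasure_mono[of "B i" E \<mu>] E by (auto simp: B_def intro: le_less_trans)
  \<comment> \<open>Needed because passing to real counts by \<open>enn2real\<close> respects the
    addition of 1 only at finite values.\<close>
  have NB_fin: "AE \<omega> in M. \<forall>i<n. emeasure (N \<omega>) (B i) < \<infinity>"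
    using AE_emeasure_N_finite[OF B_sets B_fin]
    by (subst AE_all_countable) (auto intro!: AE_impI)
  have int: "(LINT z:E|N \<omega>. q t z) = (\<Sum>i<n. c t i * measure (N \<omega>) (B i))"
    if \<omega>: "\<omega> \<in> space M" "\<forall>i<n. emeasure (N \<omega>) (B i) < \<infinity>" and t: "t \<in> J" for \<omega> t
  proof -
    have eq: "indicator E z *\<^sub>R q t z = (\<Sum>i<n. c t i * indicator (B i) z)" for z
    proof (cases "z \<in> E")
      case True
      then obtain i where i: "i < n" "z \<in> B i" using B_UN by blast
      have "(\<Sum>j<n. c t j * indicator (B j) z) = (\<Sum>j\<in>{i}. c t j * indicator (B j) z)"
        using i B_disj by (intro sum.mono_neutral_right) (auto simp: disjoint_family_on_def indicator_def)
      then show ?thesis using i True q_B t by simp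
    next
      case False
      then have "z \<notin> B i" for i by (simp add: B_def)
      then show ?thesis using False by simp
    qed
    have "integrable (N \<omega>) (\<lambda>z. c t i * indicator (B i) z)" if "i < n" for i
      using \<omega> that B_sets by (auto simp: sets_N)
    then show ?thesis
      unfolding set_lebesgue_integral_def eq using \<omega> B_sets
      by (subst Bochner_Integration.integral_sum) (auto simp: sets_N Int_absorb2 sets.sets_into_space space_N)
  qed
  have [measurable]: "(\<lambda>\<omega>. measure (N \<omega>) (B i)) \<in> borel_measurable M" if "i < n" for i
    unfolding measure_def using B_sets[OF that] by measurable
  have intm [measurable]: "(\<lambda>\<omega>. LINT z:E|N \<omega>. q t z) \<in> borel_measurable M" if "t \<in> J" for t
    unfolding set_lebesgue_integral_def using E qm[OF that]
    by (intro measurable_integral_N borel_measurable_scaleR borel_measurable_indicator)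
  then show "\<forall>t\<in>J. (\<lambda>\<omega>. LINT z:E|N \<omega>. q t z) \<in> borel_measurable M \<and> q t \<in> borel_measurable \<mu>"
    using qm by blast
  fix g :: "'t \<Rightarrow> real \<Rightarrow> real"
  assume g: "\<forall>t\<in>J. continuous_on UNIV (g t) \<and> range (g t) \<subseteq> {0..1}"
  have gm [measurable]: "g t \<in> borel_measurable borel" if "t \<in> J" for t
    using g that by (auto intro: borel_measurable_continuous_onI)
  \<comment> \<open>Off a null set the tested functional depends on \<omega> only through the vector
    of cell counts.\<close>
  define K where "K x = ennreal (\<Prod>t\<in>J. g t (\<Sum>i<n. c t i * enn2real (x i)))" for x
  have Km: "K \<in> borel_measurable (Pi\<^sub>M {..<n} (\<lambda>_. borel))"
    unfolding K_def by measurable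
  define A where "A i = (\<integral>\<^sup>+\<omega>. ennreal (\<Prod>t\<in>J. g t ((LINT z:E|N \<omega>. q t z) + c t i)) \<partial>M)" for i
  have cell: "(\<integral>\<^sup>+\<omega>. ennreal (\<Prod>t\<in>J. g t (LINT z:E|N \<omega>. q t z)) * emeasure (N \<omega>) (B j) \<partial>M) =
      emeasure \<mu> (B j) * A j" if j: "j < n" for j
  proof -
    have "(\<integral>\<^sup>+\<omega>. ennreal (\<Prod>t\<in>J. g t (LINT z:E|N \<omega>. q t z)) * emeasure (N \<omega>) (B j) \<partial>M) =
        (\<integral>\<^sup>+\<omega>. K (\<lambda>i\<in>{..<n}. emeasure (N \<omega>) (B i)) * emeasure (N \<omega>) (B j) \<partial>M)"
      by (rule nn_integral_cong_AE, use NB_fin AE_space in eventually_elim)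
        (simp add: K_def int measure_def)
    also have "\<dots> = emeasure \<mu> (B j) *
        (\<integral>\<^sup>+\<omega>. K (\<lambda>i\<in>{..<n}. emeasure (N \<omega>) (B i) + (if i = j then 1 else 0)) \<partial>M)"
      by (rule mecke_cells[OF B_sets B_disj j B_fin[OF j] Km])
    also have "(\<integral>\<^sup>+\<omega>. K (\<lambda>i\<in>{..<n}. emeasure (N \<omega>) (B i) + (if i = j then 1 else 0)) \<partial>M) = A j"
      unfolding A_def
    proof (rule nn_integral_cong_AE, use NB_fin AE_space in eventually_elim)
      case (elim \<omega>)
      have "(\<Sum>i<n. c t i * enn2real (emeasure (N \<omega>) (B i) + (if i = j then 1 else 0))) =
          (LINT z:E|N \<omega>. q t z) + c t j" if "t \<in> J" for t
      proof -
        have "(\<Sum>i<n. c t i * enn2real (emeasure (N \<omega>) (B i) + (if i = j then 1 else 0))) =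
          (\<Sum>i<n. c t i * measure (N \<omega>) (B i) + (if i = j then c t i else 0))"
          using elim by (intro sum.cong) (auto simp: enn2real_plus measure_def algebra_simps)
        then show ?thesis
          using elim int[OF _ _ that] j by (simp add: sum.distrib)
      qed
      then show ?case by (simp add: K_def)
    qed
    finally show ?thesis .
  qed
  have "(\<integral>\<^sup>+\<omega>. ennreal (\<Prod>t\<in>J. g t (LINT z:E|N \<omega>. q t z)) * emeasure (N \<omega>) C \<partial>M) =
      (\<integral>\<^sup>+\<omega>. (\<Sum>i\<in>IC. ennreal (\<Prod>t\<in>J. g t (LINT z:E|N \<omega>. q t z)) * emeasure (N \<omega>) (B i)) \<partial>M)"
  proof (rule nn_integral_cong)
    fix \<omega> assume "\<omega> \<in> space M"
    then have "emeasure (N \<omega>) C = (\<Sum>i\<in>IC. emeasure (N \<omega>) (B i))"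
      unfolding C_UN[symmetric] using IC B_sets disjoint_family_on_mono[OF IC(2) B_disj]
      by (intro sum_emeasure[symmetric]) (auto simp: sets_N)
    then show "ennreal (\<Prod>t\<in>J. g t (LINT z:E|N \<omega>. q t z)) * emeasure (N \<omega>) C =
        (\<Sum>i\<in>IC. ennreal (\<Prod>t\<in>J. g t (LINT z:E|N \<omega>. q t z)) * emeasure (N \<omega>) (B i))"
      by (simp add: sum_distrib_left)
  qed
  also have "\<dots> = (\<Sum>i\<in>IC. emeasure \<mu> (B i) * A i)"
  proof (subst nn_integral_sum)
    show "(\<lambda>\<omega>. ennreal (\<Prod>t\<in>J. g t (LINT z:E|N \<omega>. q t z)) * emeasure (N \<omega>) (B i)) \<in> borel_measurable M"
      if "i \<in> IC" for i
      using intm gm B_sets[of i] that IC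
      by (intro borel_measurable_times_ennreal measurable_compose[OF _ measurable_ennreal] borel_measurable_prod)
        (auto intro: measurable_compose)
  qed (use cell IC in \<open>auto intro!: sum.cong\<close>)
  also have "\<dots> = (\<Sum>i\<in>IC. (\<integral>\<^sup>+z\<in>B i. A i \<partial>\<mu>))"
    using B_sets IC by (intro sum.cong) (auto simp: nn_integral_cmult_indicator mult.commute)
  also have "\<dots> = (\<integral>\<^sup>+z. (\<Sum>i\<in>IC. A i * indicator (B i) z) \<partial>\<mu>)"
    using B_sets IC by (subst nn_integral_sum) auto
  also have "\<dots> = (\<integral>\<^sup>+z\<in>C. (\<integral>\<^sup>+\<omega>. ennreal (\<Prod>t\<in>J. g t ((LINT z:E|N \<omega>. q t z) + q t z)) \<partial>M) \<partial>\<mu>)"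
  proof (rule nn_integral_cong)
    fix z
    show "(\<Sum>i\<in>IC. A i * indicator (B i) z) =
        (\<integral>\<^sup>+\<omega>. ennreal (\<Prod>t\<in>J. g t ((LINT z:E|N \<omega>. q t z) + q t z)) \<partial>M) * indicator C z"
    proof (cases "z \<in> C")
      case True
      then obtain i where i: "i \<in> IC" "z \<in> B i" using C_UN by blast
      have "(\<Sum>j\<in>IC. A j * indicator (B j) z) = (\<Sum>j\<in>{i}. A j * indicator (B j) z)"
        using i B_disj IC
        by (intro sum.mono_neutral_right) (auto simp: disjoint_family_on_def indicator_def subset_iff)
      then show ?thesis using i True q_B by (simp add: A_def)
    next
      case False
      then have "z \<notin> B i" if "i \<in> IC" for i using that C_UN by blast
      then show ?thesis using False by simp
    qed
  qed
  finally show "(\<integral>\<^sup>+\<omega>. ennreal (\<Prod>t\<in>J. g t (LINT z:E|N \<omega>. q t z)) * emeasure (N \<omega>) C \<partial>M) =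
     (\<integral>\<^sup>+z\<in>C. (\<integral>\<^sup>+\<omega>. ennreal (\<Prod>t\<in>J. g t ((LINT z:E|N \<omega>. q t z) + q t z)) \<partial>M) \<partial>\<mu>)" .
qed

end

section \<open>Jump measures and moments of pure-jump Levy processes\<close>

lemma sets_leb_interval:
  assumes "A \<subseteq> {0..T}" "A \<in> sets borel"
  shows "A \<in> sets (leb T)"
  using assms by (subst sets_restrict_space_iff) auto

lemma measurable_jump_sum_integrand:
  fixes k :: "real \<Rightarrow> real"
  assumes [measurable]: "k \<in> borel_measurable borel" and "t \<le> T"
  shows "(\<lambda>z. indicator ({0<..t} \<times> UNIV) z * k (snd z)) \<in> borel_measurable (leb T \<Otimes>\<^sub>M borel)"
proof -
  have "{0<..t} \<times> UNIV \<in> sets (leb T \<Otimes>\<^sub>M (borel :: real measure))"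
    using assms(2) by (intro pair_measureI sets_leb_interval) auto
  moreover have "(\<lambda>z. k (snd z)) \<in> borel_measurable (leb T \<Otimes>\<^sub>M (borel :: real measure))"
    by measurable
  ultimately show ?thesis
    by (intro borel_measurable_times borel_measurable_indicator)
qed

lemma integral_jump_measure:
  assumes y: "cadlag_on T y" and e: "0 < e" "\<And>x. \<bar>x\<bar> \<le> e \<Longrightarrow> k x = 0"
    and k: "k \<in> borel_measurable borel" and t: "t \<le> T"
  shows "(\<integral>z. indicator ({0<..t} \<times> UNIV) z * k (snd z) \<partial>jump_measure T y) = jump_sum k y t"
proof -
  let ?A = "{s\<in>{0<..T}. jump y s \<noteq> 0}"
  let ?f = "\<lambda>s. indicator ({0<..t} \<times> UNIV) (s, jump y s) * k (jump y s)"
  \<comment> \<open>The counting measure runs over times with a nonzero jump; since \<open>k\<close>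
    vanishes at 0 this loses no term of the jump sum.\<close>
  have k0: "k 0 = 0" using e by simp
  have set: "{s\<in>?A. ?f s \<noteq> 0} = {r\<in>{0<..t}. k (jump y r) \<noteq> 0}"
    using t k0 by (auto simp: indicator_def split: if_splits)
  have "(\<integral>z. indicator ({0<..t} \<times> UNIV) z * k (snd z) \<partial>jump_measure T y) = (\<integral>s. ?f s \<partial>count_space ?A)"
    unfolding jump_measure_def using measurable_jump_sum_integrand[OF k t]
    by (subst integral_distr) (auto simp: space_pair_measure space_restrict_space)
  also have "\<dots> = (\<Sum>s\<in>{s\<in>?A. ?f s \<noteq> 0}. ?f s)"
  proof (rule lebesgue_integral_count_space_finite_support)
    show "finite {s\<in>?A. ?f s \<noteq> 0}"
      unfolding set by (rule finite_subset[OF _ finite_jump_support[OF y e t, where s = 0]]) auto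
  qed
  also have "\<dots> = jump_sum k y t"
    unfolding set jump_sum_def by (intro sum.cong) (auto simp: indicator_def)
  finally show ?thesis .
qed

lemma set_integral_jump_measure:
  assumes y: "cadlag_on T y" and e: "0 < e" "\<And>x. x \<in> B \<Longrightarrow> e < \<bar>x\<bar>"
    and B: "B \<in> sets borel" and t: "t \<le> T"
  shows "(LINT z:({0<..t} \<times> B)|jump_measure T y. snd z) = jump_sum (\<lambda>x. indicator B x * x) y t"
proof -
  have "(LINT z:({0<..t} \<times> B)|jump_measure T y. snd z) =
    (\<integral>z. indicator ({0<..t} \<times> UNIV) z * (indicator B (snd z) * snd z) \<partial>jump_measure T y)"
    unfolding set_lebesgue_integral_def
    by (intro Bochner_Integration.integral_cong) (auto simp: indicator_def)
  also have "\<dots> = jump_sum (\<lambda>x. indicator B x * x) y t"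
    using B e(2) by (intro integral_jump_measure[OF y e(1) _ _ t]) (force simp: indicator_def)+
  finally show ?thesis .
qed

lemma jump_sum_diff_fun:
  assumes y: "cadlag_on T y" and e: "0 < e" "\<And>x. \<bar>x\<bar> \<le> e \<Longrightarrow> k1 x = 0" "\<And>x. \<bar>x\<bar> \<le> e \<Longrightarrow> k2 x = 0"
    and t: "t \<le> T"
  shows "jump_sum k1 y t - jump_sum k2 y t = jump_sum (\<lambda>x. k1 x - k2 x) y t"
  using e jump_sum_superset[OF y e(1) _ t, of k1] jump_sum_superset[OF y e(1) _ t, of k2]
    jump_sum_superset[OF y e(1) _ t, of "\<lambda>x. k1 x - k2 x"]
  by (simp add: sum_subtractf)

lemma sigma_finite_leb: "sigma_finite_measure (leb T)"
  by (intro sigma_finite_measure_restrict_space sigma_finite_lborel) auto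

section \<open>Integrability with respect to a Levy measure\<close>

context
  fixes \<nu> :: "real measure"
  assumes \<nu>: "levy_measure \<nu>"
begin

lemma sets_levy_measure [measurable_cong]: "sets \<nu> = sets borel"
  using \<nu> by (simp add: levy_measure_def)

lemma space_levy_measure: "space \<nu> = UNIV"
  using sets_eq_imp_space_eq[OF sets_levy_measure] by simp

text \<open>Markov's inequality for the integrand \<open>min 1 (x\<^sup>2)\<close>, which is at
  least \<open>min 1 (e\<^sup>2)\<close> on the set in question.\<close>

lemma levy_measure_finite:
  assumes "0 < e"
  shows "emeasure \<nu> {x. e < \<bar>x\<bar>} < \<infinity>"
proof -
  let ?c = "ennreal (min 1 (e\<^sup>2))"
  have c: "0 < min 1 (e\<^sup>2)" using assms by simp
  have "?c * emeasure \<nu> {x. e < \<bar>x\<bar>} = (\<integral>\<^sup>+x. ?c * indicator {x. e < \<bar>x\<bar>} x \<partial>\<nu>)"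
    by (subst nn_integral_cmult_indicator) (auto simp: sets_levy_measure)
  also have "\<dots> \<le> (\<integral>\<^sup>+x. ennreal (min 1 (x\<^sup>2)) \<partial>\<nu>)"
  proof (rule nn_integral_mono)
    fix x :: real
    have "e\<^sup>2 \<le> x\<^sup>2" if "e < \<bar>x\<bar>"
      using that assms by (metis abs_le_square_iff abs_of_pos less_imp_le)
    then show "?c * indicator {x. e < \<bar>x\<bar>} x \<le> ennreal (min 1 (x\<^sup>2))"
      by (auto simp: indicator_def intro!: ennreal_leI)
  qed
  also have "\<dots> < \<infinity>" using \<nu> by (simp add: levy_measure_def)
  finally have "?c * emeasure \<nu> {x. e < \<bar>x\<bar>} < \<infinity>" .
  then show ?thesis
    using c by (auto simp: ennreal_mult_less_top less_top ennreal_eq_0_iff)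
qed

text \<open>The levels 1/(n+1) cover everything but the origin, which is added to the cover as a
  null set.\<close>

lemma sigma_finite_levy_measure: "sigma_finite_measure \<nu>"
proof
  let ?A = "insert {0} (range (\<lambda>n. {x. 1 / real (Suc n) < \<bar>x\<bar>}))"
  have "x \<in> \<Union>?A" for x
  proof (cases "x = 0")
    case False
    then obtain n where "1 / real (Suc n) < \<bar>x\<bar>"
      using nat_approx_posE[of "\<bar>x\<bar>"] by auto
    then show ?thesis by auto
  qed auto
  moreover have "emeasure \<nu> {0} = 0" using \<nu> by (simp add: levy_measure_def)
  ultimately show "\<exists>A. countable A \<and> A \<subseteq> sets \<nu> \<and> \<Union>A = space \<nu> \<and> (\<forall>a\<in>A. emeasure \<nu> a \<noteq> \<infinity>)"
    using levy_measure_finite[of "1 / real (Suc n)" for n]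
    by (intro exI[of _ ?A]) (auto simp: sets_levy_measure space_levy_measure less_top)
qed

lemma sets_leb_levy [measurable_cong]: "sets (leb T \<Otimes>\<^sub>M \<nu>) = sets (leb T \<Otimes>\<^sub>M borel)"
  by (intro sets_pair_measure_cong sets_levy_measure refl)

lemma sigma_finite_leb_levy: "sigma_finite_measure (leb T \<Otimes>\<^sub>M \<nu>)"
proof -
  interpret a: sigma_finite_measure "leb T" by (rule sigma_finite_leb)
  interpret b: sigma_finite_measure \<nu> by (rule sigma_finite_levy_measure)
  interpret pair_sigma_finite "leb T" \<nu> ..
  show ?thesis ..
qed

lemma emeasure_leb_levy:
  assumes "0 \<le> t" "t \<le> T" "B \<in> sets borel"
  shows "emeasure (leb T \<Otimes>\<^sub>M \<nu>) ({0<..t} \<times> B) = ennreal t * emeasure \<nu> B"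
proof -
  interpret b: sigma_finite_measure \<nu> by (rule sigma_finite_levy_measure)
  have "emeasure (leb T) {0<..t} = ennreal t"
    using assms by (subst emeasure_restrict_space) auto
  then show ?thesis
    using assms
    by (subst b.emeasure_pair_measure_Times) (auto intro!: sets_leb_interval simp: sets_levy_measure)
qed

text \<open>A bounded function that vanishes near 0 is dominated by a multiple of the indicator of a
  set of finite intensity; Fubini then evaluates its integral.\<close>

lemma
  assumes k [measurable]: "k \<in> borel_measurable borel" and e: "0 < e" "\<And>x. \<bar>x\<bar> \<le> e \<Longrightarrow> k x = 0"
    and K: "\<And>x. \<bar>k x\<bar> \<le> K" and t: "0 \<le> t" "t \<le> T"
  shows integrable_jump_sum_integrand:
      "integrable (leb T \<Otimes>\<^sub>M \<nu>) (\<lambda>z. indicator ({0<..t} \<times> UNIV) z * k (snd z))"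
    and integral_jump_sum_integrand:
      "(\<integral>z. indicator ({0<..t} \<times> UNIV) z * k (snd z) \<partial>(leb T \<Otimes>\<^sub>M \<nu>)) = t * (\<integral>x. k x \<partial>\<nu>)"
proof -
  interpret a: sigma_finite_measure "leb T" by (rule sigma_finite_leb)
  interpret b: sigma_finite_measure \<nu> by (rule sigma_finite_levy_measure)
  interpret pair_sigma_finite "leb T" \<nu> ..
  let ?f = "\<lambda>z. indicator ({0<..t} \<times> UNIV) z * k (snd z)"
  let ?E = "{0<..t} \<times> {x. e < \<bar>x\<bar>}"
  have E: "?E \<in> sets (leb T \<Otimes>\<^sub>M \<nu>)"
    using t by (intro pair_measureI sets_leb_interval) (auto simp: sets_levy_measure)
  have finE: "emeasure (leb T \<Otimes>\<^sub>M \<nu>) ?E < \<infinity>"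
    using t levy_measure_finite[OF e(1)] by (subst emeasure_leb_levy) (auto simp: ennreal_mult_less_top)
  have fm: "?f \<in> borel_measurable (leb T \<Otimes>\<^sub>M \<nu>)"
    using measurable_jump_sum_integrand[OF k t(2)] by (simp cong: measurable_cong_sets add: sets_leb_levy)
  have bnd: "norm (?f z) \<le> norm (K * indicator ?E z)" for z
  proof (cases "e < \<bar>snd z\<bar>")
    case True
    then show ?thesis using K[of "snd z"] by (cases z) (auto simp: indicator_def)
  next
    case False
    then show ?thesis using e(2)[of "snd z"] by simp
  qed
  show int: "integrable (leb T \<Otimes>\<^sub>M \<nu>) ?f"
    by (rule Bochner_Integration.integrable_bound[OF _ fm, of "\<lambda>z. K * indicator ?E z"])
      (use bnd E finE in \<open>auto intro!: integrable_mult_right integrable_real_indicator\<close>)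
  have "(\<integral>z. ?f z \<partial>(leb T \<Otimes>\<^sub>M \<nu>)) = (\<integral>s. \<integral>x. ?f (s, x) \<partial>\<nu> \<partial>leb T)"
    using integral_fst'[OF int] by simp
  also have "\<dots> = (\<integral>s. indicator {0<..t} s * (\<integral>x. k x \<partial>\<nu>) \<partial>leb T)"
    by (intro Bochner_Integration.integral_cong) (auto simp: indicator_def)
  also have "\<dots> = measure (leb T) {0<..t} * (\<integral>x. k x \<partial>\<nu>)"
  proof -
    have "{0<..t} \<inter> space (leb T) = {0<..t}"
      using t by (auto simp: space_restrict_space)
    then show ?thesis
      by (simp only: Bochner_Integration.integral_mult_left_zero Bochner_Integration.integral_indicator)
  qed
  also have "measure (leb T) {0<..t} = t"
    using t by (subst measure_restrict_space) auto
  finally show "(\<integral>z. ?f z \<partial>(leb T \<Otimes>\<^sub>M \<nu>)) = t * (\<integral>x. k x \<partial>\<nu>)" .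
qed

end

locale pure_jump_levy =
  fixes T :: real and M :: "'a measure" and F :: "real \<Rightarrow> 'a measure" and \<nu> :: "real measure"
    and Y :: "'a \<Rightarrow> real \<Rightarrow> real"
  assumes T: "0 < T" and usual: "usual_filtered_space T M F" and levy: "pure_jump_levy_process T M F \<nu> Y"
begin

lemma \<nu>: "levy_measure \<nu>"
  using levy by (simp add: pure_jump_levy_process_def)

sublocale prob_space M
  using usual by (simp add: usual_filtered_space_def)

sublocale prm M "\<lambda>\<omega>. jump_measure T (Y \<omega>)" "leb T \<Otimes>\<^sub>M \<nu>"
  using levy by unfold_locales (simp add: pure_jump_levy_process_def)

lemma cadlag_adapted_Y: "cadlag_adapted T M F Y"
  using levy by (simp add: pure_jump_levy_process_def levy_process_def)

lemma Y_path: "\<omega> \<in> space M \<Longrightarrow> Y \<omega> \<in> extensional {0..T}" "\<omega> \<in> space M \<Longrightarrow> cadlag_on T (Y \<omega>)"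
  using cadlag_adapted_Y by (auto simp: cadlag_adapted_def space_DD)

lemma subalgebra_F: "t \<in> {0..T} \<Longrightarrow> subalgebra M (F t)"
  using usual by (simp add: usual_filtered_space_def)

lemma space_F: "t \<in> {0..T} \<Longrightarrow> space (F t) = space M"
  using subalgebra_F by (auto simp: subalgebra_def)

lemma measurable_F: "t \<in> {0..T} \<Longrightarrow> f \<in> measurable (F t) L \<Longrightarrow> f \<in> measurable M L"
  using subalgebra_F by (blast intro: measurable_from_subalg)

lemma F_subalgebra: "0 \<le> s \<Longrightarrow> s \<le> t \<Longrightarrow> t \<le> T \<Longrightarrow> subalgebra (F t) (F s)"
  using usual space_F[of s] space_F[of t] by (auto simp: usual_filtered_space_def subalgebra_def)

lemma F_mono: "0 \<le> s \<Longrightarrow> s \<le> t \<Longrightarrow> t \<le> T \<Longrightarrow> f \<in> measurable (F s) L \<Longrightarrow> f \<in> measurable (F t) L"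
  by (rule measurable_from_subalg[OF F_subalgebra])

lemma Y_adapted: "t \<in> {0..T} \<Longrightarrow> (\<lambda>\<omega>. Y \<omega> t) \<in> borel_measurable (F t)"
  using cadlag_adapted_Y by (simp add: cadlag_adapted_def adapted_def)

lemma Y_measurable: "t \<in> {0..T} \<Longrightarrow> (\<lambda>\<omega>. Y \<omega> t) \<in> borel_measurable M"
  using Y_adapted measurable_F by blast

lemma
  assumes k: "k \<in> borel_measurable borel" and e: "0 < e" "\<And>x. \<bar>x\<bar> \<le> e \<Longrightarrow> k x = 0"
    and K: "\<And>x. \<bar>k x\<bar> \<le> K" and t: "0 \<le> t" "t \<le> T"
  shows integrable_jump_sum: "integrable M (\<lambda>\<omega>. jump_sum k (Y \<omega>) t)"
    and expectation_jump_sum: "expectation (\<lambda>\<omega>. jump_sum k (Y \<omega>) t) = t * (\<integral>x. k x \<partial>\<nu>)"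
proof -
  have eq: "jump_sum k (Y \<omega>) t = (\<integral>z. indicator ({0<..t} \<times> UNIV) z * k (snd z) \<partial>jump_measure T (Y \<omega>))"
    if "\<omega> \<in> space M" for \<omega>
    by (rule integral_jump_measure[OF Y_path(2)[OF that] e k t(2), symmetric])
  note int = integrable_jump_sum_integrand[OF \<nu> k e K t]
  show "integrable M (\<lambda>\<omega>. jump_sum k (Y \<omega>) t)"
    using campbell_integrable[OF int] by (simp add: eq cong: Bochner_Integration.integrable_cong)
  have "expectation (\<lambda>\<omega>. jump_sum k (Y \<omega>) t) =
      (\<integral>z. indicator ({0<..t} \<times> UNIV) z * k (snd z) \<partial>(leb T \<Otimes>\<^sub>M \<nu>))"
    using campbell_integral[OF int] by (simp add: eq cong: Bochner_Integration.integral_cong)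
  also have "\<dots> = t * (\<integral>x. k x \<partial>\<nu>)"
    by (rule integral_jump_sum_integrand[OF \<nu> k e K t])
  finally show "expectation (\<lambda>\<omega>. jump_sum k (Y \<omega>) t) = t * (\<integral>x. k x \<partial>\<nu>)" .
qed

section \<open>Pure-jump Levy processes are semimartingales\<close>

definition small_jump :: "real \<Rightarrow> real \<Rightarrow> real" where
  "small_jump \<epsilon> x = indicator {x. \<epsilon> < \<bar>x\<bar> \<and> \<bar>x\<bar> \<le> 1} x * x"

text \<open>The approximating term of \<open>is_compensated_integral\<close> written along the path;
  \<open>compensated_integral_limit\<close> makes the identification.\<close>

definition compensated_sum :: "real \<Rightarrow> real \<Rightarrow> 'a \<Rightarrow> real" where
  "compensated_sum \<epsilon> t \<omega> = jump_sum (small_jump \<epsilon>) (Y \<omega>) t - t * (\<integral>x. small_jump \<epsilon> x \<partial>\<nu>)"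

lemma small_jump_measurable [measurable]: "small_jump \<epsilon> \<in> borel_measurable borel"
  unfolding small_jump_def by measurable

lemma small_jump_0: "\<bar>x\<bar> \<le> \<epsilon> \<Longrightarrow> small_jump \<epsilon> x = 0"
  by (simp add: small_jump_def)

lemma small_jump_le: "\<bar>small_jump \<epsilon> x\<bar> \<le> 1"
  by (auto simp: small_jump_def indicator_def)

lemma
  assumes "0 < \<epsilon>" "t \<in> {0..T}"
  shows integrable_compensated_sum: "integrable M (compensated_sum \<epsilon> t)"
    and expectation_compensated_sum: "expectation (compensated_sum \<epsilon> t) = 0"
proof -
  have t: "0 \<le> t" "t \<le> T" using assms(2) by auto
  note * = integrable_jump_sum[OF small_jump_measurable assms(1) small_jump_0 small_jump_le t, simplified]
    expectation_jump_sum[OF small_jump_measurable assms(1) small_jump_0 small_jump_le t, simplified]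
  show "integrable M (compensated_sum \<epsilon> t)" "expectation (compensated_sum \<epsilon> t) = 0"
    using * by (simp_all add: compensated_sum_def[abs_def] prob_space)
qed

lemma compensated_integral_limit:
  assumes J: "is_compensated_integral T M Y \<nu> t J" and t: "t \<in> {0..T}"
  shows "(\<lambda>n. \<integral>\<^sup>+\<omega>. ennreal ((J \<omega> - compensated_sum (1 / real (Suc n)) t \<omega>)\<^sup>2) \<partial>M) \<longlonglongrightarrow> 0"
proof -
  let ?S = "\<lambda>\<epsilon>. {x. \<epsilon> < \<bar>x\<bar> \<and> \<bar>x\<bar> \<le> 1} :: real set"
  have eq: "(LINT z:({0<..t} \<times> ?S \<epsilon>)|jump_measure T (Y \<omega>). snd z) - (LINT z:({0<..t} \<times> ?S \<epsilon>)|(leb T \<Otimes>\<^sub>M \<nu>). snd z) =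
      compensated_sum \<epsilon> t \<omega>" if "0 < \<epsilon>" "\<omega> \<in> space M" for \<epsilon> \<omega>
  proof -
    have "(LINT z:({0<..t} \<times> ?S \<epsilon>)|jump_measure T (Y \<omega>). snd z) = jump_sum (\<lambda>x. indicator (?S \<epsilon>) x * x) (Y \<omega>) t"
      using that t by (intro set_integral_jump_measure[OF Y_path(2) \<open>0 < \<epsilon>\<close>]) auto
    moreover have "(LINT z:({0<..t} \<times> ?S \<epsilon>)|(leb T \<Otimes>\<^sub>M \<nu>). snd z) =
        (\<integral>z. indicator ({0<..t} \<times> UNIV) z * small_jump \<epsilon> (snd z) \<partial>(leb T \<Otimes>\<^sub>M \<nu>))"
      unfolding set_lebesgue_integral_def
      by (intro Bochner_Integration.integral_cong) (auto simp: indicator_def small_jump_def)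
    moreover have "\<dots> = t * (\<integral>x. small_jump \<epsilon> x \<partial>\<nu>)"
      using that t
      by (intro integral_jump_sum_integrand[OF \<nu> small_jump_measurable \<open>0 < \<epsilon>\<close> small_jump_0 small_jump_le]) auto
    ultimately show ?thesis
      by (simp add: compensated_sum_def small_jump_def[abs_def])
  qed
  have "((\<lambda>\<epsilon>. \<integral>\<^sup>+\<omega>. ennreal ((J \<omega> - compensated_sum \<epsilon> t \<omega>)\<^sup>2) \<partial>M) \<longlongrightarrow> 0) (at_right 0)"
  proof (rule Lim_transform_eventually)
    show "eventually (\<lambda>\<epsilon>. (\<integral>\<^sup>+\<omega>. ennreal ((J \<omega> -
          ((LINT z:({0<..t} \<times> ?S \<epsilon>)|jump_measure T (Y \<omega>). snd z) -
           (LINT z:({0<..t} \<times> ?S \<epsilon>)|(leb T \<Otimes>\<^sub>M \<nu>). snd z)))\<^sup>2) \<partial>M) =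
         (\<integral>\<^sup>+\<omega>. ennreal ((J \<omega> - compensated_sum \<epsilon> t \<omega>)\<^sup>2) \<partial>M)) (at_right 0)"
      using eventually_at_right_less
    proof eventually_elim
      case (elim \<epsilon>)
      then show ?case by (intro nn_integral_cong) (simp only: eq)
    qed
  qed (use J in \<open>simp add: is_compensated_integral_def\<close>)
  moreover have "filterlim (\<lambda>n. 1 / real (Suc n)) (at_right 0) sequentially"
    using LIMSEQ_inverse_real_of_nat
    by (auto simp: filterlim_at eventually_at_filter inverse_eq_divide intro!: always_eventually)
  ultimately show ?thesis
    by (rule filterlim_compose)
qed

text \<open>The approximations are centred and converge to \<open>J\<close> in L^2. As the square of
  a mean is at most the mean of the square, \<open>(expectation J)\<^sup>2\<close> is bounded by a
  sequence tending to 0.\<close>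

lemma
  assumes J: "is_compensated_integral T M Y \<nu> t J" and t: "t \<in> {0..T}"
  shows integrable_compensated_integral: "integrable M J"
    and expectation_compensated_integral: "expectation J = 0"
proof -
  define D where "D n \<omega> = J \<omega> - compensated_sum (1 / real (Suc n)) t \<omega>" for n \<omega>
  have Jm [measurable]: "J \<in> borel_measurable M"
    using J by (simp add: is_compensated_integral_def)
  have X: "integrable M (compensated_sum (1 / real (Suc n)) t)"
    "expectation (compensated_sum (1 / real (Suc n)) t) = 0" for n
    using t by (auto intro!: integrable_compensated_sum expectation_compensated_sum simp del: of_nat_Suc)
  have Dm [measurable]: "D n \<in> borel_measurable M" for n
    unfolding D_def using borel_measurable_integrable[OF X(1)[of n]] by measurable
  have lim: "(\<lambda>n. \<integral>\<^sup>+\<omega>. ennreal ((D n \<omega>)\<^sup>2) \<partial>M) \<longlonglongrightarrow> 0"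
    unfolding D_def by (rule compensated_integral_limit[OF J t])
  then have "eventually (\<lambda>n. (\<integral>\<^sup>+\<omega>. ennreal ((D n \<omega>)\<^sup>2) \<partial>M) < 1) sequentially"
    by (rule order_tendstoD) simp
  then have ev: "eventually (\<lambda>n. integrable M (\<lambda>\<omega>. (D n \<omega>)\<^sup>2)) sequentially"
  proof eventually_elim
    case (elim n)
    have "(1::ennreal) < \<infinity>" by simp
    with elim have "(\<integral>\<^sup>+\<omega>. ennreal ((D n \<omega>)\<^sup>2) \<partial>M) < \<infinity>" by (rule less_trans)
    then show ?case by (intro integrableI_nonneg) auto
  qed
  have D_int: "integrable M (D n)" if "integrable M (\<lambda>\<omega>. (D n \<omega>)\<^sup>2)" for n
    by (rule square_integrable_imp_integrable[OF Dm that])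
  obtain n where n: "integrable M (\<lambda>\<omega>. (D n \<omega>)\<^sup>2)"
    using ev by (auto simp: eventually_sequentially)
  have "integrable M (\<lambda>\<omega>. D n \<omega> + compensated_sum (1 / real (Suc n)) t \<omega>)"
    using D_int[OF n] X(1)[of n] by (rule Bochner_Integration.integrable_add)
  then show Ji: "integrable M J" by (simp add: D_def)
  have ED: "expectation (D n) = expectation J" for n
    using Ji X[of n] by (simp add: D_def[abs_def])
  \<comment> \<open>All differences \<open>D n\<close> have the mean of \<open>J\<close>, so the
    bound by their second moments is a bound on one fixed number.\<close>
  have "eventually (\<lambda>n. ennreal ((expectation J)\<^sup>2) \<le> (\<integral>\<^sup>+\<omega>. ennreal ((D n \<omega>)\<^sup>2) \<partial>M)) sequentially"
    using ev
  proof eventually_elim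
    case (elim n)
    have "(expectation (D n))\<^sup>2 \<le> expectation (\<lambda>\<omega>. (D n \<omega>)\<^sup>2)"
      using variance_eq[OF D_int[OF elim] elim] variance_positive[of "D n"] by linarith
    then have "ennreal ((expectation J)\<^sup>2) \<le> ennreal (expectation (\<lambda>\<omega>. (D n \<omega>)\<^sup>2))"
      by (intro ennreal_leI) (simp add: ED)
    then show ?case
      using elim by (simp add: nn_integral_eq_integral)
  qed
  then have "ennreal ((expectation J)\<^sup>2) \<le> 0"
    using lim by (intro tendsto_lowerbound) auto
  then show "expectation J = 0" by (simp add: ennreal_eq_0_iff)
qed

text \<open>A continuous substitute for the large jumps \<open>x 1\<^bsub>|x| > 1\<^esub>\<close>; continuity makes its sum along the
  jumps a limit of Riemann sums.\<close>

definition jcut :: "real \<Rightarrow> real" where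
  "jcut x = x * min 1 (max 0 (2 * \<bar>x\<bar> - 1))"

lemma jcut_continuous: "continuous_on UNIV jcut"
  unfolding jcut_def by (intro continuous_intros)

lemma jcut_measurable [measurable]: "jcut \<in> borel_measurable borel"
  by (rule borel_measurable_continuous_onI[OF jcut_continuous])

lemma jcut_0: "\<bar>x\<bar> \<le> 1/2 \<Longrightarrow> jcut x = 0"
  by (simp add: jcut_def)

text \<open>Large jumps may have no first moment. What is integrated later is only their difference
  from \<open>jcut\<close>, which is bounded and vanishes near 0.\<close>

lemma jcut_le: "\<bar>indicator {x. 1 < \<bar>x\<bar>} x * x - jcut x\<bar> \<le> 1"
proof (cases "1 < \<bar>x\<bar>")
  case False
  have "\<bar>x\<bar> * \<bar>min 1 (max 0 (2 * \<bar>x\<bar> - 1))\<bar> \<le> 1 * 1"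
    using False by (intro mult_mono) auto
  then show ?thesis using False by (simp add: jcut_def abs_mult)
qed (auto simp: jcut_def)

text \<open>The jump measure is known to be measurable only with respect to \<open>M\<close>. The
  Riemann sums over [0,t] involve values of \<open>Y\<close> up to time \<open>t\<close> only, so
  their limit is measurable with respect to \<open>F t\<close>.\<close>

lemma jump_sum_adapted:
  assumes k: "continuous_on UNIV k" "0 < e" "\<And>x. \<bar>x\<bar> \<le> e \<Longrightarrow> k x = 0" and t: "t \<in> {0..T}"
  shows "(\<lambda>\<omega>. jump_sum k (Y \<omega>) t) \<in> borel_measurable (F t)"
proof (cases "t = 0")
  case True
  then show ?thesis by (simp add: jump_sum_def)
next
  case False
  have km [measurable]: "k \<in> borel_measurable borel"
    by (rule borel_measurable_continuous_onI[OF k(1)])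
  let ?p = "\<lambda>n i. 0 + (t - 0) * real i / real n"
  show ?thesis
  proof (rule borel_measurable_LIMSEQ_real)
    fix \<omega> assume "\<omega> \<in> space (F t)"
    then have "\<omega> \<in> space M" using space_F t by simp
    have "(\<lambda>n. \<Sum>i<n. k (Y \<omega> (?p n (Suc i)) - Y \<omega> (?p n i))) \<longlonglongrightarrow> jump_sum k (Y \<omega>) t - jump_sum k (Y \<omega>) 0"
      using t False \<open>\<omega> \<in> space M\<close> by (intro jump_sum_riemann[OF Y_path(2) k(2,3,1)]) auto
    then show "(\<lambda>n. \<Sum>i<n. k (Y \<omega> (?p n (Suc i)) - Y \<omega> (?p n i))) \<longlonglongrightarrow> jump_sum k (Y \<omega>) t"
      by (simp add: jump_sum_def)
  next
    fix n
    have "(\<lambda>\<omega>. Y \<omega> (?p n i)) \<in> borel_measurable (F t)" if "i \<le> n" for i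
    proof -
      have "real i / real n \<le> 1" using that by (cases "n = 0") auto
      then have "t * (real i / real n) \<le> t * 1" using t by (intro mult_left_mono) auto
      then have "0 \<le> ?p n i" "?p n i \<le> t" "t \<le> T" using t by auto
      then show ?thesis by (intro F_mono[OF _ _ _ Y_adapted]) auto
    qed
    then show "(\<lambda>\<omega>. \<Sum>i<n. k (Y \<omega> (?p n (Suc i)) - Y \<omega> (?p n i))) \<in> borel_measurable (F t)"
      by (intro borel_measurable_sum measurable_compose[OF _ km] borel_measurable_diff)
        (auto simp del: of_nat_Suc)
  qed
qed

lemma drift_exists:
  obtains c where "\<And>t. t \<in> {0..T} \<Longrightarrow> integrable M (\<lambda>\<omega>. Y \<omega> t - Y \<omega> 0 - jump_sum jcut (Y \<omega>) t - c * t)"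
    "\<And>t. t \<in> {0..T} \<Longrightarrow> expectation (\<lambda>\<omega>. Y \<omega> t - Y \<omega> 0 - jump_sum jcut (Y \<omega>) t - c * t) = 0"
proof -
  obtain \<gamma> J where J: "\<And>t. t \<in> {0..T} \<Longrightarrow> is_compensated_integral T M Y \<nu> t (\<lambda>\<omega>. J \<omega> t)"
    and Y: "AE \<omega> in M. \<forall>t\<in>{0..T}.
           Y \<omega> t = \<gamma> * t + (LINT z:({0<..t} \<times> {x. \<bar>x\<bar> > 1})|jump_measure T (Y \<omega>). snd z) + J \<omega> t"
    using levy unfolding pure_jump_levy_process_def by blast
  define k where "k x = indicator {x. 1 < \<bar>x\<bar>} x * x - jcut x" for x
  have k0: "\<bar>x\<bar> \<le> 1/2 \<Longrightarrow> k x = 0" for x by (simp add: k_def jcut_0)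
  have km: "k \<in> borel_measurable borel" unfolding k_def by measurable
  have kb: "\<bar>k x\<bar> \<le> 1" for x unfolding k_def by (rule jcut_le)
  have half: "0 < (1/2::real)" by simp
  have Y0: "AE \<omega> in M. Y \<omega> 0 = 0"
    using levy by (simp add: pure_jump_levy_process_def levy_process_def)
  \<comment> \<open>After removal of the \<open>jcut\<close> jumps, the Levy-Ito representation
    leaves \<gamma> t, the jump sum of \<open>k\<close>, whose mean is t times the integral of
    \<open>k\<close>, and a centred term.\<close>
  define c where "c = \<gamma> + (\<integral>x. k x \<partial>\<nu>)"
  show thesis
  proof (rule that[of c])
    fix t assume t: "t \<in> {0..T}"
    then have t': "0 \<le> t" "t \<le> T" by auto
    let ?N = "\<lambda>\<omega>. Y \<omega> t - Y \<omega> 0 - jump_sum jcut (Y \<omega>) t - c * t"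
    let ?R = "\<lambda>\<omega>. jump_sum k (Y \<omega>) t - t * (\<integral>x. k x \<partial>\<nu>) + J \<omega> t"
    have AE: "AE \<omega> in M. ?R \<omega> = ?N \<omega>"
      using Y Y0 AE_space
    proof eventually_elim
      case (elim \<omega>)
      have "(LINT z:({0<..t} \<times> {x. \<bar>x\<bar> > 1})|jump_measure T (Y \<omega>). snd z) =
          jump_sum (\<lambda>x. indicator {x. 1 < \<bar>x\<bar>} x * x) (Y \<omega>) t"
        using elim t' by (intro set_integral_jump_measure[OF Y_path(2) half]) auto
      moreover have "jump_sum (\<lambda>x. indicator {x. 1 < \<bar>x\<bar>} x * x) (Y \<omega>) t - jump_sum jcut (Y \<omega>) t = jump_sum k (Y \<omega>) t"
        unfolding k_def using elim t' by (intro jump_sum_diff_fun[OF Y_path(2) half]) (auto simp: jcut_0)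
      ultimately show ?case
        using elim t by (simp add: c_def algebra_simps)
    qed
    have js: "integrable M (\<lambda>\<omega>. jump_sum k (Y \<omega>) t)"
      "expectation (\<lambda>\<omega>. jump_sum k (Y \<omega>) t) = t * (\<integral>x. k x \<partial>\<nu>)"
      by (rule integrable_jump_sum[OF km half k0 kb t'] expectation_jump_sum[OF km half k0 kb t'], simp)+
    have Rint: "integrable M ?R"
      using js integrable_compensated_integral[OF J[OF t] t] by auto
    have jm: "(\<lambda>\<omega>. jump_sum jcut (Y \<omega>) t) \<in> borel_measurable M"
      by (rule measurable_F[OF t jump_sum_adapted[OF jcut_continuous half jcut_0 t]])
    have Nm: "?N \<in> borel_measurable M"
      using T by (intro borel_measurable_diff jm Y_measurable t borel_measurable_const) auto
    show "integrable M ?N"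
      by (rule integrable_cong_AE_imp[OF Rint Nm AE])
    have "expectation ?N = expectation ?R"
      using AE Nm Rint by (intro integral_cong_AE) (auto elim: eventually_mono)
    also have "\<dots> = 0"
      using js integrable_compensated_integral[OF J[OF t] t] expectation_compensated_integral[OF J[OF t] t]
      by (simp add: prob_space)
    finally show "expectation ?N = 0" .
  qed
qed

section \<open>Independence of the past, from single increments to the martingale property\<close>

lemma increment_fubini:
  assumes st: "0 \<le> s" "s \<le> t" "t \<le> T" and U: "U \<in> measurable (F s) S"
    and h [measurable]: "case_prod h \<in> borel_measurable (S \<Otimes>\<^sub>M borel)"
  shows "(\<integral>\<^sup>+\<omega>. h (U \<omega>) (Y \<omega> t - Y \<omega> s) \<partial>M) = (\<integral>\<^sup>+\<omega>'. (\<integral>\<^sup>+\<omega>. h (U \<omega>') (Y \<omega> t - Y \<omega> s) \<partial>M) \<partial>M)"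
proof -
  define D where "D \<omega> = Y \<omega> t - Y \<omega> s" for \<omega>
  have Dm [measurable]: "D \<in> borel_measurable M"
    unfolding D_def using st Y_measurable by (intro borel_measurable_diff) auto
  have Um [measurable]: "U \<in> measurable M S"
    using U st by (intro measurable_F[of s]) auto
  have ind: "indep_set (sets (F s)) (sets (vimage_algebra (space M) D borel))"
    using levy st unfolding pure_jump_levy_process_def levy_process_def D_def[abs_def] by auto
  interpret D: prob_space "distr M borel D" by (rule prob_space_distr) simp
  interpret U: prob_space "distr M S U" by (rule prob_space_distr) simp
  \<comment> \<open>Independence is given for events, so the product form of the joint law is
    checked on rectangles.\<close>
  have "distr M S U \<Otimes>\<^sub>M distr M borel D = distr M (S \<Otimes>\<^sub>M borel) (\<lambda>\<omega>. (U \<omega>, D \<omega>))"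
  proof (rule pair_measure_eqI)
    fix A B assume A: "A \<in> sets (distr M S U)" and B: "B \<in> sets (distr M borel D)"
    have "U -` A \<inter> space (F s) \<in> sets (F s)"
      using U A by (auto intro: measurable_sets)
    moreover have "D -` B \<inter> space M \<in> sets (vimage_algebra (space M) D borel)"
      using B by (auto intro: in_vimage_algebra)
    ultimately have "prob ((U -` A \<inter> space M) \<inter> (D -` B \<inter> space M)) = prob (U -` A \<inter> space M) * prob (D -` B \<inter> space M)"
      using st by (intro indep_setD[OF ind]) (auto simp: space_F)
    moreover have "(\<lambda>\<omega>. (U \<omega>, D \<omega>)) -` (A \<times> B) \<inter> space M = (U -` A \<inter> space M) \<inter> (D -` B \<inter> space M)"
      by auto
    ultimately show "emeasure (distr M S U) A * emeasure (distr M borel D) B =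
        emeasure (distr M (S \<Otimes>\<^sub>M borel) (\<lambda>\<omega>. (U \<omega>, D \<omega>))) (A \<times> B)"
      using A B by (simp add: emeasure_distr emeasure_eq_measure ennreal_mult)
  qed (auto intro: D.sigma_finite_measure_axioms U.sigma_finite_measure_axioms)
  note distr = this[symmetric]
  have [measurable]: "(\<lambda>r. \<integral>\<^sup>+x. h r x \<partial>distr M borel D) \<in> borel_measurable S"
    by (rule D.borel_measurable_nn_integral)
      (simp add: h measurable_cong_sets[OF sets_pair_measure_cong[OF refl sets_distr] refl])
  have "(\<integral>\<^sup>+\<omega>. h (U \<omega>) (D \<omega>) \<partial>M) = (\<integral>\<^sup>+p. case_prod h p \<partial>distr M (S \<Otimes>\<^sub>M borel) (\<lambda>\<omega>. (U \<omega>, D \<omega>)))"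
    by (subst nn_integral_distr) auto
  also have "\<dots> = (\<integral>\<^sup>+r. (\<integral>\<^sup>+x. h r x \<partial>distr M borel D) \<partial>distr M S U)"
    unfolding distr
    by (subst D.nn_integral_fst[symmetric])
      (simp_all add: h measurable_cong_sets[OF sets_pair_measure_cong[OF sets_distr sets_distr] refl])
  also have "\<dots> = (\<integral>\<^sup>+\<omega>'. (\<integral>\<^sup>+x. h (U \<omega>') x \<partial>distr M borel D) \<partial>M)"
    by (subst nn_integral_distr) auto
  also have "\<dots> = (\<integral>\<^sup>+\<omega>'. (\<integral>\<^sup>+\<omega>. h (U \<omega>') (D \<omega>) \<partial>M) \<partial>M)"
  proof (rule nn_integral_cong)
    fix \<omega>' assume "\<omega>' \<in> space M"
    then have "U \<omega>' \<in> space S" by (auto intro: measurable_space)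
    then show "(\<integral>\<^sup>+x. h (U \<omega>') x \<partial>distr M borel D) = (\<integral>\<^sup>+\<omega>. h (U \<omega>') (D \<omega>) \<partial>M)"
      by (subst nn_integral_distr) auto
  qed
  finally show ?thesis by (simp add: D_def)
qed

text \<open>Each single increment is independent of its own past, so the last one can be integrated
  out: the earlier increments and \<open>A\<close> belong to \<open>F (p n)\<close>. The averaged
  function is again a test function, which is why the induction leaves \<phi> arbitrary.\<close>

lemma increment_sum_indep:
  fixes p :: "nat \<Rightarrow> real" and k :: "real \<Rightarrow> real"
  assumes k [measurable]: "k \<in> borel_measurable borel" and A: "A \<in> sets (F (p 0))"
    and p: "\<And>i. i \<le> n \<Longrightarrow> p i \<in> {0..T}" "\<And>i. i < n \<Longrightarrow> p i \<le> p (Suc i)"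
    and \<phi>: "\<phi> \<in> borel_measurable borel"
  shows "(\<integral>\<^sup>+\<omega>. indicator A \<omega> * \<phi> (\<Sum>i<n. k (Y \<omega> (p (Suc i)) - Y \<omega> (p i))) \<partial>M) =
    emeasure M A * (\<integral>\<^sup>+\<omega>. \<phi> (\<Sum>i<n. k (Y \<omega> (p (Suc i)) - Y \<omega> (p i))) \<partial>M)"
  using p \<phi>
proof (induction n arbitrary: \<phi>)
  case 0
  have "A \<in> sets M" using A 0(1)[of 0] subalgebra_F by (auto simp: subalgebra_def)
  then show ?case
    by (simp add: nn_integral_multc emeasure_space_1)
next
  case (Suc n)
  note [measurable] = Suc.prems(3)
  define W where "W \<omega> = (\<Sum>i<n. k (Y \<omega> (p (Suc i)) - Y \<omega> (p i)))" for \<omega>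
  define D where "D \<omega> = Y \<omega> (p (Suc n)) - Y \<omega> (p n)" for \<omega>
  have pmono: "p i \<le> p j" if "i \<le> j" "j \<le> Suc n" for i j
    using that
  proof (induction rule: dec_induct)
    case (step m)
    then show ?case using Suc.prems(2)[of m] by simp
  qed simp
  have pT: "p i \<in> {0..T}" if "i \<le> Suc n" for i using Suc.prems(1) that by auto
  have [measurable]: "D \<in> borel_measurable M"
    unfolding D_def using pT Y_measurable by (intro borel_measurable_diff) auto
  have WF [measurable]: "W \<in> borel_measurable (F (p n))"
    unfolding W_def
  proof (intro borel_measurable_sum measurable_compose[OF _ k] borel_measurable_diff)
    fix i assume "i \<in> {..<n}"
    then show "(\<lambda>\<omega>. Y \<omega> (p (Suc i))) \<in> borel_measurable (F (p n))" "(\<lambda>\<omega>. Y \<omega> (p i)) \<in> borel_measurable (F (p n))"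
      using pT[of i] pT[of "Suc i"] pT[of n] pmono[of i n] pmono[of "Suc i" n]
      by (auto intro!: F_mono[OF _ _ _ Y_adapted])
  qed
  have AF: "A \<in> sets (F (p n))"
  proof -
    have "subalgebra (F (p n)) (F (p 0))"
      using pT[of 0] pT[of n] pmono[of 0 n] by (intro F_subalgebra) auto
    then show ?thesis using A by (auto simp: subalgebra_def)
  qed
  \<comment> \<open>\<phi> averaged over the last increment; the induction hypothesis is applied to
    it.\<close>
  define \<Phi> where "\<Phi> w = (\<integral>\<^sup>+\<omega>. \<phi> (w + k (D \<omega>)) \<partial>M)" for w
  have \<Phi>m: "\<Phi> \<in> borel_measurable borel"
    unfolding \<Phi>_def by (intro borel_measurable_nn_integral) measurable
  have fub: "(\<integral>\<^sup>+\<omega>. indicator B \<omega> * \<phi> (W \<omega> + k (D \<omega>)) \<partial>M) = (\<integral>\<^sup>+\<omega>. indicator B \<omega> * \<Phi> (W \<omega>) \<partial>M)"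
    if B: "B \<in> sets (F (p n))" for B
  proof -
    have "(\<lambda>\<omega>. (indicator B \<omega>, W \<omega>)) \<in> measurable (F (p n)) (borel \<Otimes>\<^sub>M borel)"
      using B by measurable
    moreover have "(\<lambda>(u, d). fst u * \<phi> (snd u + k d)) \<in> borel_measurable ((borel \<Otimes>\<^sub>M borel) \<Otimes>\<^sub>M borel)"
      by measurable
    ultimately have "(\<integral>\<^sup>+\<omega>. indicator B \<omega> * \<phi> (W \<omega> + k (D \<omega>)) \<partial>M) =
        (\<integral>\<^sup>+\<omega>'. (\<integral>\<^sup>+\<omega>. indicator B \<omega>' * \<phi> (W \<omega>' + k (D \<omega>)) \<partial>M) \<partial>M)"
      unfolding D_def
      using increment_fubini[of "p n" "p (Suc n)" "\<lambda>\<omega>. (indicator B \<omega>, W \<omega>)" "borel \<Otimes>\<^sub>M borel"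
          "\<lambda>u d. fst u * \<phi> (snd u + k d)"] pT[of n] pT[of "Suc n"] pmono[of n "Suc n"]
      by simp
    also have "\<dots> = (\<integral>\<^sup>+\<omega>. indicator B \<omega> * \<Phi> (W \<omega>) \<partial>M)"
      unfolding \<Phi>_def by (intro nn_integral_cong nn_integral_cmult) measurable
    finally show ?thesis .
  qed
  have "(\<integral>\<^sup>+\<omega>. indicator A \<omega> * \<phi> (\<Sum>i<Suc n. k (Y \<omega> (p (Suc i)) - Y \<omega> (p i))) \<partial>M) =
      (\<integral>\<^sup>+\<omega>. indicator A \<omega> * \<Phi> (W \<omega>) \<partial>M)"
    using fub[OF AF] by (simp add: W_def D_def)
  also have "\<dots> = emeasure M A * (\<integral>\<^sup>+\<omega>. \<Phi> (W \<omega>) \<partial>M)"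
    unfolding W_def using Suc.prems \<Phi>m by (intro Suc.IH) auto
  \<comment> \<open>The averaging is undone by the same identity, with the whole space in place of
    \<open>A\<close>.\<close>
  also have "(\<integral>\<^sup>+\<omega>. \<Phi> (W \<omega>) \<partial>M) = (\<integral>\<^sup>+\<omega>. indicator (space M) \<omega> * \<Phi> (W \<omega>) \<partial>M)"
    by (intro nn_integral_cong) simp
  also have "\<dots> = (\<integral>\<^sup>+\<omega>. indicator (space M) \<omega> * \<phi> (W \<omega> + k (D \<omega>)) \<partial>M)"
    using fub[of "space M"] sets.top[of "F (p n)"] space_F[OF pT[of n]] by simp
  also have "\<dots> = (\<integral>\<^sup>+\<omega>. \<phi> (\<Sum>i<Suc n. k (Y \<omega> (p (Suc i)) - Y \<omega> (p i))) \<partial>M)"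
    by (intro nn_integral_cong) (simp add: W_def D_def)
  finally show ?case .
qed

definition levy_fv :: "real \<Rightarrow> 'a \<Rightarrow> real \<Rightarrow> real" where
  "levy_fv c \<omega> = (\<lambda>t\<in>{0..T}. jump_sum jcut (Y \<omega>) t + c * t)"

text \<open>The initial value is subtracted because \<open>semimartingale\<close> asks for a start
  at 0 at every sample point, whereas \<open>Y\<close> starts at 0 only almost surely.\<close>

definition levy_mart :: "real \<Rightarrow> 'a \<Rightarrow> real \<Rightarrow> real" where
  "levy_mart c \<omega> = (\<lambda>t\<in>{0..T}. Y \<omega> t - Y \<omega> 0 - jump_sum jcut (Y \<omega>) t - c * t)"

lemma jump_sum_jcut_adapted:
  assumes "t \<in> {0..T}"
  shows "(\<lambda>\<omega>. jump_sum jcut (Y \<omega>) t) \<in> borel_measurable (F t)"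
  by (rule jump_sum_adapted[where e = "1/2"]) (use assms in \<open>auto simp: jcut_continuous jcut_0\<close>)

lemma cadlag_jump_sum_jcut: "\<omega> \<in> space M \<Longrightarrow> cadlag_on T (jump_sum jcut (Y \<omega>))"
  by (rule cadlag_on_jump_sum[where e = "1/2"]) (auto simp: Y_path jcut_0)

lemma cadlag_adapted_levy_fv: "cadlag_adapted T M F (levy_fv c)"
  unfolding cadlag_adapted_def adapted_def
proof (intro conjI ballI)
  fix \<omega> assume "\<omega> \<in> space M"
  then have "cadlag_on T (\<lambda>t. jump_sum jcut (Y \<omega>) t + c * t)"
    by (intro cadlag_on_add cadlag_jump_sum_jcut cadlag_on_mult_left)
      (auto intro!: cadlag_on_continuous continuous_intros)
  then show "levy_fv c \<omega> \<in> space (DD T)"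
    unfolding levy_fv_def by (rule restrict_in_DD)
next
  fix t assume "t \<in> {0..T}"
  then show "(\<lambda>\<omega>. levy_fv c \<omega> t) \<in> borel_measurable (F t)"
    using jump_sum_jcut_adapted by (auto simp: levy_fv_def)
qed

lemma cadlag_adapted_levy_mart: "cadlag_adapted T M F (levy_mart c)"
  unfolding cadlag_adapted_def adapted_def
proof (intro conjI ballI)
  fix \<omega> assume "\<omega> \<in> space M"
  then have "cadlag_on T (\<lambda>t. Y \<omega> t - Y \<omega> 0 - jump_sum jcut (Y \<omega>) t - c * t)"
    by (intro cadlag_on_diff cadlag_jump_sum_jcut cadlag_on_mult_left Y_path)
      (auto intro!: cadlag_on_continuous continuous_intros)
  then show "levy_mart c \<omega> \<in> space (DD T)"
    unfolding levy_mart_def by (rule restrict_in_DD)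
next
  fix t assume t: "t \<in> {0..T}"
  have "(\<lambda>\<omega>. Y \<omega> 0) \<in> borel_measurable (F t)"
    using t T by (intro F_mono[OF _ _ _ Y_adapted, of 0]) auto
  then show "(\<lambda>\<omega>. levy_mart c \<omega> t) \<in> borel_measurable (F t)"
    using jump_sum_jcut_adapted[OF t] Y_adapted[OF t] t by (auto simp: levy_mart_def)
qed

lemma levy_mart_measurable: "t \<in> {0..T} \<Longrightarrow> (\<lambda>\<omega>. levy_mart c \<omega> t) \<in> borel_measurable M"
  using cadlag_adapted_levy_mart[of c] by (intro measurable_F[of t]) (simp_all add: cadlag_adapted_def adapted_def)

lemma finite_variation_levy_fv:
  assumes "\<omega> \<in> space M"
  shows "finite_variation_on T (levy_fv c \<omega>)"
proof (rule finite_variation_on_cong)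
  show "finite_variation_on T (\<lambda>t. jump_sum jcut (Y \<omega>) t + c * t)"
    using assms
    by (intro finite_variation_on_add finite_variation_on_mult_mono finite_variation_on_jump_sum[where e = "1/2"])
      (auto simp: mono_def Y_path jcut_0)
qed (simp add: levy_fv_def)

text \<open>Up to the constant c (t - s), the increment is a limit of sums of functions of
  increments of \<open>Y\<close> after time \<open>s\<close>. Each such sum is independent of
  \<open>A\<close>, and the factorisation survives the limit for bounded continuous \<phi>.\<close>

lemma levy_mart_increment_continuous:
  assumes st: "0 \<le> s" "s < t" "t \<le> T" and A: "A \<in> sets (F s)"
    and \<phi>: "continuous_on UNIV \<phi>" "\<And>x. 0 \<le> \<phi> x" "\<And>x. \<phi> x \<le> K"
  shows "(\<integral>\<^sup>+\<omega>. indicator A \<omega> * ennreal (\<phi> (levy_mart c \<omega> t - levy_mart c \<omega> s)) \<partial>M) =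
    emeasure M A * (\<integral>\<^sup>+\<omega>. ennreal (\<phi> (levy_mart c \<omega> t - levy_mart c \<omega> s)) \<partial>M)"
proof -
  define p where "p n i = s + (t - s) * real i / real n" for n i :: nat
  \<comment> \<open>The identity part telescopes to the increment of \<open>Y\<close>, and the
    \<open>jcut\<close> part tends to the increment of the jump sum.\<close>
  define W where "W n \<omega> = (\<Sum>i<n. (\<lambda>x. x - jcut x) (Y \<omega> (p n (Suc i)) - Y \<omega> (p n i)))" for n \<omega>
  define D where "D \<omega> = levy_mart c \<omega> t - levy_mart c \<omega> s" for \<omega>
  \<comment> \<open>The translation absorbs the drift that the sums \<open>W n\<close> do not
    contain.\<close>
  define \<psi> where "\<psi> x = ennreal (\<phi> (x - c * (t - s)))" for x
  have \<phi>m: "\<phi> \<in> borel_measurable borel" using \<phi>(1) by (rule borel_measurable_continuous_onI)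
  have \<psi>m [measurable]: "\<psi> \<in> borel_measurable borel"
    unfolding \<psi>_def by (intro measurable_compose[OF _ measurable_ennreal] measurable_compose[OF _ \<phi>m]) measurable
  have pT: "p n i \<in> {s..t}" if "i \<le> n" for n i
  proof -
    have "real i / real n \<le> 1" using that by (cases "n = 0") auto
    then have "(t - s) * (real i / real n) \<le> (t - s) * 1" using st by (intro mult_left_mono) auto
    then show ?thesis using st by (auto simp: p_def)
  qed
  have pmono: "p n i \<le> p n (Suc i)" for n i
    using st unfolding p_def by (intro add_left_mono divide_right_mono mult_left_mono) auto
  have p_ends: "p n 0 = s" "0 < n \<Longrightarrow> p n n = t" for n
    by (auto simp: p_def)
  have sM: "A \<in> sets M"
    using A st subalgebra_F[of s] by (auto simp: subalgebra_def)
  have Wm [measurable]: "W n \<in> borel_measurable M" for n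
    unfolding W_def
  proof (intro borel_measurable_sum borel_measurable_diff Y_measurable measurable_compose[OF _ jcut_measurable])
    fix i assume "i \<in> {..<n}"
    then show "p n i \<in> {0..T}" "p n (Suc i) \<in> {0..T}"
      "p n i \<in> {0..T}" "p n (Suc i) \<in> {0..T}"
      using pT[of i n] pT[of "Suc i" n] st by auto
  qed
  have Dm [measurable]: "D \<in> borel_measurable M"
    unfolding D_def using st by (intro borel_measurable_diff levy_mart_measurable) auto
  have lim: "(\<lambda>n. W n \<omega>) \<longlonglongrightarrow> D \<omega> + c * (t - s)" if "\<omega> \<in> space M" for \<omega>
  proof -
    have "(\<lambda>n. \<Sum>i<n. jcut (Y \<omega> (p n (Suc i)) - Y \<omega> (p n i))) \<longlonglongrightarrow> jump_sum jcut (Y \<omega>) t - jump_sum jcut (Y \<omega>) s"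
      unfolding p_def using st
      by (intro jump_sum_riemann[OF Y_path(2)[OF that], where e = "1/2"]) (auto simp: jcut_continuous jcut_0)
    then have "(\<lambda>n. (Y \<omega> t - Y \<omega> s) - (\<Sum>i<n. jcut (Y \<omega> (p n (Suc i)) - Y \<omega> (p n i))))
        \<longlonglongrightarrow> (Y \<omega> t - Y \<omega> s) - (jump_sum jcut (Y \<omega>) t - jump_sum jcut (Y \<omega>) s)"
      by (intro tendsto_intros)
    moreover have "eventually (\<lambda>n. (Y \<omega> t - Y \<omega> s) - (\<Sum>i<n. jcut (Y \<omega> (p n (Suc i)) - Y \<omega> (p n i))) = W n \<omega>) sequentially"
      using eventually_gt_at_top[of "0::nat"]
    proof eventually_elim
      case (elim n)
      then show ?case
        using sum_lessThan_telescope[of "\<lambda>i. Y \<omega> (p n i)" n] by (simp add: W_def sum_subtractf p_ends)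
    qed
    ultimately have "(\<lambda>n. W n \<omega>) \<longlonglongrightarrow> (Y \<omega> t - Y \<omega> s) - (jump_sum jcut (Y \<omega>) t - jump_sum jcut (Y \<omega>) s)"
      by (rule Lim_transform_eventually)
    also have "(Y \<omega> t - Y \<omega> s) - (jump_sum jcut (Y \<omega>) t - jump_sum jcut (Y \<omega>) s) = D \<omega> + c * (t - s)"
      using st by (simp add: D_def levy_mart_def algebra_simps)
    finally show ?thesis .
  qed
  have \<psi>lim: "(\<lambda>n. \<psi> (W n \<omega>)) \<longlonglongrightarrow> ennreal (\<phi> (D \<omega>))" if "\<omega> \<in> space M" for \<omega>
  proof -
    have "(\<lambda>n. W n \<omega> - c * (t - s)) \<longlonglongrightarrow> (D \<omega> + c * (t - s)) - c * (t - s)"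
      by (intro tendsto_intros lim that)
    then have "(\<lambda>n. W n \<omega> - c * (t - s)) \<longlonglongrightarrow> D \<omega>" by simp
    then show ?thesis
      unfolding \<psi>_def using continuous_on_tendsto_compose[OF \<phi>(1)] by (intro tendsto_ennrealI) auto
  qed
  have \<psi>K: "\<psi> x \<le> ennreal K" for x
    unfolding \<psi>_def using \<phi>(3) by (intro ennreal_leI) auto
  have conv: "(\<lambda>n. \<integral>\<^sup>+\<omega>. indicator B \<omega> * \<psi> (W n \<omega>) \<partial>M) \<longlonglongrightarrow> (\<integral>\<^sup>+\<omega>. indicator B \<omega> * ennreal (\<phi> (D \<omega>)) \<partial>M)"
    if [measurable]: "B \<in> sets M" for B
  proof (rule nn_integral_dominated_convergence[where w = "\<lambda>_. ennreal K"])
    show "(\<lambda>\<omega>. indicator B \<omega> * ennreal (\<phi> (D \<omega>))) \<in> borel_measurable M"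
      by (intro borel_measurable_times_ennreal measurable_compose[OF _ measurable_ennreal]
          measurable_compose[OF Dm \<phi>m]) measurable
    show "AE \<omega> in M. indicator B \<omega> * \<psi> (W n \<omega>) \<le> ennreal K" for n
      using \<psi>K by (intro AE_I2) (auto simp: indicator_def)
    show "(\<integral>\<^sup>+\<omega>. ennreal K \<partial>M) < \<infinity>"
      by (simp add: emeasure_space_1)
    show "AE \<omega> in M. (\<lambda>n. indicator B \<omega> * \<psi> (W n \<omega>)) \<longlonglongrightarrow> indicator B \<omega> * ennreal (\<phi> (D \<omega>))"
      using \<psi>lim by (intro AE_I2) (auto simp: indicator_def)
  qed measurable
  have "(\<integral>\<^sup>+\<omega>. indicator A \<omega> * \<psi> (W n \<omega>) \<partial>M) = emeasure M A * (\<integral>\<^sup>+\<omega>. indicator (space M) \<omega> * \<psi> (W n \<omega>) \<partial>M)" for n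
  proof -
    have "(\<integral>\<^sup>+\<omega>. indicator A \<omega> * \<psi> (W n \<omega>) \<partial>M) = emeasure M A * (\<integral>\<^sup>+\<omega>. \<psi> (W n \<omega>) \<partial>M)"
      unfolding W_def
    proof (rule increment_sum_indep)
      show "A \<in> sets (F (p n 0))" using A by (simp add: p_ends)
      show "p n i \<in> {0..T}" if "i \<le> n" for i using pT[OF that] st by auto
    qed (use pmono in measurable)
    also have "(\<integral>\<^sup>+\<omega>. \<psi> (W n \<omega>) \<partial>M) = (\<integral>\<^sup>+\<omega>. indicator (space M) \<omega> * \<psi> (W n \<omega>) \<partial>M)"
      by (intro nn_integral_cong) simp
    finally show ?thesis .
  qed
  moreover have "(\<lambda>n. emeasure M A * (\<integral>\<^sup>+\<omega>. indicator (space M) \<omega> * \<psi> (W n \<omega>) \<partial>M)) \<longlonglongrightarrow>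
      emeasure M A * (\<integral>\<^sup>+\<omega>. indicator (space M) \<omega> * ennreal (\<phi> (D \<omega>)) \<partial>M)"
    by (intro ennreal_tendsto_cmult conv) (auto simp: emeasure_eq_measure)
  ultimately have "(\<integral>\<^sup>+\<omega>. indicator A \<omega> * ennreal (\<phi> (D \<omega>)) \<partial>M) =
      emeasure M A * (\<integral>\<^sup>+\<omega>. indicator (space M) \<omega> * ennreal (\<phi> (D \<omega>)) \<partial>M)"
    using conv[OF sM] LIMSEQ_unique by simp
  also have "(\<integral>\<^sup>+\<omega>. indicator (space M) \<omega> * ennreal (\<phi> (D \<omega>)) \<partial>M) = (\<integral>\<^sup>+\<omega>. ennreal (\<phi> (D \<omega>)) \<partial>M)"
    by (intro nn_integral_cong) simp
  finally show ?thesis by (simp add: D_def)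
qed

text \<open>The factorisation extends from bounded continuous functions to the positive and negative
  parts by truncation and monotone convergence. The integral over \<open>A\<close> is then the
  probability of \<open>A\<close> times the mean, which is 0.\<close>

lemma levy_mart_increment:
  assumes st: "0 \<le> s" "s \<le> t" "t \<le> T" and A: "A \<in> sets (F s)"
    and int: "integrable M (\<lambda>\<omega>. levy_mart c \<omega> t - levy_mart c \<omega> s)"
    and mean: "expectation (\<lambda>\<omega>. levy_mart c \<omega> t - levy_mart c \<omega> s) = 0"
  shows "(\<integral>\<omega>\<in>A. levy_mart c \<omega> t - levy_mart c \<omega> s \<partial>M) = 0"
proof (cases "s = t")
  case True
  then show ?thesis by (simp add: set_lebesgue_integral_def)
next
  case False
  define D where "D \<omega> = levy_mart c \<omega> t - levy_mart c \<omega> s" for \<omega>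
  have D: "integrable M D" using int by (simp add: D_def[abs_def])
  then have Dm [measurable]: "D \<in> borel_measurable M" by auto
  have sM [measurable]: "A \<in> sets M"
    using A st subalgebra_F[of s] by (auto simp: subalgebra_def)
  \<comment> \<open>For a = 1 and a = -1 these are the positive and the negative part, since
    \<open>ennreal\<close> sends negative reals to 0.\<close>
  have part: "(\<integral>\<^sup>+\<omega>. ennreal (indicator A \<omega> * (a * D \<omega>)) \<partial>M) = emeasure M A * (\<integral>\<^sup>+\<omega>. ennreal (a * D \<omega>) \<partial>M)" for a
  proof -
    define \<phi> where "\<phi> m x = min (max 0 (a * x)) (real m)" for m :: nat and x :: real
    have [measurable]: "\<phi> m \<in> borel_measurable borel" for m unfolding \<phi>_def by measurable
    have sup: "(SUP m. ennreal (\<phi> m x)) = ennreal (a * x)" for x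
    proof (rule LIMSEQ_unique[OF LIMSEQ_SUP])
      show "incseq (\<lambda>m. ennreal (\<phi> m x))" by (auto simp: incseq_def \<phi>_def intro!: ennreal_leI)
      obtain m0 :: nat where m0: "max 0 (a * x) \<le> real m0" using real_arch_simple by blast
      have "eventually (\<lambda>m. ennreal (\<phi> m x) = ennreal (a * x)) sequentially"
        using eventually_ge_at_top[of m0]
      proof eventually_elim
        case (elim m)
        then have "\<phi> m x = max 0 (a * x)" using m0 by (auto simp: \<phi>_def)
        then show ?case by (simp add: max_def ennreal_neg)
      qed
      then show "(\<lambda>m. ennreal (\<phi> m x)) \<longlonglongrightarrow> ennreal (a * x)" by (rule tendsto_eventually)
    qed
    have inc: "incseq (\<lambda>m \<omega>. indicator B \<omega> * ennreal (\<phi> m (D \<omega>)))" for B :: "'a set"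
      by (auto simp: incseq_def le_fun_def \<phi>_def intro!: mult_left_mono ennreal_leI)
    have mono: "(\<integral>\<^sup>+\<omega>. indicator B \<omega> * ennreal (a * D \<omega>) \<partial>M) = (SUP m. \<integral>\<^sup>+\<omega>. indicator B \<omega> * ennreal (\<phi> m (D \<omega>)) \<partial>M)"
      if [measurable]: "B \<in> sets M" for B
      by (subst nn_integral_monotone_convergence_SUP[symmetric, OF inc])
        (auto simp: SUP_mult_left_ennreal[symmetric] sup)
    have sp: "(\<integral>\<^sup>+\<omega>. indicator (space M) \<omega> * u \<omega> \<partial>M) = (\<integral>\<^sup>+\<omega>. u \<omega> \<partial>M)" for u
      by (intro nn_integral_cong) simp
    have "(\<integral>\<^sup>+\<omega>. ennreal (indicator A \<omega> * (a * D \<omega>)) \<partial>M) = (\<integral>\<^sup>+\<omega>. indicator A \<omega> * ennreal (a * D \<omega>) \<partial>M)"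
      by (intro nn_integral_cong) (auto simp: indicator_def)
    also have "\<dots> = (SUP m. \<integral>\<^sup>+\<omega>. indicator A \<omega> * ennreal (\<phi> m (D \<omega>)) \<partial>M)"
      by (rule mono) simp
    also have "\<dots> = (SUP m. emeasure M A * (\<integral>\<^sup>+\<omega>. ennreal (\<phi> m (D \<omega>)) \<partial>M))"
    proof (intro SUP_cong refl)
      fix m
      have "continuous_on UNIV (\<phi> m)" unfolding \<phi>_def by (intro continuous_intros)
      then show "(\<integral>\<^sup>+\<omega>. indicator A \<omega> * ennreal (\<phi> m (D \<omega>)) \<partial>M) = emeasure M A * (\<integral>\<^sup>+\<omega>. ennreal (\<phi> m (D \<omega>)) \<partial>M)"
        unfolding D_def using st False A
        by (intro levy_mart_increment_continuous[where K = m]) (auto simp: \<phi>_def)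
    qed
    also have "\<dots> = emeasure M A * (SUP m. \<integral>\<^sup>+\<omega>. ennreal (\<phi> m (D \<omega>)) \<partial>M)"
      by (rule SUP_mult_left_ennreal[symmetric])
    also have "(SUP m. \<integral>\<^sup>+\<omega>. ennreal (\<phi> m (D \<omega>)) \<partial>M) = (\<integral>\<^sup>+\<omega>. ennreal (a * D \<omega>) \<partial>M)"
      using mono[of "space M"] by (simp add: sp)
    finally show ?thesis .
  qed
  have iA: "integrable M (\<lambda>\<omega>. indicator A \<omega> * D \<omega>)"
    using integrable_mult_indicator[OF sM D] by simp
  have "(\<integral>\<omega>\<in>A. D \<omega> \<partial>M) = (\<integral>\<omega>. indicator A \<omega> * D \<omega> \<partial>M)"
    by (simp add: set_lebesgue_integral_def)
  also have "\<dots> = enn2real (emeasure M A * (\<integral>\<^sup>+\<omega>. ennreal (D \<omega>) \<partial>M)) - enn2real (emeasure M A * (\<integral>\<^sup>+\<omega>. ennreal (- D \<omega>) \<partial>M))"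
    using part[of 1] part[of "-1"] by (subst real_lebesgue_integral_def[OF iA]) simp
  also have "\<dots> = measure M A * (enn2real (\<integral>\<^sup>+\<omega>. ennreal (D \<omega>) \<partial>M) - enn2real (\<integral>\<^sup>+\<omega>. ennreal (- D \<omega>) \<partial>M))"
    by (simp add: enn2real_mult measure_def right_diff_distrib)
  also have "\<dots> = 0"
    using mean real_lebesgue_integral_def[OF D] by (simp add: D_def[abs_def])
  finally show ?thesis by (simp add: D_def)
qed

lemma local_martingale_levy_mart:
  assumes int: "\<And>t. t \<in> {0..T} \<Longrightarrow> integrable M (\<lambda>\<omega>. levy_mart c \<omega> t)"
    and mean: "\<And>t. t \<in> {0..T} \<Longrightarrow> expectation (\<lambda>\<omega>. levy_mart c \<omega> t) = 0"
  shows "local_martingale T M F (levy_mart c)"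
proof -
  have "martingale T M F (levy_mart c)"
    unfolding martingale_def
  proof (intro conjI ballI)
    show "adapted T F (levy_mart c)"
      using cadlag_adapted_levy_mart by (simp add: cadlag_adapted_def)
    fix s t assume s: "s \<in> {0..T}" and t: "t \<in> {s..T}"
    then have t': "t \<in> {0..T}" by auto
    interpret finite_measure_subalgebra M "F s"
      using subalgebra_F[OF s] by unfold_locales
    show "AE \<omega> in M. real_cond_exp M (F s) (\<lambda>\<omega>. levy_mart c \<omega> t) \<omega> = levy_mart c \<omega> s"
    proof (rule real_cond_exp_charact)
      show "(\<lambda>\<omega>. levy_mart c \<omega> s) \<in> borel_measurable (F s)"
        using cadlag_adapted_levy_mart s by (simp add: cadlag_adapted_def adapted_def)
      fix A assume A: "A \<in> sets (F s)"
      then have "A \<in> sets M" using subalgebra_F[OF s] by (auto simp: subalgebra_def)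
      then have si: "set_integrable M A (\<lambda>\<omega>. levy_mart c \<omega> r)" if "r \<in> {0..T}" for r
        using int[OF that] unfolding set_integrable_def by (intro integrable_mult_indicator)
      have "(\<integral>\<omega>\<in>A. levy_mart c \<omega> t - levy_mart c \<omega> s \<partial>M) = 0"
        using s t A int[OF s] int[OF t'] mean[OF s] mean[OF t']
        by (intro levy_mart_increment) auto
      then show "(\<integral>\<omega>\<in>A. levy_mart c \<omega> t \<partial>M) = (\<integral>\<omega>\<in>A. levy_mart c \<omega> s \<partial>M)"
        using set_integral_diff(2)[OF si[OF t'] si[OF s]] by simp
    qed (use int s t' in auto)
  qed (rule int)
  \<comment> \<open>The process is a true martingale on [0,T], so the constant time \<open>T\<close>
    localises it; stopping there changes nothing, also off [0,T], because the path is
    extensional.\<close>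
  moreover have "stop_path T (levy_mart c \<omega>) T = levy_mart c \<omega>" for \<omega>
    by (auto simp: stop_path_def levy_mart_def fun_eq_iff)
  moreover have "stop_time T M F (\<lambda>_. T)"
    unfolding stop_time_def
  proof (intro conjI ballI)
    fix t assume "t \<in> {0..T}"
    then have "space M \<in> sets (F t)"
      using sets.top[of "F t"] by (simp only: space_F)
    then show "{\<omega> \<in> space M. T \<le> t} \<in> sets (F t)"
      by (cases "T \<le> t") auto
  qed (use T in auto)
  ultimately show ?thesis
    unfolding local_martingale_def using cadlag_adapted_levy_mart
    by (intro conjI exI[of _ "\<lambda>_ _. T"]) (auto simp: mono_def)
qed

lemma semimartingale_Y: "semimartingale T M F Y"
proof -
  obtain c where c: "\<And>t. t \<in> {0..T} \<Longrightarrow> integrable M (\<lambda>\<omega>. Y \<omega> t - Y \<omega> 0 - jump_sum jcut (Y \<omega>) t - c * t)"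
    "\<And>t. t \<in> {0..T} \<Longrightarrow> expectation (\<lambda>\<omega>. Y \<omega> t - Y \<omega> 0 - jump_sum jcut (Y \<omega>) t - c * t) = 0"
    using drift_exists by blast
  have "local_martingale T M F (levy_mart c)"
    using c by (intro local_martingale_levy_mart) (simp_all add: levy_mart_def)
  moreover have "levy_mart c \<omega> 0 = 0" "levy_fv c \<omega> 0 = 0"
    "\<forall>t\<in>{0..T}. Y \<omega> t = Y \<omega> 0 + levy_mart c \<omega> t + levy_fv c \<omega> t" for \<omega>
    using T jump_sum_0 by (auto simp: levy_mart_def levy_fv_def)
  ultimately show ?thesis
    unfolding semimartingale_def
    using cadlag_adapted_Y cadlag_adapted_levy_fv[of c] finite_variation_levy_fv[of _ c] by blast
qed

end

section \<open>Adding a jump is absolutely continuous\<close>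

lemma AE_pair_fst:
  assumes "sigma_finite_measure M2" "AE x in M1. P x"
  shows "AE z in M1 \<Otimes>\<^sub>M M2. P (fst z)"
proof -
  interpret M2: sigma_finite_measure M2 by fact
  obtain N where N: "{x\<in>space M1. \<not> P x} \<subseteq> N" "emeasure M1 N = 0" "N \<in> sets M1"
    using assms(2) by (rule AE_E)
  show ?thesis
  proof (rule AE_I[where N = "N \<times> space M2"])
    show "emeasure (M1 \<Otimes>\<^sub>M M2) (N \<times> space M2) = 0"
      using N by (simp add: M2.emeasure_pair_measure_Times)
  qed (use N in \<open>auto simp: space_pair_measure\<close>)
qed

lemma AE_pair_snd:
  assumes "sigma_finite_measure M2" "AE y in M2. P y"
  shows "AE z in M1 \<Otimes>\<^sub>M M2. P (snd z)"
proof -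
  interpret M2: sigma_finite_measure M2 by fact
  obtain N where N: "{x\<in>space M2. \<not> P x} \<subseteq> N" "emeasure M2 N = 0" "N \<in> sets M2"
    using assms(2) by (rule AE_E)
  show ?thesis
  proof (rule AE_I[where N = "space M1 \<times> N"])
    show "emeasure (M1 \<Otimes>\<^sub>M M2) (space M1 \<times> N) = 0"
      using N by (simp add: M2.emeasure_pair_measure_Times)
  qed (use N in \<open>auto simp: space_pair_measure\<close>)
qed

text \<open>For positive \<open>m\<close>, the function \<open>g m t\<close> is 1 up to
  \<open>a t\<close> and falls linearly to 0 over a length 1/m, so the products converge to the
  indicator of the orthant.\<close>

lemma emeasure_halfspaces_limit:
  fixes Q :: "('i \<Rightarrow> real) measure" and a :: "'i \<Rightarrow> real"
  assumes Q: "sets Q = sets (Pi\<^sub>M I (\<lambda>_. borel))" "emeasure Q (space Q) < \<infinity>"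
    and J: "finite J" "J \<subseteq> I"
  defines "g \<equiv> \<lambda>(m::nat) t y. max 0 (min 1 (1 - real m * (y - a t)))"
  shows "(\<lambda>m. \<integral>\<^sup>+x. ennreal (\<Prod>t\<in>J. g m t (x t)) \<partial>Q) \<longlonglongrightarrow> emeasure Q {x\<in>space Q. \<forall>t\<in>J. x t \<le> a t}"
proof -
  let ?H = "{x\<in>space Q. \<forall>t\<in>J. x t \<le> a t}"
  have [measurable]: "(\<lambda>x. x t) \<in> borel_measurable Q" if "t \<in> J" for t
    using that J by (subst measurable_cong_sets[OF Q(1) refl]) (auto intro: measurable_component_singleton)
  have H: "?H \<in> sets Q" using J(1) by measurable
  have "(\<lambda>m. \<integral>\<^sup>+x. ennreal (\<Prod>t\<in>J. g m t (x t)) \<partial>Q) \<longlonglongrightarrow> (\<integral>\<^sup>+x. indicator ?H x \<partial>Q)"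
  proof (rule nn_integral_dominated_convergence[where w = "\<lambda>_. 1"])
    show "(\<lambda>x. ennreal (\<Prod>t\<in>J. g m t (x t))) \<in> borel_measurable Q" for m
      unfolding g_def by measurable
    show "AE x in Q. ennreal (\<Prod>t\<in>J. g m t (x t)) \<le> 1" for m
      by (intro AE_I2) (auto intro!: prod_le_1 simp: g_def ennreal_le_1)
    show "AE x in Q. (\<lambda>m. ennreal (\<Prod>t\<in>J. g m t (x t))) \<longlonglongrightarrow> indicator ?H x"
    proof (rule AE_I2)
      fix x assume x: "x \<in> space Q"
      have g_lim: "(\<lambda>m. g m t (x t)) \<longlonglongrightarrow> (if x t \<le> a t then 1 else 0)" for t
      proof (cases "x t \<le> a t")
        case True
        then have "g m t (x t) = 1" for m
          unfolding g_def by (simp add: mult_nonneg_nonpos)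
        then show ?thesis using True by simp
      next
        case False
        then have d: "0 < x t - a t" by simp
        obtain m0 :: nat where m0: "1 < real m0 * (x t - a t)"
          using reals_Archimedean3[OF d] by blast
        have "eventually (\<lambda>m. g m t (x t) = 0) sequentially"
          using eventually_ge_at_top[of m0]
        proof eventually_elim
          case (elim m)
          then have "real m0 * (x t - a t) \<le> real m * (x t - a t)"
            using d by (intro mult_right_mono) auto
          then show ?case using m0 by (simp add: g_def)
        qed
        then show ?thesis using False by (simp add: tendsto_eventually)
      qed
      have "(\<Prod>t\<in>J. if x t \<le> a t then 1 else 0 :: real) = indicator ?H x"
        using x J(1) by (auto simp: indicator_def intro!: prod.neutral prod_zero)
      moreover have "(\<lambda>m. \<Prod>t\<in>J. g m t (x t)) \<longlonglongrightarrow> (\<Prod>t\<in>J. if x t \<le> a t then 1 else 0)"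
        by (intro tendsto_prod g_lim)
      ultimately have "(\<lambda>m. \<Prod>t\<in>J. g m t (x t)) \<longlonglongrightarrow> indicator ?H x" by simp
      from tendsto_ennrealI[OF this] show "(\<lambda>m. ennreal (\<Prod>t\<in>J. g m t (x t))) \<longlonglongrightarrow> indicator ?H x"
        by (simp add: ennreal_indicator)
    qed
  qed (use Q(2) borel_measurable_indicator[OF H] in auto)
  then show ?thesis using H by simp
qed

text \<open>Lower orthants in finitely many coordinates form an intersection-stable generator of the
  product sigma-algebra, and their measures are limits of integrals of continuous tests.\<close>

lemma measure_eqI_PiM_continuous:
  fixes Q1 Q2 :: "('i \<Rightarrow> real) measure"
  assumes Q1: "sets Q1 = sets (Pi\<^sub>M I (\<lambda>_. borel))" "emeasure Q1 (space Q1) < \<infinity>"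
    and Q2: "sets Q2 = sets (Pi\<^sub>M I (\<lambda>_. borel))" "emeasure Q2 (space Q2) < \<infinity>"
    and eq: "\<And>J g. finite J \<Longrightarrow> J \<subseteq> I \<Longrightarrow>
      (\<And>t. t \<in> J \<Longrightarrow> continuous_on UNIV (g t) \<and> range (g t) \<subseteq> {0..1}) \<Longrightarrow>
      (\<integral>\<^sup>+x. ennreal (\<Prod>t\<in>J. g t (x t)) \<partial>Q1) = (\<integral>\<^sup>+x. ennreal (\<Prod>t\<in>J. g t (x t)) \<partial>Q2)"
  shows "Q1 = Q2"
proof -
  let ?P = "Pi\<^sub>M I (\<lambda>_. borel :: real measure)"
  let ?\<Omega> = "space ?P"
  define H where "H J a = {x\<in>?\<Omega>. \<forall>t\<in>J. x t \<le> a t}" for J and a :: "'i \<Rightarrow> real"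
  define G where "G = {H J a | J a. finite J \<and> J \<subseteq> I}"
  have sp: "space Q1 = ?\<Omega>" "space Q2 = ?\<Omega>"
    using Q1(1) Q2(1) by (auto dest: sets_eq_imp_space_eq)
  have Hm: "H J a \<in> sets ?P" if "finite J" "J \<subseteq> I" for J a
  proof -
    have [measurable]: "(\<lambda>x. x t) \<in> borel_measurable ?P" if "t \<in> J" for t
      using that \<open>J \<subseteq> I\<close> by (auto intro: measurable_component_singleton)
    show ?thesis unfolding H_def using \<open>finite J\<close> by measurable
  qed
  have GP: "G \<subseteq> Pow ?\<Omega>" by (auto simp: G_def H_def)
  have "sigma_sets ?\<Omega> G \<subseteq> sets ?P"
    by (intro sets.sigma_sets_subset) (use Hm in \<open>auto simp: G_def\<close>)
  moreover have "sets ?P \<subseteq> sigma_sets ?\<Omega> G"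
  proof -
    have "(\<lambda>x. x i) \<in> borel_measurable (sigma ?\<Omega> G)" if "i \<in> I" for i
    proof (rule borel_measurableI_le)
      fix y
      have "{x \<in> ?\<Omega>. x i \<le> y} = H {i} (\<lambda>_. y)" by (simp add: H_def)
      then have "{x \<in> ?\<Omega>. x i \<le> y} \<in> G"
        using that unfolding G_def by blast
      then show "{x \<in> space (sigma ?\<Omega> G). x i \<le> y} \<in> sets (sigma ?\<Omega> G)"
        using GP by auto
    qed
    then have "(\<lambda>x i. x i) \<in> measurable (sigma ?\<Omega> G) ?P"
      using GP by (intro measurable_PiM_single') (auto simp: space_PiM)
    then have "A \<inter> ?\<Omega> \<in> sigma_sets ?\<Omega> G" if "A \<in> sets ?P" for A
      using measurable_sets[OF _ that, of "\<lambda>x i. x i" "sigma ?\<Omega> G"] GP by simp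
    then show ?thesis
      using sets.sets_into_space[of _ ?P] by (metis inf.absorb1 subsetI)
  qed
  ultimately have gen: "sets ?P = sigma_sets ?\<Omega> G" by blast
  show ?thesis
  proof (rule measure_eqI_generator_eq)
    show "Int_stable G"
    proof (rule Int_stableI)
      fix A B assume "A \<in> G" "B \<in> G"
      then obtain J a K b where A: "A = H J a" "finite J" "J \<subseteq> I" and B: "B = H K b" "finite K" "K \<subseteq> I"
        unfolding G_def by blast
      have "A \<inter> B = H (J \<union> K) (\<lambda>t. if t \<in> J then if t \<in> K then min (a t) (b t) else a t else b t)"
        unfolding A B H_def by (auto split: if_splits)
      then show "A \<inter> B \<in> G" unfolding G_def using A B by blast
    qed
    show "emeasure Q1 X = emeasure Q2 X" if X: "X \<in> G" for X
    proof -
      obtain J a where J: "X = H J a" "finite J" "J \<subseteq> I" using X unfolding G_def by blast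
      let ?g = "\<lambda>(m::nat) t y. max 0 (min 1 (1 - real m * (y - a t)))"
      have "(\<integral>\<^sup>+x. ennreal (\<Prod>t\<in>J. ?g m t (x t)) \<partial>Q1) = (\<integral>\<^sup>+x. ennreal (\<Prod>t\<in>J. ?g m t (x t)) \<partial>Q2)" for m
        by (intro eq J) (auto intro!: continuous_intros)
      then show ?thesis
        using emeasure_halfspaces_limit[OF Q1 J(2,3), of a] emeasure_halfspaces_limit[OF Q2 J(2,3), of a]
        unfolding sp J(1) H_def by (simp add: LIMSEQ_unique)
    qed
    \<comment> \<open>No constraint gives the whole space, which serves as the exhausting sequence
      because both measures are finite.\<close>
    have "H {} (\<lambda>_. 0) \<in> G" unfolding G_def by blast
    then show "range (\<lambda>_::nat. ?\<Omega>) \<subseteq> G" by (auto simp: H_def)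
  qed (use GP gen Q1 Q2 sp in auto)
qed

context pure_jump_levy
begin

section \<open>The Mecke formula for the Levy path\<close>

definition cut_below :: "real \<Rightarrow> real \<Rightarrow> real" where
  "cut_below \<epsilon> x = indicator {x. \<epsilon> < \<bar>x\<bar>} x * x"

text \<open>\<open>m\<close> is both the fineness of the grid and the height of the truncation: the
  range stays finite, as simple functions require, while the limit is
  \<open>cut_below\<close>.\<close>

definition discretize :: "real \<Rightarrow> nat \<Rightarrow> real \<Rightarrow> real" where
  "discretize \<epsilon> m x = (if \<epsilon> < \<bar>x\<bar> \<and> \<bar>x\<bar> \<le> real m then of_int \<lfloor>real m * x\<rfloor> / real m else 0)"

lemma discretize_measurable [measurable]: "discretize \<epsilon> m \<in> borel_measurable borel"
  unfolding discretize_def by measurable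

lemma discretize_finite_range: "finite (range (discretize \<epsilon> m))"
proof -
  have "discretize \<epsilon> m x \<in> insert 0 ((\<lambda>k. of_int k / real m) ` {- int (m * m) - 1..int (m * m) + 1})" for x
  proof (cases "\<epsilon> < \<bar>x\<bar> \<and> \<bar>x\<bar> \<le> real m")
    case True
    then have "\<bar>real m * x\<bar> \<le> real m * real m"
      by (simp add: abs_mult mult_left_mono)
    then have "- int (m * m) - 1 \<le> \<lfloor>real m * x\<rfloor>" "\<lfloor>real m * x\<rfloor> \<le> int (m * m) + 1"
      by (simp_all add: le_floor_iff floor_le_iff)
    then show ?thesis using True by (auto simp: discretize_def)
  qed (auto simp: discretize_def)
  then have "range (discretize \<epsilon> m) \<subseteq> insert 0 ((\<lambda>k. of_int k / real m) ` {- int (m * m) - 1..int (m * m) + 1})"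
    by blast
  then show ?thesis by (rule finite_subset) simp
qed

lemma discretize_limit: "(\<lambda>m. discretize \<epsilon> (Suc m) x) \<longlonglongrightarrow> cut_below \<epsilon> x"
proof (cases "\<epsilon> < \<bar>x\<bar>")
  case False
  then show ?thesis by (simp add: discretize_def cut_below_def)
next
  case True
  obtain m0 :: nat where m0: "\<bar>x\<bar> \<le> real m0" using real_arch_simple by blast
  have "eventually (\<lambda>m. norm (discretize \<epsilon> (Suc m) x - x) \<le> inverse (real (Suc m))) sequentially"
    using eventually_ge_at_top[of m0]
  proof eventually_elim
    case (elim m)
    have le: "\<bar>x\<bar> \<le> real (Suc m)" using m0 elim by linarith
    have "discretize \<epsilon> (Suc m) x - x = (of_int \<lfloor>real (Suc m) * x\<rfloor> - real (Suc m) * x) / real (Suc m)"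
      using True le by (simp add: discretize_def diff_divide_distrib del: of_nat_Suc)
    moreover have "\<bar>of_int \<lfloor>real (Suc m) * x\<rfloor> - real (Suc m) * x\<bar> \<le> 1"
      by linarith
    ultimately show ?case
      by (simp add: abs_divide inverse_eq_divide divide_right_mono del: of_nat_Suc)
  qed
  then have "(\<lambda>m. discretize \<epsilon> (Suc m) x - x) \<longlonglongrightarrow> 0"
    using LIMSEQ_inverse_real_of_nat by (rule Lim_null_comparison)
  then show ?thesis
    using True by (simp add: LIM_zero_iff cut_below_def)
qed

lemma cut_below_measurable [measurable]: "cut_below \<epsilon> \<in> borel_measurable borel"
  unfolding cut_below_def by measurable

definition jump_region :: "real \<Rightarrow> (real \<times> real) set" where
  "jump_region \<epsilon> = {0<..T} \<times> {x. \<epsilon> < \<bar>x\<bar>}"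

lemma jump_region_sets: "jump_region \<epsilon> \<in> sets (leb T \<Otimes>\<^sub>M \<nu>)"
  unfolding jump_region_def
  by (intro pair_measureI sets_leb_interval) (auto simp: sets_levy_measure[OF \<nu>])

lemma jump_region_finite: "0 < \<epsilon> \<Longrightarrow> emeasure (leb T \<Otimes>\<^sub>M \<nu>) (jump_region \<epsilon>) < \<infinity>"
  unfolding jump_region_def using T levy_measure_finite[OF \<nu>]
  by (subst emeasure_leb_levy[OF \<nu>]) (auto simp: ennreal_mult_less_top)

lemma jump_integrand_measurable:
  assumes "t \<in> {0..T}" and k [measurable]: "k \<in> borel_measurable borel"
  shows "(\<lambda>z. indicator ({0<..t} \<times> UNIV) z * k (snd z) :: real) \<in> borel_measurable (leb T \<Otimes>\<^sub>M \<nu>)"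
  using measurable_jump_sum_integrand[OF k, of t T] assms(1)
  by (simp add: measurable_cong_sets[OF sets_leb_levy[OF \<nu>] refl])

text \<open>The formula for simple functions is applied to the rounded jumps. The rounding is
  removed path by path, because only finitely many jumps exceed \<epsilon> in size.\<close>

lemma mecke_pair_cut_below:
  assumes e: "0 < \<epsilon>" and J: "finite J" "J \<subseteq> {0..T}"
    and C: "C \<in> sets (leb T \<Otimes>\<^sub>M \<nu>)" "C \<subseteq> jump_region \<epsilon>"
  shows "mecke_pair C J (\<lambda>t \<omega>. jump_sum (cut_below \<epsilon>) (Y \<omega>) t)
    (\<lambda>t z. indicator ({0<..t} \<times> UNIV) z * cut_below \<epsilon> (snd z))"
proof (rule mecke_pair_limit)
  let ?q = "\<lambda>m t z. indicator ({0<..t} \<times> UNIV) z * discretize \<epsilon> (Suc m) (snd z)"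
  let ?V = "\<lambda>m t \<omega>. LINT z:jump_region \<epsilon>|jump_measure T (Y \<omega>). ?q m t z"
  show "mecke_pair C J (?V m) (?q m)" for m
  proof (rule mecke_pair_simple[OF J(1) _ jump_region_sets jump_region_finite[OF e] C])
    fix t assume "t \<in> J"
    then have t: "t \<in> {0..T}" using J by auto
    have "range (?q m t) \<subseteq> insert 0 (range (discretize \<epsilon> (Suc m)))"
      by (auto simp: indicator_def)
    then have "finite (?q m t ` space (leb T \<Otimes>\<^sub>M \<nu>))"
      using discretize_finite_range[of \<epsilon> "Suc m"] by (meson finite_insert finite_subset image_mono subset_UNIV)
    then show "simple_function (leb T \<Otimes>\<^sub>M \<nu>) (?q m t)"
      by (intro simple_function_borel_measurable jump_integrand_measurable t) auto
  qed
  show "sigma_finite_measure (leb T \<Otimes>\<^sub>M \<nu>)" by (rule sigma_finite_leb_levy[OF \<nu>])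
  show "emeasure (leb T \<Otimes>\<^sub>M \<nu>) C < \<infinity>"
    using emeasure_mono[OF C(2) jump_region_sets] jump_region_finite[OF e] by (rule le_less_trans)
  fix t assume "t \<in> J"
  then have t: "t \<in> {0..T}" using J by auto
  have d0: "discretize \<epsilon> m x = 0" "cut_below \<epsilon> x = 0" if "\<bar>x\<bar> \<le> \<epsilon>" for m x
    using that by (auto simp: discretize_def cut_below_def)
  have "(\<lambda>\<omega>. \<integral>z. indicator ({0<..t} \<times> UNIV) z * cut_below \<epsilon> (snd z) \<partial>jump_measure T (Y \<omega>)) \<in> borel_measurable M"
    by (intro measurable_integral_N jump_integrand_measurable t) simp
  also have "?this \<longleftrightarrow> (\<lambda>\<omega>. jump_sum (cut_below \<epsilon>) (Y \<omega>) t) \<in> borel_measurable M"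
    using t by (intro measurable_cong integral_jump_measure[OF Y_path(2) e d0(2)]) auto
  finally show "(\<lambda>\<omega>. jump_sum (cut_below \<epsilon>) (Y \<omega>) t) \<in> borel_measurable M" .
  show "(\<lambda>z. indicator ({0<..t} \<times> UNIV) z * cut_below \<epsilon> (snd z)) \<in> borel_measurable (leb T \<Otimes>\<^sub>M \<nu>)"
    by (intro jump_integrand_measurable t) simp
  show "(\<lambda>m. ?q m t z) \<longlonglongrightarrow> indicator ({0<..t} \<times> UNIV) z * cut_below \<epsilon> (snd z)" for z
    by (intro tendsto_mult_left discretize_limit)
  show "AE \<omega> in M. (\<lambda>m. ?V m t \<omega>) \<longlonglongrightarrow> jump_sum (cut_below \<epsilon>) (Y \<omega>) t"
  proof (rule AE_I2)
    fix \<omega> assume \<omega>: "\<omega> \<in> space M"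
    note y = Y_path(2)[OF \<omega>]
    have "?V m t \<omega> = jump_sum (discretize \<epsilon> (Suc m)) (Y \<omega>) t" for m
    proof -
      have "?V m t \<omega> = (\<integral>z. ?q m t z \<partial>jump_measure T (Y \<omega>))"
        unfolding set_lebesgue_integral_def using t
        by (intro Bochner_Integration.integral_cong)
          (auto simp: jump_region_def indicator_def discretize_def)
      also have "\<dots> = jump_sum (discretize \<epsilon> (Suc m)) (Y \<omega>) t"
        using t by (intro integral_jump_measure[OF y e d0(1)]) auto
      finally show ?thesis .
    qed
    moreover have "(\<lambda>m. jump_sum (discretize \<epsilon> (Suc m)) (Y \<omega>) t) \<longlonglongrightarrow> jump_sum (cut_below \<epsilon>) (Y \<omega>) t"
    proof -
      have "(\<lambda>m. \<Sum>r\<in>{r\<in>{0<..t}. \<epsilon> < \<bar>jump (Y \<omega>) r\<bar>}. discretize \<epsilon> (Suc m) (jump (Y \<omega>) r))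
          \<longlonglongrightarrow> (\<Sum>r\<in>{r\<in>{0<..t}. \<epsilon> < \<bar>jump (Y \<omega>) r\<bar>}. cut_below \<epsilon> (jump (Y \<omega>) r))"
        by (intro tendsto_sum discretize_limit)
      moreover have "t \<le> T" using t by simp
      ultimately show ?thesis
        by (simp only: jump_sum_superset[OF y e d0(1)] jump_sum_superset[OF y e d0(2)])
    qed
    ultimately show "(\<lambda>m. ?V m t \<omega>) \<longlonglongrightarrow> jump_sum (cut_below \<epsilon>) (Y \<omega>) t" by simp
  qed
qed (use C J in auto)

text \<open>At the finitely many times of \<open>J\<close>, \<open>Y\<close> is an almost sure
  limit, along one subsequence, of sums of jumps above a level \<open>d n\<close> plus deterministic
  terms. On \<open>jump_region \<epsilon>\<close> the displacement no longer depends on the level,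
  since \<open>d n\<close> is below \<epsilon>.\<close>

lemma mecke_pair_levy:
  assumes e: "0 < \<epsilon>" and J: "finite J" "J \<subseteq> {0..T}"
  shows "mecke_pair (jump_region \<epsilon>) J (\<lambda>t \<omega>. Y \<omega> t) (\<lambda>t z. indicator ({0<..t} \<times> UNIV) z * snd z)"
proof -
  obtain \<gamma> K where K: "\<And>t. t \<in> {0..T} \<Longrightarrow> is_compensated_integral T M Y \<nu> t (\<lambda>\<omega>. K \<omega> t)"
    and Y: "AE \<omega> in M. \<forall>t\<in>{0..T}.
           Y \<omega> t = \<gamma> * t + (LINT z:({0<..t} \<times> {x. \<bar>x\<bar> > 1})|jump_measure T (Y \<omega>). snd z) + K \<omega> t"
    using levy unfolding pure_jump_levy_process_def by blast
  define \<delta> where "\<delta> n = 1 / real (Suc n)" for n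
  have \<delta>: "0 < \<delta> n" "\<delta> n \<le> 1" for n by (auto simp: \<delta>_def)
  \<comment> \<open>Summing the squared errors over \<open>J\<close> yields one subsequence that
    works for all times at once.\<close>
  define U where "U n \<omega> = (\<Sum>t\<in>J. (K \<omega> t - compensated_sum (\<delta> n) t \<omega>)\<^sup>2)" for n \<omega>
  have Km [measurable]: "(\<lambda>\<omega>. K \<omega> t) \<in> borel_measurable M" if "t \<in> J" for t
    using K[of t] that J by (auto simp: is_compensated_integral_def)
  have cm [measurable]: "compensated_sum (\<delta> n) t \<in> borel_measurable M" if "t \<in> J" for n t
    using integrable_compensated_sum[OF \<delta>(1)] that J by (auto intro: borel_measurable_integrable)
  have Um [measurable]: "U n \<in> borel_measurable M" for n
    unfolding U_def by measurable
  have U0: "0 \<le> U n \<omega>" for n \<omega>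
    unfolding U_def by (intro sum_nonneg) auto
  have Ulim: "(\<lambda>n. \<integral>\<^sup>+\<omega>. ennreal (U n \<omega>) \<partial>M) \<longlonglongrightarrow> 0"
  proof -
    have "(\<integral>\<^sup>+\<omega>. ennreal (U n \<omega>) \<partial>M) = (\<Sum>t\<in>J. \<integral>\<^sup>+\<omega>. ennreal ((K \<omega> t - compensated_sum (\<delta> n) t \<omega>)\<^sup>2) \<partial>M)" for n
      unfolding U_def by (subst nn_integral_sum[symmetric]) (auto simp: sum_ennreal)
    moreover have "(\<lambda>n. \<Sum>t\<in>J. \<integral>\<^sup>+\<omega>. ennreal ((K \<omega> t - compensated_sum (\<delta> n) t \<omega>)\<^sup>2) \<partial>M) \<longlonglongrightarrow> (\<Sum>t\<in>J. 0)"
      unfolding \<delta>_def using J by (intro tendsto_sum compensated_integral_limit K) auto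
    ultimately show ?thesis by simp
  qed
  then have "eventually (\<lambda>n. (\<integral>\<^sup>+\<omega>. ennreal (U n \<omega>) \<partial>M) < 1) sequentially"
    by (rule order_tendstoD) simp
  \<comment> \<open>A level below \<epsilon> serves twice: the region at \<epsilon> then lies in the
    region of that level, and the atoms in it survive the truncation.\<close>
  moreover have "eventually (\<lambda>n. \<delta> n < \<epsilon>) sequentially"
    using LIMSEQ_inverse_real_of_nat e unfolding \<delta>_def inverse_eq_divide by (rule order_tendstoD)
  ultimately have "eventually (\<lambda>n. (\<integral>\<^sup>+\<omega>. ennreal (U n \<omega>) \<partial>M) < 1 \<and> \<delta> n < \<epsilon>) sequentially"
    by (rule eventually_conj)
  then obtain n0 where n0: "\<And>n. n0 \<le> n \<Longrightarrow> (\<integral>\<^sup>+\<omega>. ennreal (U n \<omega>) \<partial>M) < 1 \<and> \<delta> n < \<epsilon>"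
    unfolding eventually_sequentially by blast
  \<comment> \<open>Integrability of the errors is known only from \<open>n0\<close> on, hence the
    shifted index in the subsequence argument.\<close>
  have Ui: "integrable M (U (n + n0))" for n
  proof (rule integrableI_nonneg)
    have "(1::ennreal) < \<infinity>" by simp
    with n0[of "n + n0"] show "(\<integral>\<^sup>+\<omega>. ennreal (U (n + n0) \<omega>) \<partial>M) < \<infinity>"
      by (meson le_add2 less_trans)
  qed (use U0 in auto)
  have "(\<lambda>n. \<integral>\<omega>. norm (U (n + n0) \<omega>) \<partial>M) \<longlonglongrightarrow> 0"
  proof -
    have "(\<lambda>n. enn2real (\<integral>\<^sup>+\<omega>. ennreal (U (n + n0) \<omega>) \<partial>M)) \<longlonglongrightarrow> enn2real 0"
      using LIMSEQ_ignore_initial_segment[OF Ulim, of n0] by (intro tendsto_enn2real) auto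
    moreover have "(\<integral>\<omega>. norm (U (n + n0) \<omega>) \<partial>M) = enn2real (\<integral>\<^sup>+\<omega>. ennreal (U (n + n0) \<omega>) \<partial>M)" for n
      using U0 by (simp add: integral_eq_nn_integral)
    ultimately show ?thesis by simp
  qed
  from tendsto_L1_AE_subseq[OF Ui this] obtain r :: "nat \<Rightarrow> nat" where
    r: "AE \<omega> in M. (\<lambda>n. U (r n + n0) \<omega>) \<longlonglongrightarrow> 0" by blast
  define d where "d n = \<delta> (r n + n0)" for n
  have d: "0 < d n" "d n \<le> 1" "d n < \<epsilon>" for n
    using \<delta> n0[of "r n + n0"] by (auto simp: d_def)
  \<comment> \<open>All jumps above \<open>d n\<close>, large ones included, with drift and
    compensator as deterministic terms for \<open>mecke_pair_shift\<close>.\<close>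
  define V where "V n t \<omega> = jump_sum (cut_below (d n)) (Y \<omega>) t + (\<gamma> * t - t * (\<integral>x. small_jump (d n) x \<partial>\<nu>))" for n t \<omega>
  have mp: "mecke_pair (jump_region \<epsilon>) J (V n)
      (\<lambda>t z. indicator ({0<..t} \<times> UNIV) z * cut_below (d n) (snd z))" for n
    unfolding V_def using d[of n] J
    by (intro mecke_pair_shift mecke_pair_cut_below jump_region_sets) (auto simp: jump_region_def)
  have Vlim: "AE \<omega> in M. (\<lambda>n. V n t \<omega>) \<longlonglongrightarrow> Y \<omega> t" if t: "t \<in> J" for t
    using r Y AE_space
  proof eventually_elim
    case (elim \<omega>)
    have t': "t \<in> {0..T}" "t \<le> T" using t J by auto
    note y = Y_path(2)[OF elim(3)]
    have "(\<lambda>n. (K \<omega> t - compensated_sum (d n) t \<omega>)\<^sup>2) \<longlonglongrightarrow> 0"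
    proof (rule tendsto_sandwich[OF _ _ tendsto_const elim(1)])
      show "eventually (\<lambda>n. (K \<omega> t - compensated_sum (d n) t \<omega>)\<^sup>2 \<le> U (r n + n0) \<omega>) sequentially"
        unfolding U_def d_def using t J(1) by (intro always_eventually allI member_le_sum) auto
    qed auto
    then have "(\<lambda>n. sqrt ((K \<omega> t - compensated_sum (d n) t \<omega>)\<^sup>2)) \<longlonglongrightarrow> sqrt 0"
      by (rule tendsto_real_sqrt)
    then have "(\<lambda>n. K \<omega> t - compensated_sum (d n) t \<omega>) \<longlonglongrightarrow> 0"
      by (simp add: tendsto_rabs_zero_iff)
    then have "(\<lambda>n. Y \<omega> t - (K \<omega> t - compensated_sum (d n) t \<omega>)) \<longlonglongrightarrow> Y \<omega> t - 0"
      by (intro tendsto_intros)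
    moreover have "Y \<omega> t - (K \<omega> t - compensated_sum (d n) t \<omega>) = V n t \<omega>" for n
    proof -
      have "(LINT z:({0<..t} \<times> {x. \<bar>x\<bar> > 1})|jump_measure T (Y \<omega>). snd z) =
          jump_sum (\<lambda>x. indicator {x. 1 < \<bar>x\<bar>} x * x) (Y \<omega>) t"
        using t' by (intro set_integral_jump_measure[OF y, of "1/2"]) auto
      moreover have "jump_sum (cut_below (d n)) (Y \<omega>) t - jump_sum (small_jump (d n)) (Y \<omega>) t =
          jump_sum (\<lambda>x. cut_below (d n) x - small_jump (d n) x) (Y \<omega>) t"
        using t' d[of n] by (intro jump_sum_diff_fun[OF y, of "d n"]) (auto simp: cut_below_def small_jump_def)
      moreover have "(\<lambda>x. cut_below (d n) x - small_jump (d n) x) = (\<lambda>x. indicator {x. 1 < \<bar>x\<bar>} x * x)"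
        using d[of n] by (auto simp: cut_below_def small_jump_def indicator_def fun_eq_iff)
      ultimately show ?thesis
        using elim(2) t' by (simp add: V_def compensated_sum_def)
    qed
    ultimately show ?case by simp
  qed
  show ?thesis
  proof (rule mecke_pair_limit[OF mp J(1) jump_region_sets jump_region_finite[OF e] sigma_finite_leb_levy[OF \<nu>]])
    fix t assume t: "t \<in> J"
    then have t': "t \<in> {0..T}" using J by auto
    show "(\<lambda>\<omega>. Y \<omega> t) \<in> borel_measurable M" by (rule Y_measurable[OF t'])
    show "(\<lambda>z. indicator ({0<..t} \<times> UNIV) z * snd z) \<in> borel_measurable (leb T \<Otimes>\<^sub>M \<nu>)"
      using jump_integrand_measurable[OF t', of "\<lambda>x. x"] by simp
    show "AE \<omega> in M. (\<lambda>n. V n t \<omega>) \<longlonglongrightarrow> Y \<omega> t" by (rule Vlim[OF t])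
    show "(\<lambda>n. indicator ({0<..t} \<times> UNIV) z * cut_below (d n) (snd z)) \<longlonglongrightarrow> indicator ({0<..t} \<times> UNIV) z * snd z"
      if "z \<in> jump_region \<epsilon>" for z
    proof -
      have "cut_below (d n) (snd z) = snd z" for n
        using that d(3)[of n] by (auto simp: jump_region_def cut_below_def indicator_def)
      then show ?thesis by simp
    qed
  qed
qed

lemma measurable_Y: "Y \<in> measurable M (DD T)"
  using Y_measurable Y_path by (intro measurable_into_DD) (auto simp: space_DD)

lemma measurable_shift:
  "(\<lambda>(\<omega>, u, v). shift_path T (Y \<omega>) u v) \<in> measurable (M \<Otimes>\<^sub>M (leb T \<Otimes>\<^sub>M \<nu>)) (DD T)"
proof (rule measurable_into_DD)
  let ?L = "M \<Otimes>\<^sub>M (leb T \<Otimes>\<^sub>M \<nu>)"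
  fix z assume "z \<in> space ?L"
  then show "(case z of (\<omega>, u, v) \<Rightarrow> shift_path T (Y \<omega>) u v) \<in> space (DD T)"
    by (auto simp: space_pair_measure intro!: shift_path_in_DD Y_path)
next
  let ?L = "M \<Otimes>\<^sub>M (leb T \<Otimes>\<^sub>M \<nu>)"
  fix t assume t: "t \<in> {0..T}"
  have 1: "(\<lambda>z. Y (fst z) t) \<in> borel_measurable ?L"
    by (rule measurable_compose[OF measurable_fst Y_measurable[OF t]])
  have "(\<lambda>u. u) \<in> borel_measurable (leb T)"
    by (intro measurable_restrict_space1) simp
  then have 2: "(\<lambda>z. fst (snd z)) \<in> borel_measurable ?L"
    by (intro measurable_compose[OF measurable_compose[OF measurable_snd measurable_fst]])
  have "(\<lambda>v. v) \<in> borel_measurable \<nu>"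
    by (simp add: measurable_cong_sets[OF sets_levy_measure[OF \<nu>] refl])
  then have 3: "(\<lambda>z. snd (snd z)) \<in> borel_measurable ?L"
    by (intro measurable_compose[OF measurable_compose[OF measurable_snd measurable_snd]])
  have "(\<lambda>z. Y (fst z) t + (if fst (snd z) \<le> t then snd (snd z) else 0)) \<in> borel_measurable ?L"
    using 1 2 3 by measurable
  then show "(\<lambda>z. (case z of (\<omega>, u, v) \<Rightarrow> shift_path T (Y \<omega>) u v) t) \<in> borel_measurable ?L"
    by (simp add: shift_path_apply[OF t] case_prod_beta')
qed

text \<open>Both sides are finite measures of \<open>B\<close>: the law of \<open>Y\<close> weighted
  by the number of jumps in the region, and the law of the shifted path with (u,v) in the region.
  They agree on continuous tests by \<open>mecke_pair_levy\<close>.\<close>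

lemma mecke_levy_eq:
  assumes e: "0 < \<epsilon>" and B: "B \<in> sets (DD T)"
  shows "(\<integral>\<^sup>+\<omega>. indicator B (Y \<omega>) * emeasure (jump_measure T (Y \<omega>)) (jump_region \<epsilon>) \<partial>M) =
    (\<integral>\<^sup>+z. indicator (jump_region \<epsilon>) (snd z) * indicator B (case z of (\<omega>, u, v) \<Rightarrow> shift_path T (Y \<omega>) u v)
      \<partial>(M \<Otimes>\<^sub>M (leb T \<Otimes>\<^sub>M \<nu>)))"
proof -
  let ?L = "M \<Otimes>\<^sub>M (leb T \<Otimes>\<^sub>M \<nu>)"
  let ?C = "jump_region \<epsilon>"
  let ?P = "Pi\<^sub>M {0..T} (\<lambda>_. borel :: real measure)"
  define N where "N \<omega> = emeasure (jump_measure T (Y \<omega>)) ?C" for \<omega>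
  define S where "S z = (case z of (\<omega>, u, v) \<Rightarrow> shift_path T (Y \<omega>) u v)" for z
  interpret \<mu>: sigma_finite_measure "leb T \<Otimes>\<^sub>M \<nu>" by (rule sigma_finite_leb_levy[OF \<nu>])
  interpret pair_sigma_finite M "leb T \<Otimes>\<^sub>M \<nu>" ..
  \<comment> \<open>The laws are compared on the full product space, where the uniqueness result
    lives; \<open>B\<close> is carried over later as the trace of a product set.\<close>
  have DP: "f \<in> measurable K ?P" if "f \<in> measurable K (DD T)" for f and K :: "'k measure"
    using that unfolding DD_def by (simp add: measurable_restrict_space2_iff)
  have Nm [measurable]: "N \<in> borel_measurable M"
    unfolding N_def by (rule measurable_emeasure_N[OF jump_region_sets])
  have Ym [measurable]: "Y \<in> measurable M ?P" by (rule DP[OF measurable_Y])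
  have Sm [measurable]: "S \<in> measurable ?L ?P"
    using DP[OF measurable_shift] by (simp add: S_def[abs_def])
  have Cm [measurable]: "?C \<in> sets (leb T \<Otimes>\<^sub>M \<nu>)" by (rule jump_region_sets)
  define w where "w z = (indicator ?C (snd z) :: ennreal)" for z :: "'a \<times> real \<times> real"
  have wm [measurable]: "w \<in> borel_measurable ?L" unfolding w_def by measurable
  define Q1 where "Q1 = distr (density M N) ?P Y"
  define Q2 where "Q2 = distr (density ?L w) ?P S"
  have Q1: "(\<integral>\<^sup>+x. h x \<partial>Q1) = (\<integral>\<^sup>+\<omega>. N \<omega> * h (Y \<omega>) \<partial>M)" if [measurable]: "h \<in> borel_measurable ?P" for h
    unfolding Q1_def by (subst nn_integral_distr) (auto simp: nn_integral_density)
  have Q2: "(\<integral>\<^sup>+x. h x \<partial>Q2) = (\<integral>\<^sup>+z. w z * h (S z) \<partial>?L)" if [measurable]: "h \<in> borel_measurable ?P" for h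
    unfolding Q2_def by (subst nn_integral_distr) (auto simp: nn_integral_density)
  have "Q1 = Q2"
  proof (rule measure_eqI_PiM_continuous)
    show "sets Q1 = sets ?P" "sets Q2 = sets ?P" by (auto simp: Q1_def Q2_def)
    have "emeasure Q1 (space Q1) = (\<integral>\<^sup>+x. 1 \<partial>Q1)" by simp
    also have "\<dots> = emeasure (leb T \<Otimes>\<^sub>M \<nu>) ?C"
      using nn_integral_emeasure_N_mean[OF Cm] by (subst Q1) (auto simp: N_def)
    finally show "emeasure Q1 (space Q1) < \<infinity>" using jump_region_finite[OF e] by simp
    have "emeasure Q2 (space Q2) = (\<integral>\<^sup>+x. 1 \<partial>Q2)" by simp
    also have "\<dots> = (\<integral>\<^sup>+z. w z \<partial>?L)" by (subst Q2) auto
    also have "\<dots> = (\<integral>\<^sup>+\<omega>. (\<integral>\<^sup>+z. w (\<omega>, z) \<partial>(leb T \<Otimes>\<^sub>M \<nu>)) \<partial>M)"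
      by (rule \<mu>.nn_integral_fst[symmetric]) simp
    also have "\<dots> = emeasure (leb T \<Otimes>\<^sub>M \<nu>) ?C"
      by (simp add: w_def emeasure_space_1)
    finally show "emeasure Q2 (space Q2) < \<infinity>" using jump_region_finite[OF e] by simp
  next
    fix J and g :: "real \<Rightarrow> real \<Rightarrow> real"
    assume J: "finite J" "J \<subseteq> {0..T}" and g: "\<And>t. t \<in> J \<Longrightarrow> continuous_on UNIV (g t) \<and> range (g t) \<subseteq> {0..1}"
    have hm: "(\<lambda>x. ennreal (\<Prod>t\<in>J. g t (x t))) \<in> borel_measurable ?P"
    proof (intro measurable_compose[OF _ measurable_ennreal] borel_measurable_prod)
      fix t assume t: "t \<in> J"
      then have "g t \<in> borel_measurable borel" using g by (auto intro: borel_measurable_continuous_onI)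
      moreover have "(\<lambda>x. x t) \<in> borel_measurable ?P"
        using t J by (auto intro: measurable_component_singleton)
      ultimately show "(\<lambda>x. g t (x t)) \<in> borel_measurable ?P" by (rule measurable_compose[rotated])
    qed
    have "(\<integral>\<^sup>+x. ennreal (\<Prod>t\<in>J. g t (x t)) \<partial>Q1) = (\<integral>\<^sup>+\<omega>. ennreal (\<Prod>t\<in>J. g t (Y \<omega> t)) * N \<omega> \<partial>M)"
      by (simp add: Q1[OF hm] mult.commute)
    also have "\<dots> = (\<integral>\<^sup>+z\<in>?C. (\<integral>\<^sup>+\<omega>. ennreal (\<Prod>t\<in>J. g t (Y \<omega> t + indicator ({0<..t} \<times> UNIV) z * snd z)) \<partial>M) \<partial>(leb T \<Otimes>\<^sub>M \<nu>))"
      using mecke_pair_levy[OF e J] g unfolding mecke_pair_def N_def by simp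
    also have "\<dots> = (\<integral>\<^sup>+z. (\<integral>\<^sup>+\<omega>. w (\<omega>, z) * ennreal (\<Prod>t\<in>J. g t (S (\<omega>, z) t)) \<partial>M) \<partial>(leb T \<Otimes>\<^sub>M \<nu>))"
    proof (rule nn_integral_cong)
      fix z
      show "(\<integral>\<^sup>+\<omega>. ennreal (\<Prod>t\<in>J. g t (Y \<omega> t + indicator ({0<..t} \<times> UNIV) z * snd z)) \<partial>M) * indicator ?C z =
          (\<integral>\<^sup>+\<omega>. w (\<omega>, z) * ennreal (\<Prod>t\<in>J. g t (S (\<omega>, z) t)) \<partial>M)"
      proof (cases "z \<in> ?C")
        case True
        \<comment> \<open>In the region u is positive, so u \<le> t and membership of u in (0,t]
          coincide.\<close>
        then have "S (\<omega>, z) t = Y \<omega> t + indicator ({0<..t} \<times> UNIV) z * snd z" if "t \<in> J" for \<omega> t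
          using that J shift_path_apply[of t] by (cases z) (auto simp: S_def jump_region_def indicator_def)
        then show ?thesis using True by (simp add: w_def cong: prod.cong)
      qed (simp add: w_def)
    qed
    also have "\<dots> = (\<integral>\<^sup>+z. w z * ennreal (\<Prod>t\<in>J. g t (S z t)) \<partial>?L)"
      by (intro nn_integral_snd borel_measurable_times_ennreal wm measurable_compose[OF Sm hm])
    also have "\<dots> = (\<integral>\<^sup>+x. ennreal (\<Prod>t\<in>J. g t (x t)) \<partial>Q2)"
      by (simp add: Q2[OF hm])
    finally show "(\<integral>\<^sup>+x. ennreal (\<Prod>t\<in>J. g t (x t)) \<partial>Q1) = (\<integral>\<^sup>+x. ennreal (\<Prod>t\<in>J. g t (x t)) \<partial>Q2)" .
  qed
  obtain B' where B': "B' \<in> sets ?P" "B = B' \<inter> {x. cadlag_on T x}"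
    using B unfolding DD_def sets_restrict_space by auto
  have [measurable]: "(indicator B' :: _ \<Rightarrow> ennreal) \<in> borel_measurable ?P" using B' by simp
  have "(\<integral>\<^sup>+\<omega>. indicator B (Y \<omega>) * N \<omega> \<partial>M) = (\<integral>\<^sup>+\<omega>. N \<omega> * indicator B' (Y \<omega>) \<partial>M)"
    using Y_path(2) by (intro nn_integral_cong) (auto simp: B' indicator_def)
  also have "\<dots> = (\<integral>\<^sup>+z. w z * indicator B' (S z) \<partial>?L)"
    using Q1[of "indicator B'"] Q2[of "indicator B'"] \<open>Q1 = Q2\<close> by simp
  also have "\<dots> = (\<integral>\<^sup>+z. w z * indicator B (S z) \<partial>?L)"
  proof (rule nn_integral_cong)
    fix z assume "z \<in> space ?L"
    then have "S z \<in> space (DD T)"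
      by (auto simp: S_def space_pair_measure intro!: shift_path_in_DD Y_path)
    then show "w z * indicator B' (S z) = w z * indicator B (S z)"
      by (auto simp: B' space_DD indicator_def)
  qed
  finally show ?thesis by (simp add: N_def w_def S_def)
qed

text \<open>A null set for the law of \<open>Y\<close> makes the left side of the Mecke identity 0,
  so the shifted path avoids \<open>B\<close> for almost all atoms of each region. The regions miss
  only u = 0 and v = 0, null for Lebesgue measure and for \<nu>.\<close>

lemma AE_shift_path:
  assumes B: "B \<in> sets (DD T)" and AE: "AE \<omega> in M. Y \<omega> \<notin> B"
  shows "AE z in M \<Otimes>\<^sub>M (leb T \<Otimes>\<^sub>M \<nu>). (case z of (\<omega>, u, v) \<Rightarrow> shift_path T (Y \<omega>) u v) \<notin> B"
proof -
  let ?L = "M \<Otimes>\<^sub>M (leb T \<Otimes>\<^sub>M \<nu>)"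
  interpret \<mu>: sigma_finite_measure "leb T \<Otimes>\<^sub>M \<nu>" by (rule sigma_finite_leb_levy[OF \<nu>])
  interpret n: sigma_finite_measure \<nu> by (rule sigma_finite_levy_measure[OF \<nu>])
  define S where "S z = (case z of (\<omega>, u, v) \<Rightarrow> shift_path T (Y \<omega>) u v)" for z
  have [measurable]: "S \<in> measurable ?L (DD T)" using measurable_shift by (simp add: S_def[abs_def])
  note [measurable] = B jump_region_sets
  have 1: "AE z in ?L. snd z \<in> jump_region (1 / real (Suc n)) \<longrightarrow> S z \<notin> B" for n
  proof -
    let ?C = "jump_region (1 / real (Suc n))"
    have "(\<integral>\<^sup>+\<omega>. indicator B (Y \<omega>) * emeasure (jump_measure T (Y \<omega>)) ?C \<partial>M) = (\<integral>\<^sup>+\<omega>. 0 \<partial>M)"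
      using AE by (intro nn_integral_cong_AE) (auto elim!: eventually_mono)
    then have "(\<integral>\<^sup>+z. indicator ?C (snd z) * indicator B (S z) \<partial>?L) = 0"
      using mecke_levy_eq[of "1 / real (Suc n)", OF _ B] by (simp add: S_def)
    then have "AE z in ?L. indicator ?C (snd z) * indicator B (S z) = (0 :: ennreal)"
      by (subst (asm) nn_integral_0_iff_AE) auto
    then show ?thesis
      by eventually_elim (auto simp: indicator_def split: if_splits)
  qed
  have u: "AE u in leb T. u \<noteq> 0"
  proof (rule AE_I[where N = "{0}"])
    show "emeasure (leb T) {0} = 0"
      using T by (subst emeasure_restrict_space) auto
  qed (use T sets_leb_interval[of "{0}" T] in auto)
  have v: "AE v in \<nu>. v \<noteq> 0"
    using \<nu> by (intro AE_I[where N = "{0}"]) (auto simp: levy_measure_def)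
  have "AE p in leb T \<Otimes>\<^sub>M \<nu>. fst p \<noteq> 0 \<and> snd p \<noteq> 0"
    using AE_pair_fst[OF n.sigma_finite_measure_axioms u] AE_pair_snd[OF n.sigma_finite_measure_axioms v]
    by eventually_elim simp
  then have 2: "AE z in ?L. fst (snd z) \<noteq> 0 \<and> snd (snd z) \<noteq> 0"
    by (rule AE_pair_snd[OF \<mu>.sigma_finite_measure_axioms])
  have "AE z in ?L. \<forall>n. snd z \<in> jump_region (1 / real (Suc n)) \<longrightarrow> S z \<notin> B"
    using 1 unfolding AE_all_countable by blast
  with 2 AE_space have "AE z in ?L. S z \<notin> B"
  proof eventually_elim
    case (elim z)
    obtain \<omega> u v where z: "z = (\<omega>, u, v)" by (cases z)
    then obtain n where "1 / real (Suc n) < \<bar>v\<bar>"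
      using elim nat_approx_posE[of "\<bar>v\<bar>"] by auto
    then have "snd z \<in> jump_region (1 / real (Suc n))"
      using elim z by (auto simp: jump_region_def space_pair_measure space_restrict_space)
    then show ?case using elim by blast
  qed
  then show ?thesis by (simp add: S_def)
qed

end

section \<open>Representing functionals and the derivative of the solution\<close>

lemma path_add_malliavin_path:
  assumes "h = \<phi> (Y \<omega>)" "\<phi> (shift_path T (Y \<omega>) u v) \<in> space (DD T)"
  shows "path_add T h (malliavin_path T Y \<phi> u v \<omega>) = \<phi> (shift_path T (Y \<omega>) u v)"
  using assms
  by (auto simp: path_add_def malliavin_path_def path_diff_def space_DD extensional_def fun_eq_iff)

context pure_jump_levy
begin

lemma measurable_malliavin_diff:
  assumes \<psi>: "\<psi> \<in> borel_measurable (DD T)"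
  shows "malliavin_diff T Y \<psi> \<in> borel_measurable (M \<Otimes>\<^sub>M (leb T \<Otimes>\<^sub>M \<nu>))"
proof -
  have "(\<lambda>z. \<psi> (case z of (\<omega>, u, v) \<Rightarrow> shift_path T (Y \<omega>) u v) - \<psi> (Y (fst z)))
      \<in> borel_measurable (M \<Otimes>\<^sub>M (leb T \<Otimes>\<^sub>M \<nu>))"
    by (intro borel_measurable_diff measurable_compose[OF measurable_shift \<psi>]
        measurable_compose[OF measurable_compose[OF measurable_fst measurable_Y] \<psi>])
  then show ?thesis by (simp add: malliavin_diff_def case_prod_beta')
qed

text \<open>Two functionals for \<open>Z\<close> differ on a path set \<open>B\<close> that is null
  for the law of \<open>Y\<close>. The unshifted terms then agree almost surely, and
  \<open>AE_shift_path\<close> gives the same for the shifted ones.\<close>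

lemma malliavin_diff_unique:
  assumes "represents T M Y \<psi> Z" "represents T M Y \<psi>' Z"
  shows "AE z in M \<Otimes>\<^sub>M (leb T \<Otimes>\<^sub>M \<nu>). malliavin_diff T Y \<psi> z = malliavin_diff T Y \<psi>' z"
proof -
  let ?L = "M \<Otimes>\<^sub>M (leb T \<Otimes>\<^sub>M \<nu>)"
  have m: "\<psi> \<in> borel_measurable (DD T)" "\<psi>' \<in> borel_measurable (DD T)"
    and AE: "AE \<omega> in M. Z \<omega> = \<psi> (Y \<omega>)" "AE \<omega> in M. Z \<omega> = \<psi>' (Y \<omega>)"
    using assms by (auto simp: represents_def)
  define B where "B = {y\<in>space (DD T). \<psi> y \<noteq> \<psi>' y}"
  have B: "B \<in> sets (DD T)" unfolding B_def using m by (rule borel_measurable_neq)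
  have Y: "AE \<omega> in M. \<psi> (Y \<omega>) = \<psi>' (Y \<omega>)" using AE by eventually_elim simp
  then have "AE \<omega> in M. Y \<omega> \<notin> B" by eventually_elim (simp add: B_def)
  from AE_shift_path[OF B this] AE_pair_fst[OF sigma_finite_leb_levy[OF \<nu>] Y] AE_space
  show ?thesis
  proof eventually_elim
    case (elim z)
    then show ?case
      by (cases z) (auto simp: malliavin_diff_def B_def space_pair_measure shift_path_in_DD Y_path)
  qed
qed

end

theorem theorem4p2:
  fixes T :: real
    and M :: "'a measure" and F :: "real \<Rightarrow> 'a measure" and \<nu> :: "real measure"
    and Y H G X :: "'a \<Rightarrow> real \<Rightarrow> real"
    and f :: "real \<Rightarrow> (real \<Rightarrow> real) \<Rightarrow> (real \<Rightarrow> real) \<Rightarrow> real"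
    and \<Psi> :: "(real \<Rightarrow> real) \<Rightarrow> (real \<Rightarrow> real) \<Rightarrow> (real \<Rightarrow> real) \<Rightarrow> real \<Rightarrow> real"
    and \<phi>H \<phi>G :: "(real \<Rightarrow> real) \<Rightarrow> real \<Rightarrow> real"
  defines "g \<equiv> left_lim_coeff f"
    and "R \<equiv> (\<lambda>t. \<lambda>(\<omega>, u, v).
           \<Psi> (path_add T (H \<omega>) (malliavin_path T Y \<phi>H u v \<omega>))
             (path_add T (G \<omega>) (malliavin_path T Y \<phi>G u v \<omega>))
             (shift_path T (Y \<omega>) u v) t
           - \<Psi> (H \<omega>) (G \<omega>) (Y \<omega>) t)"
  assumes "0 < T"
    and "usual_filtered_space T M F"
    and "pure_jump_levy_process T M F \<nu> Y"
    and "generated_by T M Y"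
    and "coefficient_conditions T f"
    and "universal_representation TYPE('a) T g \<Psi>"
    and "cadlag_adapted T M F H" and "cadlag_adapted T M F G"
    and "path_represents T M Y \<phi>H H" and "path_represents T M Y \<phi>G G"
    and "\<forall>t\<in>{0..T}. (\<lambda>\<omega>. H \<omega> t) \<in> malliavin_domain T M \<nu> Y"
    and "\<forall>t\<in>{0..T}. (\<lambda>\<omega>. G \<omega> t) \<in> malliavin_domain T M \<nu> Y"
    and "sde_solution T M F g H G Y X"
    and "\<forall>t\<in>{0..T}. square_integrable M (\<lambda>\<omega>. X \<omega> t)"
  shows "\<forall>t\<in>{0..T}. square_integrable (M \<Otimes>\<^sub>M (leb T \<Otimes>\<^sub>M \<nu>)) (R t) \<longrightarrow>
           has_malliavin_deriv T M \<nu> Y (\<lambda>\<omega>. X \<omega> t) (R t)"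
proof (intro ballI impI)
  interpret pure_jump_levy T M F \<nu> Y
    by unfold_locales fact+
  let ?L = "M \<Otimes>\<^sub>M (leb T \<Otimes>\<^sub>M \<nu>)"
  note ur = \<open>universal_representation TYPE('a) T g \<Psi>\<close>[unfolded universal_representation_def]
  have \<Psi>: "(\<lambda>(h, \<zeta>, y). \<Psi> h \<zeta> y) \<in> measurable (DD T \<Otimes>\<^sub>M (DD T \<Otimes>\<^sub>M DD T)) (DD T)"
    using ur by (rule conjunct1)
  have X: "AE \<omega> in M. \<forall>t\<in>{0..T}. X \<omega> t = \<Psi> (H \<omega>) (G \<omega>) (Y \<omega>) t"
    using ur[THEN conjunct2, rule_format, of M F H G Y] usual semimartingale_Y
      \<open>cadlag_adapted T M F H\<close> \<open>cadlag_adapted T M F G\<close> \<open>sde_solution T M F g H G Y X\<close> by blast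
  have \<phi>: "\<phi>H \<in> measurable (DD T) (DD T)" "\<phi>G \<in> measurable (DD T) (DD T)"
    and HG: "AE \<omega> in M. H \<omega> = \<phi>H (Y \<omega>)" "AE \<omega> in M. G \<omega> = \<phi>G (Y \<omega>)"
    using \<open>path_represents T M Y \<phi>H H\<close> \<open>path_represents T M Y \<phi>G G\<close> by (auto simp: path_represents_def)
  fix t assume t: "t \<in> {0..T}" and R: "square_integrable ?L (R t)"
  define \<psi> where "\<psi> y = \<Psi> (\<phi>H y) (\<phi>G y) y t" for y
  have \<psi>m: "\<psi> \<in> borel_measurable (DD T)"
  proof -
    have "(\<lambda>y. (\<phi>H y, \<phi>G y, y)) \<in> measurable (DD T) (DD T \<Otimes>\<^sub>M (DD T \<Otimes>\<^sub>M DD T))"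
      by (intro measurable_Pair \<phi> measurable_ident_sets refl)
    from measurable_compose[OF measurable_compose[OF this \<Psi>] measurable_DD_eval[OF t]]
    show ?thesis by (simp add: \<psi>_def[abs_def])
  qed
  have rep: "represents T M Y \<psi> (\<lambda>\<omega>. X \<omega> t)"
    unfolding represents_def
  proof
    show "AE \<omega> in M. X \<omega> t = \<psi> (Y \<omega>)"
      using X HG by eventually_elim (use t in \<open>simp add: \<psi>_def\<close>)
  qed (rule \<psi>m)
  \<comment> \<open>The representations of \<open>H\<close> and \<open>G\<close> fail only on a null
    set of \<omega>, which is independent of (u,v) and thus null in the product.\<close>
  have R_eq: "AE z in ?L. malliavin_diff T Y \<psi> z = R t z"
    using AE_pair_fst[OF sigma_finite_leb_levy[OF \<nu>] HG(1)] AE_pair_fst[OF sigma_finite_leb_levy[OF \<nu>] HG(2)] AE_space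
  proof eventually_elim
    case (elim z)
    obtain \<omega> u v where z: "z = (\<omega>, u, v)" by (cases z)
    have \<omega>: "\<omega> \<in> space M" using elim z by (auto simp: space_pair_measure)
    have S: "shift_path T (Y \<omega>) u v \<in> space (DD T)"
      by (rule shift_path_in_DD[OF Y_path(2)[OF \<omega>]])
    \<comment> \<open>Adding the path-valued derivative back cancels the unshifted path;
      extensionality settles the arguments off [0,T].\<close>
    have "path_add T (H \<omega>) (malliavin_path T Y \<phi>H u v \<omega>) = \<phi>H (shift_path T (Y \<omega>) u v)"
      "path_add T (G \<omega>) (malliavin_path T Y \<phi>G u v \<omega>) = \<phi>G (shift_path T (Y \<omega>) u v)"
      using elim z measurable_space[OF \<phi>(1) S] measurable_space[OF \<phi>(2) S]
      by (auto intro!: path_add_malliavin_path)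
    then show ?case
      using elim z by (simp add: R_def malliavin_diff_def \<psi>_def)
  qed
  \<comment> \<open>The domain asks for one functional with a square integrable difference; this one
    inherits the property from \<open>R t\<close>.\<close>
  have "square_integrable ?L (malliavin_diff T Y \<psi>)"
    unfolding square_integrable_def
  proof
    show m: "malliavin_diff T Y \<psi> \<in> borel_measurable ?L" by (rule measurable_malliavin_diff[OF \<psi>m])
    show "integrable ?L (\<lambda>z. (malliavin_diff T Y \<psi> z)\<^sup>2)"
    proof (rule integrable_cong_AE_imp)
      show "integrable ?L (\<lambda>z. (R t z)\<^sup>2)" using R by (simp add: square_integrable_def)
      show "AE z in ?L. (R t z)\<^sup>2 = (malliavin_diff T Y \<psi> z)\<^sup>2"
        using R_eq by eventually_elim simp
    qed (use m in measurable)
  qed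
  with rep have "(\<lambda>\<omega>. X \<omega> t) \<in> malliavin_domain T M \<nu> Y"
    using \<open>\<forall>t\<in>{0..T}. square_integrable M (\<lambda>\<omega>. X \<omega> t)\<close> t by (auto simp: malliavin_domain_def)
  moreover have "AE z in ?L. malliavin_diff T Y \<psi>' z = R t z" if "represents T M Y \<psi>' (\<lambda>\<omega>. X \<omega> t)" for \<psi>'
    using malliavin_diff_unique[OF that rep] R_eq by eventually_elim simp
  ultimately show "has_malliavin_deriv T M \<nu> Y (\<lambda>\<omega>. X \<omega> t) (R t)"
    by (simp add: has_malliavin_deriv_def)
qed

end
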